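(* Let $E_1\subset E_2$ be subsets of the unit circle $T$ and suppose that the measure of $E_2$ is $2\pi$. Then there exists a function $f\in H^\infty$ such that the set of points of $T$ at which the radial limit of $f$ fails to exist is exactly $E_1$, and the set of points of $T$ at which $f$ has a vanishing unrestricted limit is exactly $T\setminus E_2$, if and only if both of the following conditions hold: (1) $E_1$ is of type $G_{\delta\sigma}$ and of measure zero; (2) $E_2$ is of type $F_\sigma$.
   Context: $D=\{z\in\mathbb{C}:|z|<1\}$ is the open unit disc and $T=\{z\in\mathbb{C}:|z|=1\}$ is the unit circle, with measure meaning arc-length (Lebesgue) measure of total mass $2\pi$. $H^\infty$ is the set of bounded analytic functions on $D$. For $\zeta\in T$, the radial limit of $f$ at $\zeta$ is $\lim_{r\to 1^-}f(r\zeta)$ (when it exists in $\mathbb{C}$). The function $f$ has an unrestricted limit $L$ at $\zeta$ if $f(z)\to L$ as $z\to\zeta$ with $z\in D$ (no restriction on the manner of approach within $D$); the unrestricted limit is vanishing if $L=0$. A subset of $T$ is of type $F_\sigma$ if it is a countable union of closed sets, of type $G_\delta$ if it is a countable intersection of (relatively) open subsets of $T$, and of type $G_{\delta\sigma}$ if it is a countable union of sets of type $G_\delta$. *)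

theory Defs
  imports "HOL-Analysis.Analysis"
begin

abbreviation unit_disc :: "complex set" where
  "unit_disc \<equiv> ball 0 1"

abbreviation unit_circle :: "complex set" where
  "unit_circle \<equiv> sphere 0 1"

(* Completed, so that the measurable sets are all Lebesgue measurable subsets of the circle,
   not only the Borel ones. *)
definition arc_length :: "complex measure" where
  "arc_length =
     completion (distr (restrict_space lborel {0..<2 * pi}) (restrict_space borel unit_circle) cis)"

lemma space_arc_length [simp]: "space arc_length = unit_circle"
  by (simp add: arc_length_def space_restrict_space)

lemma cis_measurable_unit_circle:
  "cis \<in> restrict_space lborel {0..<2 * pi} \<rightarrow>\<^sub>M restrict_space borel unit_circle"
proof (rule measurable_restrict_space2)
  have "cis \<in> borel_measurable lborel"
    by (simp add: borel_measurable_continuous_onI continuous_on_cis)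
  then show "cis \<in> borel_measurable (restrict_space lborel {0..<2 * pi})"
    by (rule measurable_restrict_space1)
qed auto

lemma emeasure_arc_length_unit_circle: "emeasure arc_length unit_circle = ennreal (2 * pi)"
proof -
  let ?A = "restrict_space lborel {0..<2 * pi}"
  let ?B = "restrict_space borel unit_circle"
  have B: "unit_circle \<in> sets ?B"
    using sets.top[of ?B] by (simp add: space_restrict_space)
  have "emeasure arc_length unit_circle = emeasure (distr ?A ?B cis) unit_circle"
    unfolding arc_length_def using B by simp
  also have "\<dots> = emeasure ?A (cis -` unit_circle \<inter> space ?A)"
    by (rule emeasure_distr[OF cis_measurable_unit_circle B])
  also have "cis -` unit_circle \<inter> space ?A = {0..<2 * pi}"
    by (auto simp: space_restrict_space)
  also have "emeasure ?A {0..<2 * pi} = ennreal (2 * pi)"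
    by (subst emeasure_restrict_space) auto
  finally show ?thesis .
qed

(* Elements are functions on the whole plane; only their values on the disc are constrained. *)
definition H_infinity :: "(complex \<Rightarrow> complex) set" where
  "H_infinity = {f. f holomorphic_on unit_disc \<and> bounded (f ` unit_disc)}"

definition has_radial_limit :: "(complex \<Rightarrow> complex) \<Rightarrow> complex \<Rightarrow> complex \<Rightarrow> bool" where
  "has_radial_limit f L \<zeta> \<longleftrightarrow> ((\<lambda>r. f (complex_of_real r * \<zeta>)) \<longlongrightarrow> L) (at_left 1)"

definition has_unrestricted_limit :: "(complex \<Rightarrow> complex) \<Rightarrow> complex \<Rightarrow> complex \<Rightarrow> bool" where
  "has_unrestricted_limit f L \<zeta> \<longleftrightarrow> (f \<longlongrightarrow> L) (at \<zeta> within unit_disc)"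

definition gdelta_sigma_in :: "'a topology \<Rightarrow> 'a set \<Rightarrow> bool" where
  "gdelta_sigma_in X = countable union_of gdelta_in X"

end

theory Submission
  imports Defs "HOL-Complex_Analysis.Complex_Analysis"
begin

text \<open>
  The key step: for a null \<open>G\<^sub>\<delta>\<close> set \<open>E\<close> there is a holomorphic \<open>W\<close> with \<open>Re W \<ge> 0\<close> on the disc that tends
  to infinity at every point of \<open>E\<close> and has a finite radial limit at every other point of the circle.
  Then \<open>(1 + W)\<^sup>i\<close> is bounded and has no radial limit exactly on \<open>E\<close>; a rapidly decreasing combination
  \<open>h\<close> of such functions handles a \<open>G\<^sub>\<delta>\<^sub>\<sigma>\<close> set, and \<open>(h + 3) / (1 + W)\<close>, with \<open>W\<close> belonging to the
  complement of \<open>E2\<close>, has the prescribed behaviour.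

  To construct \<open>W\<close>, let \<open>H U\<close> be the Herglotz integral of the indicator function of an open set \<open>U\<close>.
  The bounded function \<open>H U / (1 + H U)\<close> is close to \<open>1/2\<close> near the points of \<open>U\<close> and small far from \<open>U\<close>, but it may
  fail to have radial limits on a null subset of the boundary of \<open>U\<close>. By Fatou's theorem this bad set is
  null, so between two open sets one can insert a third that covers the bad set of the smaller one.
  Iterating over the dyadic rationals gives a decreasing family \<open>V s\<close>, \<open>s \<ge> 0\<close>, of open sets shrinking
  to \<open>E\<close>, in which every point of the circle is bad for at most one \<open>s\<close>. Hence
  \<open>W = \<integral> H (V s) / (1 + H (V s)) ds\<close> has a radial limit everywhere outside \<open>E\<close>, by dominated convergence.

  Fatou's theorem itself follows from the weak-type inequality for the radial maximal function and
  Parseval's identity. It also shows that \<open>E1\<close> must be null.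
\<close>

section \<open>Arc-length measure on the circle and the Poisson integral\<close>

text \<open>The obstacle is that W must have a finite radial limit at every point outside E, while
  each open set used near E brings its own bad boundary points; a countable sum of such functions
  can keep every one of them bad. Hence the continuous parameter: a point that is bad for a single
  \<open>s\<close> is lost in an integral over \<open>s\<close>. The bad parameter is unique because
  the bad set of \<open>V t\<close> lies in \<open>V s\<close> for every \<open>s < t\<close>, and a
  point of the open set \<open>V s\<close> is good for \<open>s\<close>. The quotient w / (1 + w)
  replaces w because the imaginary part of a Herglotz integral can blow up: on the right half-plane
  the quotient is bounded by 1, so Fatou's theorem applies to it and the integral over
  \<open>s\<close> can be dominated, while its real part stays nonnegative and is at least 1/3 where
  Re w is at least 1/2. Smallness away from E is measured by the integral of 1 / |x - \<zeta>|,
  which bounds the Herglotz integral along the whole radius to \<zeta>. The constant 3 in the last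
  formula keeps the numerator away from zero, since |h| is at most 2.\<close>

text \<open>Arc length as a Borel measure on the whole plane: integrands need no restriction to the
  circle, and open or closed sets of the plane are measurable as they stand. The points off the
  circle form a null set.\<close>

definition circle_measure :: "complex measure" where
  "circle_measure = distr (restrict_space lborel {0..<2 * pi}) borel cis"

lemma cis_measurable [measurable]: "cis \<in> borel_measurable borel"
  by (simp add: borel_measurable_continuous_onI continuous_on_cis)

lemma cis_measurable_restrict: "cis \<in> restrict_space lborel S \<rightarrow>\<^sub>M borel"
  by (rule measurable_restrict_space1) simp

lemma sets_circle_measure [simp, measurable_cong]: "sets circle_measure = sets borel"
  by (simp add: circle_measure_def)

lemma space_circle_measure [simp]: "space circle_measure = UNIV"
  by (simp add: circle_measure_def)

lemma emeasure_circle_measure: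
  assumes "A \<in> sets borel"
  shows "emeasure circle_measure A = emeasure lborel ({0..<2 * pi} \<inter> cis -` A)"
proof -
  have "emeasure circle_measure A
      = emeasure (restrict_space lborel {0..<2 * pi}) (cis -` A \<inter> space (restrict_space lborel {0..<2 * pi}))"
    unfolding circle_measure_def by (rule emeasure_distr[OF cis_measurable_restrict assms])
  also have "\<dots> = emeasure lborel ({0..<2 * pi} \<inter> cis -` A)"
    by (subst emeasure_restrict_space) (auto simp: space_restrict_space Int_commute)
  finally show ?thesis .
qed

lemma emeasure_circle_measure_UNIV: "emeasure circle_measure UNIV = ennreal (2 * pi)"
  by (simp add: emeasure_circle_measure)

interpretation circle_measure: finite_measure circle_measure
  by standard (simp add: emeasure_circle_measure_UNIV)

lemma AE_circle_measure: "AE x in circle_measure. norm x = 1"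
proof (rule AE_I')
  have "{0..<2 * pi} \<inter> cis -` (UNIV - sphere 0 1) = {}"
    by auto
  then show "UNIV - sphere 0 1 \<in> null_sets circle_measure"
    by (auto simp: null_sets_def emeasure_circle_measure)
qed auto

text \<open>The bridge to \<open>arc_length\<close>: both measures agree on Borel subsets of the
  circle, and a set is null for a completion exactly when a measurable null set covers it. A cover
  in the plane is cut down to the circle.\<close>

lemma null_sets_arc_length_iff:
  assumes "N \<subseteq> unit_circle"
  shows "N \<in> null_sets arc_length \<longleftrightarrow> (\<exists>B \<in> null_sets circle_measure. N \<subseteq> B)"
proof -
  let ?D = "distr (restrict_space lborel {0..<2 * pi}) (restrict_space borel unit_circle) cis"
  have em: "emeasure ?D A = emeasure circle_measure A"
    if "A \<in> sets borel" "A \<subseteq> unit_circle" for A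
  proof -
    have A: "A \<in> sets (restrict_space borel unit_circle)"
      using that by (auto simp: sets_restrict_space_iff)
    have "emeasure ?D A
        = emeasure (restrict_space lborel {0..<2 * pi}) (cis -` A \<inter> space (restrict_space lborel {0..<2 * pi}))"
      by (rule emeasure_distr[OF cis_measurable_unit_circle A])
    also have "\<dots> = emeasure circle_measure A"
      unfolding circle_measure_def
      by (rule emeasure_distr[OF cis_measurable_restrict that(1), symmetric])
    finally show ?thesis .
  qed
  have "N \<in> null_sets arc_length \<longleftrightarrow> (\<exists>B \<in> null_sets ?D. N \<subseteq> B)"
    unfolding arc_length_def by (rule null_sets_completion_iff2)
  also have "\<dots> \<longleftrightarrow> (\<exists>B \<in> null_sets circle_measure. N \<subseteq> B)"
  proof safe
    fix B assume B: "B \<in> null_sets ?D" "N \<subseteq> B"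
    then have "B \<in> sets (restrict_space borel unit_circle)"
      by (auto dest: null_setsD2)
    then have "B \<in> sets borel" "B \<subseteq> unit_circle"
      by (auto simp: sets_restrict_space_iff)
    with B em[of B] show "\<exists>B \<in> null_sets circle_measure. N \<subseteq> B"
      by (intro bexI[of _ B]) (auto simp: null_sets_def)
  next
    fix B assume B: "B \<in> null_sets circle_measure" "N \<subseteq> B"
    then have Bb: "B \<in> sets borel"
      using null_setsD2 by fastforce
    have "B \<inter> unit_circle \<in> null_sets circle_measure"
      using B(1) by (intro null_set_Int2) auto
    then have "emeasure ?D (B \<inter> unit_circle) = 0"
      using em[of "B \<inter> unit_circle"] Bb by (auto simp: null_sets_def)
    then have "B \<inter> unit_circle \<in> null_sets ?D"
      using Bb by (auto simp: null_sets_def sets_restrict_space_iff)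
    with B(2) assms show "\<exists>B \<in> null_sets ?D. N \<subseteq> B"
      by blast
  qed
  finally show ?thesis .
qed

lemma integral_circle_measure:
  fixes f :: "complex \<Rightarrow> 'b::{banach, second_countable_topology}"
  assumes [measurable]: "f \<in> borel_measurable borel"
  shows "(\<integral>x. f x \<partial>circle_measure) = (LINT t:{0..<2*pi}|lborel. f (cis t))"
  unfolding circle_measure_def set_lebesgue_integral_def
  by (subst integral_distr[OF cis_measurable_restrict assms]) (subst integral_restrict_space, auto)

lemma AE_lborel_Ico_Icc: "AE t in lborel. indicator {a..<b} t *\<^sub>R g t = indicator {a..b::real} t *\<^sub>R (g t :: 'b::real_vector)"
proof (rule AE_I')
  show "{b} \<in> null_sets lborel" by (simp add: null_sets_def)
qed (auto simp: indicator_def)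

lemma integral_circle_measure_eq_integral:
  fixes f :: "complex \<Rightarrow> 'b::euclidean_space"
  assumes "f \<in> borel_measurable borel" and cont: "continuous_on unit_circle f"
  shows "(\<integral>x. f x \<partial>circle_measure) = integral {0..2*pi} (\<lambda>t. f (cis t))"
proof -
  have c: "continuous_on {0..2*pi} (\<lambda>t. f (cis t))"
    by (rule continuous_on_compose2[OF cont]) (auto intro: continuous_intros)
  then have si: "set_integrable lborel {0..2*pi} (\<lambda>t. f (cis t))"
    by (rule borel_integrable_atLeastAtMost')
  have [measurable]: "f \<in> borel_measurable borel" by fact
  have "(\<integral>x. f x \<partial>circle_measure) = (LINT t:{0..<2*pi}|lborel. f (cis t))"
    by (rule integral_circle_measure) fact
  also have "\<dots> = (LINT t:{0..2*pi}|lborel. f (cis t))"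
    unfolding set_lebesgue_integral_def by (intro integral_cong_AE AE_lborel_Ico_Icc) auto
  also have "\<dots> = integral {0..2*pi} (\<lambda>t. f (cis t))"
    by (rule set_borel_integral_eq_integral[OF si])
  finally show ?thesis .
qed

section \<open>The Cauchy and Poisson formulas on the unit circle\<close>

lemma Cauchy_integral_cis:
  fixes f :: "complex \<Rightarrow> complex"
  assumes contf: "continuous_on (cball 0 1) f" and holf: "f holomorphic_on ball 0 1" and z: "norm z < 1"
  shows "((\<lambda>t. f (cis t) * cis t / (cis t - z)) has_integral 2 * pi * f z) {0..2*pi}"
proof -
  have "((\<lambda>u. f u/(u-z)) has_contour_integral (2 * of_real pi * \<i> * f z)) (circlepath 0 1)"
    using Cauchy_integral_circlepath[OF contf holf, of z] z by simp
  then have "((\<lambda>t. f (0 + of_real 1 * cis t) / (0 + of_real 1 * cis t - z) * of_real 1 * \<i> * cis t)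
      has_integral (2 * of_real pi * \<i> * f z)) {0..2*pi}"
    unfolding circlepath_def by (subst (asm) has_contour_integral_part_circlepath_iff) auto
  from has_integral_mult_right[OF this, of "-\<i>"]
  show ?thesis by (simp add: field_simps)
qed

text \<open>The factor \<open>(1 - |z|\<^sup>2) / (1 - cnj z * u)\<close> turns the Cauchy kernel at \<open>z\<close> into the Poisson kernel.\<close>

lemma Poisson_integral_cis:
  fixes f :: "complex \<Rightarrow> complex"
  assumes contf: "continuous_on (cball 0 1) f" and holf: "f holomorphic_on ball 0 1" and z: "norm z < 1"
  shows "((\<lambda>t. f (cis t) * of_real ((1 - (norm z)\<^sup>2) / (norm (cis t - z))\<^sup>2)) has_integral 2 * pi * f z) {0..2*pi}"
proof -
  define g where "g = (\<lambda>u. f u * (1 - of_real ((norm z)\<^sup>2)) / (1 - cnj z * u))"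
  have nz: "1 - cnj z * u \<noteq> 0" if "norm u \<le> 1" for u
  proof
    assume "1 - cnj z * u = 0"
    then have "norm (cnj z * u) = 1" by simp
    moreover have "norm (cnj z * u) < 1"
      using z that by (simp add: norm_mult) (metis mult_le_one mult_left_le norm_ge_zero order_le_less_trans)
    ultimately show False by simp
  qed
  have 1: "continuous_on (cball 0 1) g"
    unfolding g_def using nz by (intro continuous_intros contf) auto
  have 2: "g holomorphic_on ball 0 1"
    unfolding g_def using nz by (intro holomorphic_intros holf) auto
  have gz: "g z = f z"
  proof -
    have "1 - of_real ((norm z)\<^sup>2) = 1 - cnj z * z"
      using complex_norm_square[of z] by (simp add: mult.commute)
    then show ?thesis unfolding g_def using nz[of z] z by simp
  qed
  have eq: "g (cis t) * cis t / (cis t - z) = f (cis t) * of_real ((1 - (norm z)\<^sup>2) / (norm (cis t - z))\<^sup>2)" for t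
  proof -
    have ne: "cis t - z \<noteq> 0" using z by (metis eq_iff_diff_eq_0 less_irrefl norm_cis)
    have "of_real ((norm (cis t - z))\<^sup>2) = (cis t - z) * cnj (cis t - z)"
      by (rule complex_norm_square)
    also have "cnj (cis t - z) = (1 - cnj z * cis t) / cis t"
      by (simp add: field_simps cis_cnj cis_mult)
    finally have N: "of_real ((norm (cis t - z))\<^sup>2) = (cis t - z) * ((1 - cnj z * cis t) / cis t)" .
    have "complex_of_real ((1 - (norm z)\<^sup>2) / (norm (cis t - z))\<^sup>2)
        = (1 - of_real ((norm z)\<^sup>2)) / ((cis t - z) * ((1 - cnj z * cis t) / cis t))"
      unfolding N[symmetric] by simp
    then show ?thesis
      unfolding g_def by (simp add: mult_ac)
  qed
  show ?thesis
    using Cauchy_integral_cis[OF 1 2 z] unfolding eq gz .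
qed

section \<open>Dominated convergence for a parameter tending to a point\<close>

lemma dominated_convergence_within:
  fixes f :: "'c::first_countable_topology \<Rightarrow> 'a \<Rightarrow> 'b::{banach, second_countable_topology}"
  assumes meas: "\<And>y. y \<in> S \<Longrightarrow> f y \<in> borel_measurable M" "g \<in> borel_measurable M"
    and w: "integrable M w"
    and lim: "AE x in M. ((\<lambda>y. f y x) \<longlongrightarrow> g x) (at a within S)"
    and bound: "\<And>y. y \<in> S \<Longrightarrow> AE x in M. norm (f y x) \<le> w x"
  shows "((\<lambda>y. \<integral>x. f y x \<partial>M) \<longlongrightarrow> (\<integral>x. g x \<partial>M)) (at a within S)"
  unfolding tendsto_at_iff_sequentially comp_def
proof (intro allI impI)
  fix X assume X: "\<forall>i. X i \<in> S - {a}" "X \<longlonglongrightarrow> a"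
  show "(\<lambda>i. \<integral>x. f (X i) x \<partial>M) \<longlonglongrightarrow> (\<integral>x. g x \<partial>M)"
  proof (rule integral_dominated_convergence[OF _ _ w])
    show "AE x in M. (\<lambda>i. f (X i) x) \<longlonglongrightarrow> g x"
      using lim by eventually_elim (use X in \<open>auto simp: tendsto_at_iff_sequentially comp_def\<close>)
  qed (use X meas bound in auto)
qed

text \<open>For use when the pointwise limit has no formula. The candidate limit function is defined
  along one fixed sequence \<open>X\<close>, which makes it measurable; where the full limit exists,
  it agrees with the limit along \<open>X\<close>.\<close>

lemma dominated_convergence_within_ex:
  fixes f :: "'c::first_countable_topology \<Rightarrow> 'a \<Rightarrow> 'b::{banach, second_countable_topology}"
  assumes meas: "\<And>y. y \<in> S \<Longrightarrow> f y \<in> borel_measurable M"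
    and w: "integrable M w"
    and nt: "at a within S \<noteq> bot"
    and lim: "AE x in M. \<exists>l. ((\<lambda>y. f y x) \<longlongrightarrow> l) (at a within S)"
    and bound: "\<And>y. y \<in> S \<Longrightarrow> AE x in M. norm (f y x) \<le> w x"
  shows "\<exists>L. ((\<lambda>y. \<integral>x. f y x \<partial>M) \<longlongrightarrow> L) (at a within S)"
proof -
  obtain X where X: "\<And>i. X i \<in> S - {a}" "X \<longlonglongrightarrow> a"
  proof -
    have "a \<in> closure (S - {a})"
      using nt by (metis at_within_eq_bot_iff)
    then obtain X where "\<forall>i. X i \<in> S - {a}" "X \<longlonglongrightarrow> a"
      unfolding closure_sequential by blast
    then show ?thesis using that by blast
  qed
  define g where "g x = lim (\<lambda>i. f (X i) x)" for x
  have "((\<lambda>y. \<integral>x. f y x \<partial>M) \<longlongrightarrow> (\<integral>x. g x \<partial>M)) (at a within S)"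
  proof (rule dominated_convergence_within[OF meas _ w _ bound])
    show "g \<in> borel_measurable M"
      unfolding g_def using X meas by (intro borel_measurable_lim_metric) auto
    show "AE x in M. ((\<lambda>y. f y x) \<longlongrightarrow> g x) (at a within S)"
      using lim
    proof eventually_elim
      case (elim x)
      then obtain l where l: "((\<lambda>y. f y x) \<longlongrightarrow> l) (at a within S)" by blast
      then have "(\<lambda>i. f (X i) x) \<longlonglongrightarrow> l"
        using X unfolding tendsto_at_iff_sequentially by (auto simp: o_def)
      then show ?case using l by (simp add: g_def limI)
    qed
  qed
  then show ?thesis ..
qed

section \<open>The radial maximal function\<close>

text \<open>The half \<open>{pi..2*pi}\<close> is reflected onto \<open>{0..pi}\<close>, where the
  Poisson kernel is monotone.\<close>

lemma integral_fold_half_period: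
  fixes g :: "real \<Rightarrow> real"
  assumes cont: "continuous_on UNIV g"
  shows "integral {0..2*pi} g = integral {0..pi} (\<lambda>t. g t + g (2*pi - t))"
proof -
  have int: "g integrable_on {a..b}" for a b
    by (intro integrable_continuous_real continuous_on_subset[OF cont]) auto
  have "(g has_integral integral {pi..2*pi} g) (cbox pi (2*pi))"
    using int[of pi "2*pi"] by (simp add: has_integral_integral)
  from has_integral_affinity[OF this, of "-1" "2*pi"]
  have "((\<lambda>x. g (2*pi - x)) has_integral integral {pi..2*pi} g) ((\<lambda>x. 2*pi - x) ` {pi..2*pi})"
    by (simp add: algebra_simps)
  also have "(\<lambda>x. 2*pi - x) ` {pi..2*pi} = {0..pi}"
    by (subst image_diff_atLeastAtMost) simp
  finally have r: "((\<lambda>x. g (2*pi - x)) has_integral integral {pi..2*pi} g) {0..pi}" .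
  have "integral {0..pi} (\<lambda>t. g t + g (2*pi - t)) = integral {0..pi} g + integral {pi..2*pi} g"
    using r int[of 0 pi] by (subst integral_add) (auto simp: has_integral_iff)
  also have "\<dots> = integral {0..2*pi} g"
    by (rule Henstock_Kurzweil_Integration.integral_combine) (auto intro: int)
  finally show ?thesis ..
qed

definition poisson_kernel :: "real \<Rightarrow> real \<Rightarrow> real" where
  "poisson_kernel r t = (1 - r\<^sup>2) / (1 - 2 * r * cos t + r\<^sup>2)"

lemma norm_cis_minus_of_real: "(norm (cis t - complex_of_real r))\<^sup>2 = 1 - 2 * r * cos t + r\<^sup>2"
proof -
  have "(norm (cis t - complex_of_real r))\<^sup>2 = (cos t - r)\<^sup>2 + (sin t)\<^sup>2"
    by (simp add: cmod_power2)
  also have "\<dots> = ((cos t)\<^sup>2 + (sin t)\<^sup>2) - 2 * r * cos t + r\<^sup>2"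
    by (simp add: power2_eq_square algebra_simps)
  finally show ?thesis by simp
qed

lemma poisson_kernel_denom_pos:
  fixes t :: real
  assumes "0 \<le> r" "r < 1" shows "1 - 2 * r * cos t + r\<^sup>2 > 0"
proof -
  have "cis t - complex_of_real r \<noteq> 0"
    using assms by (metis abs_of_nonneg eq_iff_diff_eq_0 less_irrefl norm_cis norm_of_real)
  then show ?thesis unfolding norm_cis_minus_of_real[symmetric] by simp
qed

lemma poisson_kernel_pos: "0 \<le> r \<Longrightarrow> r < 1 \<Longrightarrow> poisson_kernel r t > 0"
  unfolding poisson_kernel_def using poisson_kernel_denom_pos[of r t]
  by (simp add: abs_square_less_1)

lemma continuous_poisson_kernel: "0 \<le> r \<Longrightarrow> r < 1 \<Longrightarrow> continuous_on S (poisson_kernel r)"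
  unfolding poisson_kernel_def using poisson_kernel_denom_pos[of r]
  by (intro continuous_intros) (metis less_irrefl)

lemma Poisson_integral_rotated:
  fixes f :: "complex \<Rightarrow> complex"
  assumes contf: "continuous_on (cball 0 1) f" and holf: "f holomorphic_on ball 0 1" and r: "0 \<le> r" "r < 1"
  shows "((\<lambda>t. f (cis (\<theta> + t)) * of_real (poisson_kernel r t)) has_integral 2 * pi * f (of_real r * cis \<theta>)) {0..2*pi}"
proof -
  have "((\<lambda>t. (\<lambda>u. f (u * cis \<theta>)) (cis t) * of_real ((1 - (norm (of_real r :: complex))\<^sup>2) / (norm (cis t - complex_of_real r))\<^sup>2))
      has_integral 2 * pi * (\<lambda>u. f (u * cis \<theta>)) (of_real r)) {0..2*pi}"
  proof (rule Poisson_integral_cis)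
    show "continuous_on (cball 0 1) (\<lambda>u. f (u * cis \<theta>))"
      by (intro continuous_on_compose2[OF contf] continuous_intros) (auto simp: norm_mult)
    have "f \<circ> (\<lambda>u. u * cis \<theta>) holomorphic_on ball 0 1"
      by (rule holomorphic_on_compose_gen[OF _ holf]) (auto intro!: holomorphic_intros simp: norm_mult)
    then show "(\<lambda>u. f (u * cis \<theta>)) holomorphic_on ball 0 1"
      by (simp add: o_def)
  qed (use r in auto)
  then show ?thesis
    unfolding norm_cis_minus_of_real poisson_kernel_def by (simp add: cis_mult add.commute)
qed

text \<open>Half of the mass 2 pi, by evenness; the mass itself is the Poisson formula for the
  constant 1.\<close>

lemma integral_poisson_kernel_half:
  assumes r: "0 \<le> r" "r < 1"
  shows "integral {0..pi} (poisson_kernel r) = pi"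
proof -
  have "((\<lambda>t. complex_of_real (poisson_kernel r t)) has_integral complex_of_real (2 * pi)) {0..2*pi}"
    using Poisson_integral_rotated[of "\<lambda>_. 1" r] r by simp
  from has_integral_linear[OF this bounded_linear_Re] have "(poisson_kernel r has_integral 2 * pi) {0..2*pi}"
    by (simp add: o_def)
  then have "2 * pi = integral {0..pi} (\<lambda>t. poisson_kernel r t + poisson_kernel r (2*pi - t))"
    using integral_fold_half_period[OF continuous_poisson_kernel[OF r]] by (simp add: has_integral_iff)
  also have "\<dots> = integral {0..pi} (\<lambda>t. 2 * poisson_kernel r t)"
    by (simp add: poisson_kernel_def)
  finally show ?thesis by simp
qed

lemma poisson_kernel_deriv:
  assumes "0 \<le> r" "r < 1"
  shows "(poisson_kernel r has_real_derivative
           - ((1 - r\<^sup>2) * (2 * r * sin t)) / (1 - 2 * r * cos t + r\<^sup>2)\<^sup>2) (at t within S)"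
  unfolding poisson_kernel_def using poisson_kernel_denom_pos[OF assms, of t]
  by (auto intro!: derivative_eq_intros simp: power2_eq_square)

text \<open>The Poisson kernel is even and decreasing on \<open>[0, \<pi>]\<close>, so integration by parts expresses the
  Poisson integral as an average of symmetric means.\<close>

lemma Poisson_le_symmetric_means:
  fixes u :: "real \<Rightarrow> real"
  assumes cont: "continuous_on UNIV u" and per: "\<And>t. u (t + 2*pi) = u t" and r: "0 \<le> r" "r < 1"
    and bound: "\<And>h. 0 < h \<Longrightarrow> h \<le> pi \<Longrightarrow> integral {\<theta>-h..\<theta>+h} u \<le> 2 * h * c"
  shows "integral {0..2*pi} (\<lambda>t. u (\<theta> + t) * poisson_kernel r t) \<le> 2 * pi * c"
proof -
  let ?P = "poisson_kernel r"
  define P' where "P' t = - ((1 - r\<^sup>2) * (2 * r * sin t)) / (1 - 2 * r * cos t + r\<^sup>2)\<^sup>2" for t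
  have P'_nonpos: "P' t \<le> 0" if "t \<in> {0..pi}" for t
    using r that sin_ge_zero[of t] by (auto simp: P'_def power_le_one intro!: mult_nonneg_nonneg divide_nonneg_nonneg)
  have cP': "continuous_on S P'" for S
    unfolding P'_def using poisson_kernel_denom_pos[OF r]
    by (intro continuous_intros) (metis less_irrefl power_not_zero)
  have cu: "continuous_on S (\<lambda>t. u (g t))" if "continuous_on S g" for S and g :: "real \<Rightarrow> real"
    by (rule continuous_on_compose2[OF cont that]) auto
  \<comment> \<open>The excess of the symmetric integral over its allowed size; by hypothesis it is
    never positive on \<open>{0..pi}\<close>.\<close>
  define K where "K h = integral {\<theta>-h..\<theta>+h} u - 2 * h * c" for h
  have K0: "K 0 = 0" by (simp add: K_def)
  have K_le: "K h \<le> 0" if "h \<in> {0..pi}" for h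
    using bound[of h] that K0 by (cases "h = 0") (auto simp: K_def)
  \<comment> \<open>The radius 4 exceeds pi, so that \<open>U\<close> has a two-sided derivative on
    all of \<open>{\<theta>-pi..\<theta>+pi}\<close>, end points included.\<close>
  obtain U where U: "\<And>x. x \<in> {\<theta>-4..\<theta>+4} \<Longrightarrow> (U has_vector_derivative u x) (at x within {\<theta>-4..\<theta>+4})"
    using antiderivative_continuous[OF continuous_on_subset[OF cont]] by (metis subset_UNIV)
  have U': "(U has_real_derivative u x) (at x)" if "x \<in> {\<theta>-pi..\<theta>+pi}" for x
  proof -
    have "x \<in> {\<theta>-4<..<\<theta>+4}" using that pi_less_4 by auto
    then show ?thesis
      using U[of x] at_within_Icc_at[of "\<theta>-4" x "\<theta>+4"] by (auto simp: has_real_derivative_iff_has_vector_derivative)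
  qed
  have K_eq: "K h = U (\<theta>+h) - U (\<theta>-h) - 2 * h * c" if "h \<in> {0..pi}" for h
  proof -
    have "(u has_integral U (\<theta>+h) - U (\<theta>-h)) {\<theta>-h..\<theta>+h}"
    proof (rule fundamental_theorem_of_calculus)
      fix x assume "x \<in> {\<theta>-h..\<theta>+h}"
      then have "x \<in> {\<theta>-pi..\<theta>+pi}" using that by auto
      from U'[OF this] show "(U has_vector_derivative u x) (at x within {\<theta>-h..\<theta>+h})"
        by (metis has_field_derivative_at_within has_real_derivative_iff_has_vector_derivative)
    qed (use that in auto)
    then show ?thesis by (simp add: K_def has_integral_iff)
  qed
  define L where "L h = U (\<theta>+h) - U (\<theta>-h) - 2 * h * c" for h
  define k where "k h = u (\<theta>+h) + u (\<theta>-h) - 2 * c" for h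
  have L': "(L has_real_derivative k h) (at h within {0..pi})" if "h \<in> {0..pi}" for h
  proof -
    have 1: "((\<lambda>h. U (\<theta>+h)) has_real_derivative u (\<theta>+h)) (at h)"
      using U'[of "\<theta>+h"] that by (auto intro!: DERIV_chain'[of "\<lambda>h. \<theta>+h" 1 h UNIV U, simplified] derivative_eq_intros)
    have 2: "((\<lambda>h. U (\<theta>-h)) has_real_derivative - u (\<theta>-h)) (at h)"
      using U'[of "\<theta>-h"] that by (auto intro!: DERIV_chain'[of "\<lambda>h. \<theta>-h" "-1" h UNIV U, simplified] derivative_eq_intros)
    show ?thesis unfolding L_def k_def
      by (rule has_field_derivative_at_within) (auto intro!: derivative_eq_intros 1 2)
  qed
  \<comment> \<open>Integration by parts in derivative form. The boundary term at 0 vanishes with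
    \<open>L 0\<close>, the one at pi is nonpositive, and the integral of \<open>P' h * L h\<close>
    is nonnegative because both factors are nonpositive; so the integral of the kernel times
    \<open>k\<close> cannot be positive.\<close>
  have PL: "((\<lambda>h. P' h * L h + ?P h * k h) has_integral ?P pi * L pi - ?P 0 * L 0) {0..pi}"
  proof (rule fundamental_theorem_of_calculus)
    fix x :: real assume x: "x \<in> {0..pi}"
    have "((\<lambda>x. ?P x * L x) has_real_derivative P' x * L x + ?P x * k x) (at x within {0..pi})"
      using DERIV_mult'[OF poisson_kernel_deriv[OF r, of x "{0..pi}"] L'[OF x]]
      by (simp add: P'_def algebra_simps)
    then show "((\<lambda>x. ?P x * L x) has_vector_derivative P' x * L x + ?P x * k x) (at x within {0..pi})"
      by (simp add: has_real_derivative_iff_has_vector_derivative)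
  qed simp
  have ck: "continuous_on {0..pi} k"
    unfolding k_def by (intro continuous_intros cu)
  have cL: "continuous_on {0..pi} L"
    using L' by (meson DERIV_continuous_on)
  have i1: "(\<lambda>h. P' h * L h) integrable_on {0..pi}"
    by (intro integrable_continuous_real continuous_intros cL cP')
  have i2: "(\<lambda>h. ?P h * k h) integrable_on {0..pi}"
    by (intro integrable_continuous_real continuous_intros ck continuous_poisson_kernel r)
  have "integral {0..pi} (\<lambda>h. P' h * L h) \<ge> 0"
    using K_le K_eq P'_nonpos by (intro integral_nonneg i1) (auto simp: L_def intro!: mult_nonpos_nonpos)
  moreover have "integral {0..pi} (\<lambda>h. P' h * L h) + integral {0..pi} (\<lambda>h. ?P h * k h) = ?P pi * L pi - ?P 0 * L 0"
    using PL integral_add[OF i1 i2] by (simp add: has_integral_iff)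
  moreover have "L 0 = 0" by (simp add: L_def)
  moreover have "L pi \<le> 0" using K_le[of pi] K_eq[of pi] by (simp add: L_def)
  then have "?P pi * L pi \<le> 0" using poisson_kernel_pos[OF r, of pi] by (simp add: mult_le_0_iff)
  ultimately have le: "integral {0..pi} (\<lambda>h. ?P h * k h) \<le> 0" by simp
  have per': "u (\<theta> + (2*pi - t)) = u (\<theta> - t)" for t
    using per[of "\<theta> - t"] by (simp add: algebra_simps)
  have sym: "?P (2*pi - t) = ?P t" for t
    by (simp add: poisson_kernel_def)
  have "integral {0..2*pi} (\<lambda>t. u (\<theta> + t) * ?P t)
      = integral {0..pi} (\<lambda>t. u (\<theta> + t) * ?P t + u (\<theta> + (2*pi - t)) * ?P (2*pi - t))"
    by (rule integral_fold_half_period) (intro continuous_intros cu continuous_poisson_kernel r)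
  also have "\<dots> = integral {0..pi} (\<lambda>t. ?P t * k t + 2 * c * ?P t)"
    by (rule integral_cong) (simp only: per' sym k_def, simp add: algebra_simps)
  also have "\<dots> = integral {0..pi} (\<lambda>t. ?P t * k t) + 2 * c * integral {0..pi} ?P"
    by (subst integral_add[OF i2]) (auto intro!: integrable_continuous_real continuous_intros continuous_poisson_kernel r)
  finally show ?thesis
    using le integral_poisson_kernel_half[OF r] by simp
qed

section \<open>A weak-type inequality for symmetric means\<close>

text \<open>Vitali's covering lemma selects countably many disjoint intervals of half-length
  \<open>h i\<close> whose fivefold enlargements cover the set. An enlargement has length
  \<open>10 * h i\<close>, at most 5 / c times the integral of \<open>u\<close> over the original;
  the originals lie in \<open>{-pi..3*pi}\<close>, two periods, which doubles 5 to 10. The covering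
  set \<open>B\<close> carries the estimate, so measurability of the covered set is not at
  issue.\<close>

lemma symmetric_means_weak_type:
  fixes u :: "real \<Rightarrow> real"
  assumes cont: "continuous_on UNIV u" and per: "\<And>t. u (t + 2*pi) = u t" and nonneg: "\<And>t. u t \<ge> 0"
    and c: "c > 0"
  shows "\<exists>B \<in> sets borel.
    {\<theta> \<in> {0..<2*pi}. \<exists>h. 0 < h \<and> h \<le> pi \<and> integral {\<theta>-h..\<theta>+h} u > 2 * h * c} \<subseteq> B \<and>
    emeasure lborel B \<le> ennreal (10 / c * integral {0..2*pi} u)"
proof -
  define S where "S = {\<theta> \<in> {0..<2*pi}. \<exists>h. 0 < h \<and> h \<le> pi \<and> integral {\<theta>-h..\<theta>+h} u > 2 * h * c}"
  have "\<forall>\<theta>\<in>S. \<exists>h. 0 < h \<and> h \<le> pi \<and> integral {\<theta>-h..\<theta>+h} u > 2 * h * c"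
    by (simp add: S_def)
  then obtain h where h: "\<And>\<theta>. \<theta> \<in> S \<Longrightarrow> 0 < h \<theta> \<and> h \<theta> \<le> pi \<and> integral {\<theta>-h \<theta>..\<theta>+h \<theta>} u > 2 * h \<theta> * c"
    by metis
  have "S \<subseteq> (\<Union>\<theta>\<in>S. cball \<theta> (h \<theta>))"
    using h by force
  then obtain C where C: "countable C" "C \<subseteq> S"
    "pairwise (\<lambda>i j. disjnt (cball i (h i)) (cball j (h j))) C" "S \<subseteq> (\<Union>i\<in>C. cball i (5 * h i))"
    using Vitali_covering_lemma_cballs[of S "\<lambda>x. x" h S pi] h by (metis (no_types, lifting))
  \<comment> \<open>With \<open>u\<close> as a density, adding the integrals over the disjoint
    intervals becomes countable additivity of a measure.\<close>
  define N where "N = density lborel (\<lambda>x. ennreal (u x))"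
  have [measurable]: "u \<in> borel_measurable borel"
    using cont by (rule borel_measurable_continuous_onI)
  have N: "emeasure N {a..b} = ennreal (integral {a..b} u)" for a b
  proof -
    have "emeasure N {a..b} = (\<integral>\<^sup>+x. ennreal (u x) * indicator {a..b} x \<partial>lborel)"
      unfolding N_def by (subst emeasure_density) auto
    also have "\<dots> = (\<integral>\<^sup>+x. ennreal (indicator {a..b} x * u x) \<partial>lborel)"
      by (intro nn_integral_cong) (auto simp: indicator_def)
    also have "\<dots> = ennreal (LINT x:{a..b}|lborel. u x)"
      unfolding set_lebesgue_integral_def
      using borel_integrable_atLeastAtMost'[OF continuous_on_subset[OF cont], of a b]
      by (subst nn_integral_eq_integral) (auto simp: set_integrable_def nonneg)
    also have "(LINT x:{a..b}|lborel. u x) = integral {a..b} u"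
      by (rule set_borel_integral_eq_integral)
        (auto intro!: borel_integrable_atLeastAtMost' continuous_on_subset[OF cont])
    finally show ?thesis .
  qed
  have sets_N: "sets N = sets borel" by (simp add: N_def)
  have cb: "cball x r = {x-r..x+r}" for x r :: real
    by (auto simp: dist_real_def)
  have step: "emeasure lborel (cball i (5 * h i)) \<le> ennreal (5/c) * emeasure N (cball i (h i))" if "i \<in> C" for i
  proof -
    have "i \<in> S" using C that by auto
    note hi = h[OF this]
    have "emeasure lborel (cball i (5 * h i)) = ennreal (10 * h i)"
      unfolding cb using hi by simp
    also have "\<dots> \<le> ennreal (5/c * integral {i-h i..i+h i} u)"
      using hi c by (intro ennreal_leI) (simp add: field_simps)
    also have "\<dots> = ennreal (5/c) * emeasure N (cball i (h i))"
      unfolding cb N using c hi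
      by (subst ennreal_mult) (auto intro!: integral_nonneg integrable_continuous_real continuous_on_subset[OF cont] nonneg)
    finally show ?thesis .
  qed
  define X where "X r n = (if n \<in> to_nat_on C ` C then cball (from_nat_into C n) (r * h (from_nat_into C n)) else {})" for r :: real and n
  have UN_X: "(\<Union>n. X r n) = (\<Union>i\<in>C. cball i (r * h i))" for r
    using C(1) by (auto simp: X_def from_nat_into_to_nat_on split: if_splits)
  have disj: "disjoint_family (X 1)"
    unfolding disjoint_family_on_def
  proof (intro ballI impI)
    fix m n :: nat assume "m \<noteq> n"
    then show "X 1 m \<inter> X 1 n = {}"
      using C(1,3) by (auto simp: X_def pairwise_def disjnt_def split: if_splits) (metis disjoint_iff mem_cball)
  qed
  define D where "D = (\<Union>i\<in>C. cball i (5 * h i))"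
  have X_sub: "(\<Union>n. X 1 n) \<subseteq> {-pi..3*pi}"
  proof -
    have "cball i (h i) \<subseteq> {-pi..3*pi}" if "i \<in> C" for i
    proof -
      have "i \<in> S" using that C by auto
      moreover from this have "0 \<le> i" "i < 2 * pi" by (auto simp: S_def)
      ultimately show ?thesis using h[of i] unfolding cb by auto
    qed
    then show ?thesis unfolding UN_X by simp blast
  qed
  have "emeasure lborel D \<le> (\<Sum>n. emeasure lborel (X 5 n))"
    unfolding D_def UN_X[symmetric] by (rule emeasure_subadditive_countably) (auto simp: X_def)
  also have "\<dots> \<le> (\<Sum>n. ennreal (5/c) * emeasure N (X 1 n))"
    using C(1) step by (intro suminf_le) (auto simp: X_def from_nat_into_to_nat_on)
  also have "\<dots> = ennreal (5/c) * (\<Sum>n. emeasure N (X 1 n))"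
    by simp
  also have "(\<Sum>n. emeasure N (X 1 n)) = emeasure N (\<Union>n. X 1 n)"
    by (rule suminf_emeasure[OF _ disj]) (auto simp: sets_N X_def)
  also have "\<dots> \<le> emeasure N {-pi..3*pi}"
    by (rule emeasure_mono[OF X_sub]) (simp add: sets_N)
  also have "\<dots> = ennreal (2 * integral {0..2*pi} u)"
  proof -
    have int: "u integrable_on {a..b}" for a b
      by (intro integrable_continuous_real continuous_on_subset[OF cont]) auto
    have per_m: "u (t - 2*pi) = u t" for t using per[of "t - 2*pi"] by simp
    have "integral {-pi..3*pi} u = integral {-pi..0} u + (integral {0..2*pi} u + integral {2*pi..3*pi} u)"
      using int by (simp add: Henstock_Kurzweil_Integration.integral_combine)
    moreover have "integral {-pi..0} u = integral {pi..2*pi} u"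
      using integral_shift_Icc_real[of "-pi" 0 u "2*pi"] by (simp add: o_def add.commute[of "2*pi"] per)
    moreover have "integral {2*pi..3*pi} u = integral {0..pi} u"
      using integral_shift_Icc_real[of 0 pi u "2*pi"] by (simp add: o_def add.commute[of "2*pi"] per)
    moreover have "integral {0..pi} u + integral {pi..2*pi} u = integral {0..2*pi} u"
      using int by (simp add: Henstock_Kurzweil_Integration.integral_combine)
    ultimately show ?thesis unfolding N by (intro arg_cong[of _ _ ennreal]) linarith
  qed
  also have "ennreal (5/c) * \<dots> = ennreal (10 / c * integral {0..2*pi} u)"
    using c by (subst ennreal_mult[symmetric])
      (auto intro!: integral_nonneg integrable_continuous_real continuous_on_subset[OF cont] nonneg)
  finally have "emeasure lborel D \<le> ennreal (10 / c * integral {0..2*pi} u)" by (simp add: mult_left_mono)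
  moreover have "D \<in> sets borel"
    unfolding D_def using C(1) by (intro sets.countable_UN') auto
  moreover have "S \<subseteq> D" using C(4) by (simp add: D_def)
  ultimately show ?thesis unfolding S_def by blast
qed

section \<open>Parseval's identity for power series\<close>

lemma integrable_circle_measure_bounded:
  fixes f :: "complex \<Rightarrow> 'b::{banach, second_countable_topology}"
  assumes "f \<in> borel_measurable borel" and "\<And>x. norm x = 1 \<Longrightarrow> norm (f x) \<le> C"
  shows "integrable circle_measure f"
proof (rule circle_measure.integrable_const_bound)
  show "AE x in circle_measure. norm (f x) \<le> C"
    using AE_circle_measure by eventually_elim (rule assms(2))
  show "f \<in> borel_measurable circle_measure"
    using assms(1) by simp
qed

text \<open>On the circle the integrand equals \<open>cnj (x ^ (N - n))\<close>, and Cauchy's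
  formula at 0 evaluates the integral of \<open>x ^ (N - n)\<close> as 2 pi times the value of a
  positive power at 0.\<close>

lemma integral_monomial_orthogonal:
  assumes "n < N"
  shows "(\<integral>x. x ^ n * cnj (x ^ N) \<partial>circle_measure) = 0"
proof -
  have [measurable]: "(\<lambda>x. x ^ k :: complex) \<in> borel_measurable borel" "cnj \<in> borel_measurable borel" for k
    by (auto intro!: borel_measurable_continuous_onI continuous_intros)
  let ?k = "N - n"
  have "integral {0..2*pi} (\<lambda>t. (cis t) ^ ?k) = 0"
    using Cauchy_integral_cis[of "\<lambda>u. u ^ ?k" 0] assms
    by (simp add: has_integral_iff continuous_intros holomorphic_intros)
  then have 0: "(\<integral>x. x ^ ?k \<partial>circle_measure) = 0"
    by (subst integral_circle_measure_eq_integral) (auto intro!: continuous_intros)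
  have "(\<integral>x. x ^ n * cnj (x ^ N) \<partial>circle_measure) = (\<integral>x. cnj (x ^ ?k) \<partial>circle_measure)"
  proof (rule integral_cong_AE)
    show "AE x in circle_measure. x ^ n * cnj (x ^ N) = cnj (x ^ ?k)"
      using AE_circle_measure
    proof eventually_elim
      fix x :: complex assume "norm x = 1"
      then have "x * cnj x = 1" using complex_norm_square[of x] by simp
      then have "x ^ n * cnj x ^ n = 1" by (simp add: power_mult_distrib[symmetric])
      moreover have "cnj (x ^ N) = cnj x ^ n * cnj x ^ ?k"
        using assms by (simp add: power_add[symmetric])
      ultimately show "x ^ n * cnj (x ^ N) = cnj (x ^ ?k)"
        by (simp add: mult.assoc[symmetric])
    qed
  qed measurable
  also have "\<dots> = cnj (\<integral>x. x ^ ?k \<partial>circle_measure)"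
    by (rule Bochner_Integration.integral_cnj)
  finally show ?thesis using 0 by simp
qed

lemma norm_add_squared_complex:
  "(norm (a + b :: complex))\<^sup>2 = (norm a)\<^sup>2 + (norm b)\<^sup>2 + 2 * Re (a * cnj b)"
  unfolding cmod_power2 by (simp add: power2_eq_square algebra_simps)

lemma integral_norm_polynomial:
  "(\<integral>x. (norm (\<Sum>n<N. b n * x ^ n))\<^sup>2 \<partial>circle_measure) = 2 * pi * (\<Sum>n<N. (norm (b n))\<^sup>2)"
proof (induction N)
  case (Suc N)
  define S where "S x = (\<Sum>n<N. b n * x ^ n)" for x
  have [measurable]: "(\<lambda>x. x ^ k :: complex) \<in> borel_measurable borel" "cnj \<in> borel_measurable borel"
      "S \<in> borel_measurable borel" for k
    unfolding S_def by (auto intro!: borel_measurable_continuous_onI continuous_intros)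
  have S_le: "norm (S x) \<le> (\<Sum>n<N. norm (b n))" if "norm x = 1" for x
    unfolding S_def using that by (intro sum_norm_le) (simp add: norm_mult norm_power)
  have iS: "integrable circle_measure (\<lambda>x. (norm (S x))\<^sup>2)"
    by (rule integrable_circle_measure_bounded[where C = "(\<Sum>n<N. norm (b n))\<^sup>2"])
      (auto intro!: power_mono S_le)
  have iC: "integrable circle_measure (\<lambda>x. S x * cnj (b N * x ^ N))"
    by (rule integrable_circle_measure_bounded[where C = "(\<Sum>n<N. norm (b n)) * norm (b N)"])
      (auto simp: norm_mult norm_power intro!: mult_right_mono S_le)
  have iM: "integrable circle_measure (\<lambda>x. b n * x ^ n * cnj (b N * x ^ N))" for n
    by (rule integrable_circle_measure_bounded[where C = "norm (b n) * norm (b N)"])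
      (auto simp: norm_mult norm_power)
  have 0: "(\<integral>x. S x * cnj (b N * x ^ N) \<partial>circle_measure) = 0"
  proof -
    have "(\<integral>x. S x * cnj (b N * x ^ N) \<partial>circle_measure)
        = (\<integral>x. (\<Sum>n<N. b n * x ^ n * cnj (b N * x ^ N)) \<partial>circle_measure)"
      by (simp add: S_def sum_distrib_right)
    also have "\<dots> = (\<Sum>n<N. \<integral>x. b n * x ^ n * cnj (b N * x ^ N) \<partial>circle_measure)"
      by (rule Bochner_Integration.integral_sum) (rule iM)
    also have "\<dots> = (\<Sum>n<N. \<integral>x. (b n * cnj (b N)) * (x ^ n * cnj (x ^ N)) \<partial>circle_measure)"
      by (simp add: mult_ac)
    also have "\<dots> = 0"
      by (intro sum.neutral ballI) (simp add: integral_monomial_orthogonal del: complex_cnj_power)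
    finally show ?thesis .
  qed
  have "(\<integral>x. (norm (\<Sum>n<Suc N. b n * x ^ n))\<^sup>2 \<partial>circle_measure)
      = (\<integral>x. (norm (S x))\<^sup>2 + (norm (b N))\<^sup>2 + 2 * Re (S x * cnj (b N * x ^ N)) \<partial>circle_measure)"
  proof (rule integral_cong_AE)
    show "AE x in circle_measure. (norm (\<Sum>n<Suc N. b n * x ^ n))\<^sup>2
        = (norm (S x))\<^sup>2 + (norm (b N))\<^sup>2 + 2 * Re (S x * cnj (b N * x ^ N))"
      using AE_circle_measure
    proof eventually_elim
      fix x :: complex assume x: "norm x = 1"
      have "(norm (S x + b N * x ^ N))\<^sup>2 = (norm (S x))\<^sup>2 + (norm (b N * x ^ N))\<^sup>2 + 2 * Re (S x * cnj (b N * x ^ N))"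
        by (rule norm_add_squared_complex)
      then show "(norm (\<Sum>n<Suc N. b n * x ^ n))\<^sup>2
        = (norm (S x))\<^sup>2 + (norm (b N))\<^sup>2 + 2 * Re (S x * cnj (b N * x ^ N))"
        using x by (simp add: S_def norm_mult norm_power)
    qed
  qed (auto simp: S_def[symmetric])
  also have "\<dots> = (\<integral>x. (norm (S x))\<^sup>2 \<partial>circle_measure) + 2 * pi * (norm (b N))\<^sup>2
      + 2 * Re (\<integral>x. S x * cnj (b N * x ^ N) \<partial>circle_measure)"
  proof -
    have iR: "integrable circle_measure (\<lambda>x. Re (S x * cnj (b N * x ^ N)))"
      by (rule integrable_Re[OF iC])
    have "(\<integral>x. Re (S x * cnj (b N * x ^ N)) \<partial>circle_measure) = Re (\<integral>x. S x * cnj (b N * x ^ N) \<partial>circle_measure)"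
      by (rule integral_Re[OF iC])
    moreover have "integrable circle_measure (\<lambda>x. (norm (S x))\<^sup>2 + (norm (b N))\<^sup>2)"
      using iS by simp
    ultimately show ?thesis
      using iS iR by (subst Bochner_Integration.integral_add)
        (auto simp: measure_def emeasure_circle_measure_UNIV simp del: times_complex.sel)
  qed
  finally show ?case using Suc 0 by (simp add: S_def[symmetric] algebra_simps)
qed simp

text \<open>Dominated convergence from the polynomial case, with a constant majorant from absolute
  summability. It yields square summability of the coefficients and, later, the mean square of a
  difference of two dilates.\<close>

lemma Parseval_power_series:
  assumes sm: "summable (\<lambda>n. norm (b n))"
    and f: "\<And>x. norm x = 1 \<Longrightarrow> (\<lambda>n. b n * x ^ n) sums f x" and [measurable]: "f \<in> borel_measurable borel"
  shows "(\<lambda>n. 2 * pi * (norm (b n))\<^sup>2) sums (\<integral>x. (norm (f x))\<^sup>2 \<partial>circle_measure)"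
proof -
  have [measurable]: "(\<lambda>x. x ^ k :: complex) \<in> borel_measurable borel" for k
    by (auto intro!: borel_measurable_continuous_onI continuous_intros)
  have "(\<lambda>N. \<integral>x. (norm (\<Sum>n<N. b n * x ^ n))\<^sup>2 \<partial>circle_measure) \<longlonglongrightarrow> (\<integral>x. (norm (f x))\<^sup>2 \<partial>circle_measure)"
  proof (rule integral_dominated_convergence[where w = "\<lambda>_. (suminf (\<lambda>n. norm (b n)))\<^sup>2"])
    show "AE x in circle_measure. (\<lambda>N. (norm (\<Sum>n<N. b n * x ^ n))\<^sup>2) \<longlonglongrightarrow> (norm (f x))\<^sup>2"
      using AE_circle_measure
      by eventually_elim (use f in \<open>auto simp: sums_def intro!: tendsto_intros\<close>)
    show "AE x in circle_measure. norm ((norm (\<Sum>n<N. b n * x ^ n))\<^sup>2) \<le> (suminf (\<lambda>n. norm (b n)))\<^sup>2" for N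
      using AE_circle_measure
    proof eventually_elim
      fix x :: complex assume "norm x = 1"
      then have "norm (\<Sum>n<N. b n * x ^ n) \<le> (\<Sum>n<N. norm (b n))"
        by (intro sum_norm_le) (simp add: norm_mult norm_power)
      also have "\<dots> \<le> suminf (\<lambda>n. norm (b n))"
        by (rule sum_le_suminf[OF sm]) auto
      finally show "norm ((norm (\<Sum>n<N. b n * x ^ n))\<^sup>2) \<le> (suminf (\<lambda>n. norm (b n)))\<^sup>2"
        by (simp add: power_mono)
    qed
  qed auto
  then show ?thesis
    unfolding integral_norm_polynomial sums_def by (simp add: sum_distrib_left)
qed

text \<open>Parseval on the circle of radius R bounds the partial sums of
  \<open>(norm (a n))\<^sup>2 * R ^ (2*n)\<close> by \<open>B\<^sup>2\<close>, independently of R;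
  each finite partial sum is then passed to R = 1.\<close>

lemma holomorphic_coefficients:
  assumes hol: "f holomorphic_on ball 0 1" and bd: "\<And>z. norm z < 1 \<Longrightarrow> norm (f z) \<le> B"
  obtains a where "\<And>z. norm z < 1 \<Longrightarrow> (\<lambda>n. a n * z ^ n) sums f z"
    and "\<And>R. 0 \<le> R \<Longrightarrow> R < 1 \<Longrightarrow> summable (\<lambda>n. norm (a n) * R ^ n)"
    and "summable (\<lambda>n. (norm (a n))\<^sup>2)"
proof -
  define a where "a n = (deriv ^^ n) f 0 / fact n" for n
  have s: "(\<lambda>n. a n * z ^ n) sums f z" if "norm z < 1" for z
    using holomorphic_power_series[OF hol, of z] that by (simp add: a_def)
  have abs: "summable (\<lambda>n. norm (a n) * R ^ n)" if R: "0 \<le> R" "R < 1" for R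
  proof -
    obtain R' where R': "R < R'" "R' < 1" using dense[OF R(2)] by auto
    have "summable (\<lambda>n. a n * (of_real R') ^ n)"
      using s[of "of_real R'"] R R' by (simp add: sums_iff)
    from powser_insidea[OF this, of "of_real R"] show ?thesis
      using R R' by (simp add: norm_mult norm_power)
  qed
  have cont: "continuous_on (ball 0 1) f" using hol by (rule holomorphic_on_imp_continuous_on)
  have bound: "(\<Sum>n<N. (norm (a n))\<^sup>2 * R ^ (2*n)) \<le> B\<^sup>2" if R: "0 < R" "R < 1" for R N
  proof -
    \<comment> \<open>The cut-off to the unit circle makes a Borel function on the plane out of
      \<open>f\<close>, which is constrained only on the disc.\<close>
    define g where "g x = indicator (sphere 0 1) x *\<^sub>R f (of_real R * x)" for x
    have [measurable]: "g \<in> borel_measurable borel"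
      unfolding g_def
      by (rule borel_measurable_continuous_on_indicator)
        (use R in \<open>auto intro!: continuous_on_compose2[OF cont] continuous_intros simp: norm_mult\<close>)
    have g_le: "norm (g x) \<le> B" if "norm x = 1" for x
      using bd[of "of_real R * x"] R that by (simp add: g_def norm_mult)
    have ps: "(\<lambda>n. 2 * pi * (norm (a n * of_real R ^ n))\<^sup>2) sums (\<integral>x. (norm (g x))\<^sup>2 \<partial>circle_measure)"
    proof (rule Parseval_power_series)
      show "summable (\<lambda>n. norm (a n * of_real R ^ n))"
        using abs[of R] R by (simp add: norm_mult norm_power)
      show "(\<lambda>n. a n * of_real R ^ n * x ^ n) sums g x" if "norm x = 1" for x
        using s[of "of_real R * x"] that R by (simp add: g_def norm_mult power_mult_distrib mult.assoc)
    qed auto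
    have "(\<integral>x. (norm (g x))\<^sup>2 \<partial>circle_measure) \<le> (\<integral>x. B\<^sup>2 \<partial>circle_measure)"
    proof (rule integral_mono_AE)
      show "AE x in circle_measure. (norm (g x))\<^sup>2 \<le> B\<^sup>2"
        using AE_circle_measure
        by eventually_elim (auto intro!: power_mono g_le)
      show "integrable circle_measure (\<lambda>x. (norm (g x))\<^sup>2)"
        by (rule integrable_circle_measure_bounded[where C = "B\<^sup>2"])
          (auto intro!: power_mono g_le)
    qed auto
    also have "\<dots> = 2 * pi * B\<^sup>2"
      by (simp add: measure_def emeasure_circle_measure_UNIV)
    finally have le: "(\<integral>x. (norm (g x))\<^sup>2 \<partial>circle_measure) \<le> 2 * pi * B\<^sup>2" .
    have "(\<Sum>n<N. 2 * pi * (norm (a n * of_real R ^ n))\<^sup>2) \<le> (\<integral>x. (norm (g x))\<^sup>2 \<partial>circle_measure)"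
      using sum_le_suminf[OF sums_summable[OF ps], of "{..<N}"] sums_unique[OF ps] by simp
    with le have "2 * pi * (\<Sum>n<N. (norm (a n * of_real R ^ n))\<^sup>2) \<le> 2 * pi * B\<^sup>2"
      by (simp add: sum_distrib_left)
    then have "(\<Sum>n<N. (norm (a n * of_real R ^ n))\<^sup>2) \<le> B\<^sup>2" by simp
    then show ?thesis
      using R by (simp add: norm_mult norm_power power_mult_distrib power_mult[symmetric] mult.commute)
  qed
  have "summable (\<lambda>n. (norm (a n))\<^sup>2)"
  proof (rule bounded_imp_summable)
    fix N
    have lim: "((\<lambda>R. \<Sum>n\<le>N. (norm (a n))\<^sup>2 * R ^ (2*n)) \<longlongrightarrow> (\<Sum>n\<le>N. (norm (a n))\<^sup>2 * 1 ^ (2*n))) (at_left (1::real))"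
      by (intro tendsto_intros)
    have "(\<Sum>n\<le>N. (norm (a n))\<^sup>2 * 1 ^ (2*n)) \<le> B\<^sup>2"
    proof (rule tendsto_upperbound[OF lim])
      show "\<forall>\<^sub>F R in at_left (1::real). (\<Sum>n\<le>N. (norm (a n))\<^sup>2 * R ^ (2*n)) \<le> B\<^sup>2"
        by (rule eventually_mono[OF eventually_at_left_real[of 0 1]]) (use bound[where N = "Suc N"] in \<open>auto simp: lessThan_Suc_atMost\<close>)
    qed simp
    then show "(\<Sum>n\<le>N. (norm (a n))\<^sup>2) \<le> B\<^sup>2" by simp
  qed auto
  with s abs show ?thesis using that by blast
qed

section \<open>Fatou's theorem on radial limits\<close>

text \<open>Applied to the holomorphic function \<open>F\<^sup>2\<close>, the Poisson formula bounds
  \<open>(norm (F z))\<^sup>2\<close> by the Poisson average of its boundary values. If every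
  symmetric mean at \<theta> were at most \<open>\<kappa>\<^sup>2\<close>, so would be that average
  on the whole radius; the set in question thus lies in the exceptional set for symmetric
  means.\<close>

lemma radial_maximal_weak_type:
  fixes F :: "complex \<Rightarrow> complex"
  assumes cont: "continuous_on (cball 0 1) F" and hol: "F holomorphic_on ball 0 1" and "\<kappa> > 0"
  shows "\<exists>B \<in> sets borel. {\<theta> \<in> {0..<2*pi}. \<exists>r. 0 \<le> r \<and> r < 1 \<and> norm (F (of_real r * cis \<theta>)) > \<kappa>} \<subseteq> B \<and>
    emeasure lborel B \<le> ennreal (10 / \<kappa>\<^sup>2 * integral {0..2*pi} (\<lambda>t. (norm (F (cis t)))\<^sup>2))"
proof -
  define u where "u t = (norm (F (cis t)))\<^sup>2" for t
  have cont_u: "continuous_on UNIV u"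
    unfolding u_def by (intro continuous_intros continuous_on_compose2[OF cont]) auto
  have per: "u (t + 2*pi) = u t" for t
    by (simp add: u_def cis_mult[symmetric])
  have ex: "\<exists>h. 0 < h \<and> h \<le> pi \<and> integral {\<theta>-h..\<theta>+h} u > 2 * h * \<kappa>\<^sup>2"
    if r: "0 \<le> r" "r < 1" and gt: "norm (F (of_real r * cis \<theta>)) > \<kappa>" for r \<theta>
  proof (rule ccontr)
    assume "\<not> ?thesis"
    then have "integral {\<theta>-h..\<theta>+h} u \<le> 2 * h * \<kappa>\<^sup>2" if "0 < h" "h \<le> pi" for h
      using that by force
    then have le: "integral {0..2*pi} (\<lambda>t. u (\<theta> + t) * poisson_kernel r t) \<le> 2 * pi * \<kappa>\<^sup>2"
      by (intro Poisson_le_symmetric_means cont_u per r)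
    have hi: "((\<lambda>t. (F (cis (\<theta> + t)))\<^sup>2 * of_real (poisson_kernel r t)) has_integral
        2 * pi * (F (of_real r * cis \<theta>))\<^sup>2) {0..2*pi}"
      using Poisson_integral_rotated[of "\<lambda>z. (F z)\<^sup>2" r \<theta>] cont hol r
      by (simp add: continuous_on_power holomorphic_on_power)
    have "norm (2 * pi * (F (of_real r * cis \<theta>))\<^sup>2) \<le> integral {0..2*pi} (\<lambda>t. u (\<theta> + t) * poisson_kernel r t)"
      unfolding integral_unique[OF hi, symmetric]
    proof (rule integral_norm_bound_integral)
      show "(\<lambda>t. (F (cis (\<theta> + t)))\<^sup>2 * of_real (poisson_kernel r t)) integrable_on {0..2*pi}"
        using hi by blast
      have "continuous_on {0..2*pi} (\<lambda>t. u (\<theta> + t))"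
        by (rule continuous_on_compose2[OF cont_u]) (auto intro!: continuous_intros)
      then show "(\<lambda>t. u (\<theta> + t) * poisson_kernel r t) integrable_on {0..2*pi}"
        by (intro integrable_continuous_real continuous_intros continuous_poisson_kernel r)
    qed (use poisson_kernel_pos[OF r] in \<open>auto simp: norm_mult norm_power u_def less_imp_le\<close>)
    from order_trans[OF this le] have "(norm (F (of_real r * cis \<theta>)))\<^sup>2 \<le> \<kappa>\<^sup>2"
      by (simp add: norm_mult norm_power)
    then show False using gt \<open>\<kappa> > 0\<close> by (simp add: power2_le_iff_abs_le)
  qed
  have "\<kappa>\<^sup>2 > 0" using assms by simp
  have nonneg: "u t \<ge> 0" for t by (simp add: u_def)
  from symmetric_means_weak_type[OF cont_u per nonneg \<open>\<kappa>\<^sup>2 > 0\<close>] obtain B where "B \<in> sets borel"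
    "{\<theta> \<in> {0..<2*pi}. \<exists>h. 0 < h \<and> h \<le> pi \<and> integral {\<theta>-h..\<theta>+h} u > 2 * h * \<kappa>\<^sup>2} \<subseteq> B"
    "emeasure lborel B \<le> ennreal (10 / \<kappa>\<^sup>2 * integral {0..2*pi} u)"
    by blast
  with ex show ?thesis
    unfolding u_def[symmetric] by (intro bexI[of _ B] conjI) auto
qed

text \<open>A Cauchy criterion tailored to boundary limits: the approximant \<open>g\<close> may
  change with \<open>e\<close>, and the limits of different approximants are not compared
  beforehand. Completeness supplies the limit.\<close>

lemma ex_tendsto_if_approximable:
  fixes f :: "'a \<Rightarrow> 'b::complete_space"
  assumes "F \<noteq> bot"
    and app: "\<And>e. e > 0 \<Longrightarrow> \<exists>g l. (g \<longlongrightarrow> l) F \<and> (\<forall>\<^sub>F x in F. dist (f x) (g x) \<le> e)"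
  shows "\<exists>L. (f \<longlongrightarrow> L) F"
proof -
  have "cauchy_filter (filtermap f F)"
    unfolding cauchy_filter_metric_filtermap
  proof (intro allI impI)
    fix e :: real assume "e > 0"
    then obtain g l where g: "(g \<longlongrightarrow> l) F" "\<forall>\<^sub>F x in F. dist (f x) (g x) \<le> e / 4"
      using app[of "e / 4"] by auto
    have "\<forall>\<^sub>F x in F. dist (g x) l < e / 4"
      using tendstoD[OF g(1), of "e / 4"] \<open>e > 0\<close> by simp
    with g(2) have "\<forall>\<^sub>F x in F. dist (f x) l < e / 2"
    proof eventually_elim
      case (elim x)
      then show ?case using dist_triangle[of "f x" l "g x"] by linarith
    qed
    moreover have "dist (f x) (f y) < e" if "dist (f x) l < e / 2 \<and> dist (f y) l < e / 2" for x y
      using that dist_triangle2[of "f x" "f y" l] by linarith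
    ultimately show "\<exists>P. eventually P F \<and> (\<forall>x y. P x \<and> P y \<longrightarrow> dist (f x) (f y) < e)"
      by (intro exI[of _ "\<lambda>x. dist (f x) l < e / 2"]) blast
  qed
  from cauchy_filter_complete_converges[OF this complete_UNIV] show ?thesis
    using assms(1) by (simp add: filterlim_def filtermap_bot_iff)
qed

lemma norm_dilation_less_1:
  fixes x :: complex
  assumes "x \<in> ball 0 (1/r)" "0 < r" "0 < \<rho>" "\<rho> < 1"
  shows "norm (of_real r * x) < 1" "norm (of_real (r * \<rho>) * x) < 1"
proof -
  show 1: "norm (of_real r * x) < 1"
    using assms by (simp add: norm_mult field_simps)
  have "norm (of_real (r * \<rho>) * x) = norm (of_real r * x) * \<rho>"
    using assms by (simp add: norm_mult)
  also have "\<dots> < 1" using 1 assms by (meson mult_left_le less_imp_le norm_ge_zero order_le_less_trans)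
  finally show "norm (of_real (r * \<rho>) * x) < 1" .
qed

text \<open>The set is taken in the plane, on the disc of radius 1/r where both dilates are defined:
  it is then open, and even the uncountable union over \<open>r\<close> remains Borel.\<close>

lemma open_dilation_difference:
  fixes f :: "complex \<Rightarrow> complex"
  assumes cont: "continuous_on (ball 0 1) f" and r: "0 < r" "r < 1" and \<rho>: "0 < \<rho>" "\<rho> < 1"
  shows "open {x \<in> ball 0 (1/r). \<kappa> < norm (f (of_real r * x) - f (of_real (r * \<rho>) * x))}"
proof -
  have "continuous_on (ball 0 (1/r)) (\<lambda>x. norm (f (of_real r * x) - f (of_real (r * \<rho>) * x)))"
    by (intro continuous_intros continuous_on_compose2[OF cont]) (use norm_dilation_less_1 r \<rho> in auto)
  from continuous_open_preimage[OF this open_ball open_greaterThan[of \<kappa>]]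
  show ?thesis by (simp add: vimage_def Int_def)
qed

text \<open>For fixed R < 1 the function f(R z) - f(R \<rho> z) is holomorphic past the closed disc,
  so the maximal inequality covers all radii r < R at once. Its coefficients are bounded by those of
  \<open>f\<close> times \<open>1 - \<rho> ^ n\<close>, so the estimate does not depend on R, and R
  tends to 1 by continuity of the measure from below.\<close>

lemma dilation_difference_weak_type:
  assumes hol: "f holomorphic_on ball 0 1" and bd: "\<And>z. norm z < 1 \<Longrightarrow> norm (f z) \<le> B"
    and a: "\<And>z. norm z < 1 \<Longrightarrow> (\<lambda>n. a n * z ^ n) sums f z"
      "\<And>R. 0 \<le> R \<Longrightarrow> R < 1 \<Longrightarrow> summable (\<lambda>n. norm (a n) * R ^ n)"
      "summable (\<lambda>n. (norm (a n))\<^sup>2)"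
    and \<rho>: "0 < \<rho>" "\<rho> < 1" and \<kappa>: "\<kappa> > 0"
  shows "emeasure circle_measure
      (\<Union>r\<in>{0<..<1}. {x \<in> ball 0 (1/r). \<kappa> < norm (f (of_real r * x) - f (of_real (r * \<rho>) * x))})
    \<le> ennreal (10 / \<kappa>\<^sup>2 * (2 * pi * (\<Sum>n. (norm (a n))\<^sup>2 * (1 - \<rho> ^ n)\<^sup>2)))"
proof -
  define T where "T = (\<Sum>n. (norm (a n))\<^sup>2 * (1 - \<rho> ^ n)\<^sup>2)"
  have cont: "continuous_on (ball 0 1) f" using hol by (rule holomorphic_on_imp_continuous_on)
  define V where "V r = {x \<in> ball 0 (1/r). \<kappa> < norm (f (of_real r * x) - f (of_real (r * \<rho>) * x))}" for r
  have open_V: "open (V r)" if "r \<in> {0<..<1}" for r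
    unfolding V_def using that \<rho> by (intro open_dilation_difference cont) auto
  define W where "W R = (\<Union>r\<in>{0<..<R}. V r)" for R
  have open_W: "open (W R)" if "R \<le> 1" for R
    unfolding W_def using that by (intro open_UN ballI open_V) auto
  have W_le: "emeasure circle_measure (W R) \<le> ennreal (10 / \<kappa>\<^sup>2 * (2 * pi * T))" if R: "0 < R" "R < 1" for R
  proof -
    define F where "F z = f (of_real R * z) - f (of_real (R * \<rho>) * z)" for z
    note 1 = norm_dilation_less_1(1)[OF _ R(1) \<rho>] and 2 = norm_dilation_less_1(2)[OF _ R(1) \<rho>]
    have sub: "cball 0 1 \<subseteq> ball (0::complex) (1/R)"
    proof
      fix x :: complex assume "x \<in> cball 0 1"
      then have "R * norm x \<le> R * 1" using R by (intro mult_left_mono) auto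
      then have "R * norm x < 1" using R by linarith
      then show "x \<in> ball 0 (1/R)" using R by (simp add: field_simps)
    qed
    have cont_F: "continuous_on (ball 0 (1/R)) F"
      unfolding F_def by (intro continuous_intros continuous_on_compose2[OF cont]) (use 1 2 in auto)
    have "f \<circ> (\<lambda>z. of_real R * z) holomorphic_on ball 0 (1/R)"
      by (rule holomorphic_on_compose_gen[OF _ hol]) (use 1 in \<open>auto intro!: holomorphic_intros\<close>)
    moreover have "f \<circ> (\<lambda>z. of_real (R * \<rho>) * z) holomorphic_on ball 0 (1/R)"
      by (rule holomorphic_on_compose_gen[OF _ hol]) (use 2 in \<open>auto intro!: holomorphic_intros\<close>)
    ultimately have hol_F: "F holomorphic_on ball 0 (1/R)"
      unfolding F_def o_def by (rule holomorphic_on_diff)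
    define g where "g x = indicator (sphere 0 1) x *\<^sub>R F x" for x
    have [measurable]: "g \<in> borel_measurable borel"
      unfolding g_def
      by (rule borel_measurable_continuous_on_indicator) (use sub in \<open>auto intro!: continuous_on_subset[OF cont_F]\<close>)
    have cont_g: "continuous_on unit_circle g"
      using continuous_on_subset[OF cont_F order_trans[OF sphere_cball sub]]
      by (subst continuous_on_cong[of _ unit_circle g F]) (auto simp: g_def)
    define b where "b n = a n * of_real R ^ n * of_real (1 - \<rho> ^ n)" for n
    have b_le: "norm (b n) \<le> norm (a n) * R ^ n" for n
      using R \<rho> by (simp add: b_def norm_mult norm_power power_le_one mult_left_le del: of_real_diff of_real_power)
    have ps: "(\<lambda>n. 2 * pi * (norm (b n))\<^sup>2) sums (\<integral>x. (norm (g x))\<^sup>2 \<partial>circle_measure)"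
    proof (rule Parseval_power_series)
      show "summable (\<lambda>n. norm (b n))"
        by (rule summable_comparison_test'[OF a(2)[of R]]) (use R b_le in auto)
      fix x :: complex assume x: "norm x = 1"
      then have xb: "x \<in> ball 0 (1/R)" using R by simp
      have "(\<lambda>n. a n * (of_real R * x) ^ n - a n * (of_real (R * \<rho>) * x) ^ n) sums F x"
        unfolding F_def by (rule sums_diff[OF a(1)[OF 1[OF xb]] a(1)[OF 2[OF xb]]])
      also have "(\<lambda>n. a n * (of_real R * x) ^ n - a n * (of_real (R * \<rho>) * x) ^ n) = (\<lambda>n. b n * x ^ n)"
        by (rule ext) (simp add: b_def power_mult_distrib algebra_simps)
      finally show "(\<lambda>n. b n * x ^ n) sums g x" using x by (simp add: g_def)
    qed simp
    have smT: "summable (\<lambda>n. (norm (a n))\<^sup>2 * (1 - \<rho> ^ n)\<^sup>2)"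
      by (rule summable_comparison_test'[OF a(3)]) (use \<rho> in \<open>auto simp: power_le_one intro!: mult_left_le\<close>)
    have bT: "(norm (b n))\<^sup>2 \<le> (norm (a n))\<^sup>2 * (1 - \<rho> ^ n)\<^sup>2" for n
    proof -
      have "norm (b n) \<le> norm (a n) * (1 - \<rho> ^ n)"
        using R \<rho> by (simp add: b_def norm_mult norm_power power_le_one mult_left_le mult_left_le_one_le mult.assoc del: of_real_diff of_real_power)
          (intro mult_left_mono mult_left_le_one_le, auto simp: power_le_one)
      then have "(norm (b n))\<^sup>2 \<le> (norm (a n) * (1 - \<rho> ^ n))\<^sup>2" by (intro power_mono) auto
      then show ?thesis by (simp add: power_mult_distrib)
    qed
    have "integral {0..2*pi} (\<lambda>t. (norm (F (cis t)))\<^sup>2) = (\<integral>x. (norm (g x))\<^sup>2 \<partial>circle_measure)"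
      by (subst integral_circle_measure_eq_integral) (auto intro!: continuous_intros cont_g simp: g_def[of "cis _"])
    also have "\<dots> = (\<Sum>n. 2 * pi * (norm (b n))\<^sup>2)"
      by (rule sums_unique[OF ps])
    also have "\<dots> \<le> (\<Sum>n. 2 * pi * ((norm (a n))\<^sup>2 * (1 - \<rho> ^ n)\<^sup>2))"
      by (intro suminf_le sums_summable[OF ps] summable_mult smT mult_left_mono bT) auto
    also have "\<dots> = 2 * pi * T" unfolding T_def by (rule suminf_mult[OF smT])
    finally have I_le: "integral {0..2*pi} (\<lambda>t. (norm (F (cis t)))\<^sup>2) \<le> 2 * pi * T" .
    obtain D where D: "D \<in> sets borel"
        "{\<theta> \<in> {0..<2*pi}. \<exists>r. 0 \<le> r \<and> r < 1 \<and> norm (F (of_real r * cis \<theta>)) > \<kappa>} \<subseteq> D"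
        "emeasure lborel D \<le> ennreal (10 / \<kappa>\<^sup>2 * integral {0..2*pi} (\<lambda>t. (norm (F (cis t)))\<^sup>2))"
      using radial_maximal_weak_type[of F \<kappa>] continuous_on_subset[OF cont_F sub]
        holomorphic_on_subset[OF hol_F, of "ball 0 1"] sub \<kappa> by (meson ball_subset_cball order_trans)
    have "{0..<2*pi} \<inter> cis -` W R \<subseteq> D"
    proof
      fix \<theta> assume \<theta>: "\<theta> \<in> {0..<2*pi} \<inter> cis -` W R"
      then obtain r where r: "0 < r" "r < R" "\<kappa> < norm (f (of_real r * cis \<theta>) - f (of_real (r * \<rho>) * cis \<theta>))"
        by (auto simp: W_def V_def)
      \<comment> \<open>The radius \<open>r / R\<close> for \<open>F\<close> corresponds to the
        radius \<open>r\<close> for \<open>f\<close>.\<close>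
      then have "norm (F (of_real (r / R) * cis \<theta>)) > \<kappa>"
        using R by (simp add: F_def field_simps)
      moreover have "0 \<le> r / R" "r / R < 1" using r R by auto
      ultimately show "\<theta> \<in> D" using D(2) \<theta> by blast
    qed
    then have "emeasure circle_measure (W R) \<le> emeasure lborel D"
      using open_W[of R] R D(1) by (subst emeasure_circle_measure) (auto intro!: emeasure_mono)
    also note D(3)
    also have "ennreal (10 / \<kappa>\<^sup>2 * integral {0..2*pi} (\<lambda>t. (norm (F (cis t)))\<^sup>2)) \<le> ennreal (10 / \<kappa>\<^sup>2 * (2 * pi * T))"
      by (intro ennreal_leI mult_left_mono I_le) auto
    finally show ?thesis .
  qed
  \<comment> \<open>The offset 2 keeps \<open>R 0\<close> positive.\<close>
  define R where "R n = 1 - inverse (real (n + 2))" for n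
  have R: "0 < R n" "R n < 1" for n by (auto simp: R_def field_simps)
  have R_mono: "m \<le> n \<Longrightarrow> R m \<le> R n" for m n by (auto simp: R_def)
  have UN: "(\<Union>r\<in>{0<..<1}. V r) = (\<Union>n. W (R n))"
  proof safe
    fix x r assume r: "r \<in> {0<..<1::real}" and x: "x \<in> V r"
    have "R \<longlonglongrightarrow> 1 - 0" unfolding R_def
      by (intro tendsto_intros) (use LIMSEQ_ignore_initial_segment[OF lim_inverse_n, of 2] in simp)
    then have "\<forall>\<^sub>F n in sequentially. r < R n" using r by (intro order_tendstoD) auto
    then obtain n where "r < R n" by (auto simp: eventually_sequentially)
    then have "x \<in> W (R n)" using x r by (auto simp: W_def)
    then show "x \<in> (\<Union>n. W (R n))" by blast
  next
    fix x n assume "x \<in> W (R n)"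
    then obtain r where "r \<in> {0<..<R n}" "x \<in> V r" by (auto simp: W_def)
    then show "x \<in> (\<Union>r\<in>{0<..<1}. V r)" using R(2)[of n] by (intro UN_I[of r]) auto
  qed
  have "emeasure circle_measure (\<Union>n. W (R n)) = (SUP n. emeasure circle_measure (W (R n)))"
  proof (rule SUP_emeasure_incseq[symmetric])
    show "range (\<lambda>n. W (R n)) \<subseteq> sets circle_measure" using open_W R by (auto simp: less_imp_le)
    show "incseq (\<lambda>n. W (R n))"
    proof (rule incseq_SucI, rule subsetI)
      fix n x assume "x \<in> W (R n)"
      then show "x \<in> W (R (Suc n))" using R_mono[of n "Suc n"] by (force simp: W_def)
    qed
  qed
  also have "\<dots> \<le> ennreal (10 / \<kappa>\<^sup>2 * (2 * pi * T))"
    by (intro SUP_least W_le R)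
  finally show ?thesis unfolding UN[symmetric] by (simp add: V_def T_def)
qed

text \<open>For \<rho> close to 1 the dilate f(r \<rho> \<zeta>) is within \<kappa> of f(r \<zeta>)
  for all r, off a set of small measure; and the dilate does converge as r tends to 1, because
  \<rho> \<zeta> is interior. Off the null set \<open>N\<close> this approximation is available for
  every tolerance.\<close>

theorem Fatou_radial_limit:
  assumes hol: "f holomorphic_on ball 0 1" and bd: "\<And>z. norm z < 1 \<Longrightarrow> norm (f z) \<le> B"
  shows "\<exists>N \<in> null_sets circle_measure. {\<zeta> \<in> unit_circle. \<not> (\<exists>L. has_radial_limit f L \<zeta>)} \<subseteq> N"
proof -
  obtain a where a: "\<And>z. norm z < 1 \<Longrightarrow> (\<lambda>n. a n * z ^ n) sums f z"
      "\<And>R. 0 \<le> R \<Longrightarrow> R < 1 \<Longrightarrow> summable (\<lambda>n. norm (a n) * R ^ n)"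
      "summable (\<lambda>n. (norm (a n))\<^sup>2)"
    using holomorphic_coefficients[OF hol bd] by blast
  have cont: "continuous_on (ball 0 1) f" using hol by (rule holomorphic_on_imp_continuous_on)
  define V where "V \<kappa> \<rho> = (\<Union>r\<in>{0<..<1}. {x \<in> ball 0 (1/r). \<kappa> < norm (f (of_real r * x) - f (of_real (r * \<rho>) * x))})" for \<kappa> \<rho> :: real
  define T where "T \<rho> = (\<Sum>n. (norm (a n))\<^sup>2 * (1 - \<rho> ^ n)\<^sup>2)" for \<rho> :: real
  \<comment> \<open>Tannery's theorem with the majorant \<open>(norm (a n))\<^sup>2\<close>; square
    summability enters here.\<close>
  have T_lim: "(T \<longlongrightarrow> 0) (at_left 1)"
  proof -
    have "((\<lambda>\<rho>. suminf (\<lambda>n. (norm (a n))\<^sup>2 * (1 - \<rho> ^ n)\<^sup>2)) \<longlongrightarrow> suminf (\<lambda>n. 0)) (at_left (1::real))"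
    proof (rule tannerys_theorem[THEN conjunct2, THEN conjunct2])
      fix k
      have "((\<lambda>\<rho>. (norm (a k))\<^sup>2 * (1 - \<rho> ^ k)\<^sup>2) \<longlongrightarrow> (norm (a k))\<^sup>2 * (1 - 1 ^ k)\<^sup>2) (at_left (1::real))"
        by (intro tendsto_intros)
      then show "((\<lambda>\<rho>. (norm (a k))\<^sup>2 * (1 - \<rho> ^ k)\<^sup>2) \<longlongrightarrow> 0) (at_left (1::real))" by simp
    next
      have "\<forall>\<^sub>F \<rho> in at_left (1::real). \<forall>k. norm ((norm (a k))\<^sup>2 * (1 - \<rho> ^ k)\<^sup>2) \<le> (norm (a k))\<^sup>2"
        by (rule eventually_mono[OF eventually_at_left_real[of 0 1]])
          (auto simp: power_le_one abs_mult intro!: mult_left_le)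
      then show "\<forall>\<^sub>F (k, \<rho>) in at_top \<times>\<^sub>F at_left (1::real). norm ((norm (a k))\<^sup>2 * (1 - \<rho> ^ k)\<^sup>2) \<le> (norm (a k))\<^sup>2"
        unfolding eventually_prod_filter
        by (intro exI[of _ "\<lambda>_. True"] exI[of _ "\<lambda>\<rho>. \<forall>k. norm ((norm (a k))\<^sup>2 * (1 - \<rho> ^ k)\<^sup>2) \<le> (norm (a k))\<^sup>2"]) auto
    qed (use a(3) in auto)
    then show ?thesis by (simp add: T_def[abs_def])
  qed
  have ex_\<rho>: "\<exists>\<rho>. 0 < \<rho> \<and> \<rho> < 1 \<and> emeasure circle_measure (V \<kappa> \<rho>) \<le> ennreal e" if "\<kappa> > 0" "e > 0" for \<kappa> e
  proof -
    have "((\<lambda>\<rho>. 10 / \<kappa>\<^sup>2 * (2 * pi * T \<rho>)) \<longlongrightarrow> 10 / \<kappa>\<^sup>2 * (2 * pi * 0)) (at_left 1)"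
      by (intro tendsto_intros T_lim)
    then have "\<forall>\<^sub>F \<rho> in at_left 1. 10 / \<kappa>\<^sup>2 * (2 * pi * T \<rho>) < e"
      by (rule order_tendstoD) (use that in auto)
    moreover have "\<forall>\<^sub>F \<rho> in at_left (1::real). \<rho> \<in> {0<..<1}"
      by (rule eventually_at_left_real) simp
    ultimately have "\<forall>\<^sub>F \<rho> in at_left 1. 10 / \<kappa>\<^sup>2 * (2 * pi * T \<rho>) < e \<and> \<rho> \<in> {0<..<1}"
      by eventually_elim simp
    from eventually_happens'[OF trivial_limit_at_left_real this]
    obtain \<rho> where \<rho>: "10 / \<kappa>\<^sup>2 * (2 * pi * T \<rho>) < e" "0 < \<rho>" "\<rho> < 1"
      unfolding greaterThanLessThan_iff by blast
    have "emeasure circle_measure (V \<kappa> \<rho>) \<le> ennreal (10 / \<kappa>\<^sup>2 * (2 * pi * T \<rho>))"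
      unfolding V_def T_def by (rule dilation_difference_weak_type[OF hol bd a \<rho>(2,3) that(1)])
    also have "\<dots> \<le> ennreal e" using \<rho> by (intro ennreal_leI) simp
    finally show ?thesis using \<rho> by blast
  qed
  define \<kappa> where "\<kappa> m = inverse (real (Suc m))" for m
  have "\<forall>m k. \<exists>\<rho>. 0 < \<rho> \<and> \<rho> < 1 \<and> emeasure circle_measure (V (\<kappa> m) \<rho>) \<le> ennreal (inverse (real (Suc k)))"
    by (intro allI ex_\<rho>) (auto simp: \<kappa>_def)
  then obtain \<rho> where \<rho>: "\<And>m k. 0 < \<rho> m k" "\<And>m k. \<rho> m k < 1"
    "\<And>m k. emeasure circle_measure (V (\<kappa> m) (\<rho> m k)) \<le> ennreal (inverse (real (Suc k)))"
    by metis
  have V_borel: "V (\<kappa> m) (\<rho> m k) \<in> sets borel" for m k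
    unfolding V_def using \<rho>(1,2) by (intro borel_open open_UN ballI open_dilation_difference cont) auto
  \<comment> \<open>A point is excluded when, for some tolerance \<open>\<kappa> m\<close>, it is
    bad for all of the \<open>\<rho> m k\<close>; the measures tend to 0 with growing
    \<open>k\<close>, so each intersection is null.\<close>
  define N where "N = (\<Union>m. \<Inter>k. V (\<kappa> m) (\<rho> m k))"
  have "(\<Inter>k. V (\<kappa> m) (\<rho> m k)) \<in> null_sets circle_measure" for m
  proof -
    have I: "(\<Inter>k. V (\<kappa> m) (\<rho> m k)) \<in> sets borel"
      using V_borel by (intro sets.countable_INT) auto
    have "emeasure circle_measure (\<Inter>k. V (\<kappa> m) (\<rho> m k)) \<le> ennreal (inverse (real (Suc k)))" for k
      using V_borel by (intro order_trans[OF emeasure_mono \<rho>(3)[of m k]]) auto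
    moreover have "(\<lambda>k. ennreal (inverse (real (Suc k)))) \<longlonglongrightarrow> ennreal 0"
      by (intro tendsto_ennrealI LIMSEQ_inverse_real_of_nat)
    ultimately have "emeasure circle_measure (\<Inter>k. V (\<kappa> m) (\<rho> m k)) \<le> ennreal 0"
      by (intro tendsto_lowerbound[of _ _ sequentially]) auto
    with I show ?thesis by (simp add: null_sets_def)
  qed
  then have "N \<in> null_sets circle_measure" unfolding N_def by (intro null_sets_UN) auto
  moreover have "\<exists>L. has_radial_limit f L \<zeta>" if \<zeta>: "\<zeta> \<in> unit_circle" "\<zeta> \<notin> N" for \<zeta>
    unfolding has_radial_limit_def
  proof (rule ex_tendsto_if_approximable)
    fix e :: real assume "e > 0"
    then obtain m where m: "\<kappa> m < e" unfolding \<kappa>_def using reals_Archimedean by blast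
    obtain k where k: "\<zeta> \<notin> V (\<kappa> m) (\<rho> m k)" using \<zeta>(2) by (auto simp: N_def)
    define q where "q = \<rho> m k"
    have q: "0 < q" "q < 1" using \<rho> by (auto simp: q_def)
    have le: "norm (f (of_real r * \<zeta>) - f (of_real (r * q) * \<zeta>)) \<le> \<kappa> m" if "0 < r" "r < 1" for r
    proof (rule ccontr)
      assume "\<not> ?thesis"
      moreover have "\<zeta> \<in> ball 0 (1/r)" using \<zeta>(1) that by (simp add: field_simps)
      ultimately have "\<zeta> \<in> V (\<kappa> m) (\<rho> m k)"
        unfolding V_def q_def using that by (intro UN_I[of r]) auto
      with k show False by simp
    qed
    have "\<forall>\<^sub>F r in at_left 1. dist (f (of_real r * \<zeta>)) (f (of_real (r * q) * \<zeta>)) \<le> e"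
    proof (rule eventually_mono[OF eventually_at_left_real[of 0 1]])
      fix r :: real assume "r \<in> {0<..<1}"
      with le[of r] m show "dist (f (of_real r * \<zeta>)) (f (of_real (r * q) * \<zeta>)) \<le> e"
        by (simp add: dist_norm)
    qed simp
    moreover have "isCont f (of_real (1 * q) * \<zeta>)"
      using cont q \<zeta>(1) by (auto simp: continuous_on_eq_continuous_at norm_mult)
    then have "((\<lambda>r. f (of_real (r * q) * \<zeta>)) \<longlongrightarrow> f (of_real (1 * q) * \<zeta>)) (at_left 1)"
      by (rule isCont_tendsto_compose) (intro tendsto_intros)
    ultimately show "\<exists>g l. (g \<longlongrightarrow> l) (at_left 1) \<and> (\<forall>\<^sub>F r in at_left 1. dist (f (of_real r * \<zeta>)) (g r) \<le> e)"
      by (intro exI conjI)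
  qed simp
  ultimately show ?thesis by blast
qed

section \<open>Herglotz integrals of indicator functions\<close>

text \<open>Cauchy's estimate on discs of radius r/2 turns the local majorant \<open>w\<close> into
  the majorant \<open>2 * w x / r\<close> for the difference quotients. Existence of the limit of
  their integrals is enough for differentiability, so measurability of the pointwise derivative in
  \<open>x\<close> does not have to be treated.\<close>

lemma holomorphic_on_integral:
  fixes f :: "'a \<Rightarrow> complex \<Rightarrow> complex"
  assumes "open S" and hol: "AE x in M. f x holomorphic_on S"
    and meas: "\<And>z. z \<in> S \<Longrightarrow> (\<lambda>x. f x z) \<in> borel_measurable M"
    and bound: "\<And>z. z \<in> S \<Longrightarrow> \<exists>r w. 0 < r \<and> cball z r \<subseteq> S \<and> integrable M w \<and> (AE x in M. \<forall>y\<in>cball z r. norm (f x y) \<le> w x)"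
  shows "(\<lambda>z. \<integral>x. f x z \<partial>M) holomorphic_on S"
proof -
  have "(\<lambda>z. \<integral>x. f x z \<partial>M) field_differentiable (at z)" if z: "z \<in> S" for z
  proof -
    obtain r w where r: "0 < r" "cball z r \<subseteq> S" and w: "integrable M w"
      and le: "AE x in M. \<forall>y\<in>cball z r. norm (f x y) \<le> w x" using bound[OF z] by blast
    have int: "integrable M (\<lambda>x. f x y)" if "y \<in> cball z r" for y
    proof (rule Bochner_Integration.integrable_bound[OF w])
      show "(\<lambda>x. f x y) \<in> borel_measurable M" using meas that r by blast
      show "AE x in M. norm (f x y) \<le> norm (w x)" using le by eventually_elim (use that in force)
    qed
    define Q where "Q y x = (f x y - f x z) / (y - z)" for y x
    have mQ: "Q y \<in> borel_measurable M" if "y \<in> S" for y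
      unfolding Q_def using meas[OF that] meas[OF z] by measurable
    have Q_lim: "AE x in M. ((\<lambda>y. Q y x) \<longlongrightarrow> deriv (f x) z) (at z)"
      using hol
    proof eventually_elim
      case (elim x)
      then have "(f x has_field_derivative deriv (f x) z) (at z)"
        using \<open>open S\<close> z by (simp add: holomorphic_derivI)
      then show ?case unfolding has_field_derivative_iff Q_def .
    qed
    have Q_le: "AE x in M. \<forall>y\<in>ball z (r/2). norm (Q y x) \<le> 2 * w x / r"
      using hol le
    proof eventually_elim
      case (elim x)
      have w0: "0 \<le> w x" using elim(2) r(1) by (metis centre_in_cball less_imp_le norm_ge_zero order_trans)
      have d: "norm (deriv (f x) v) \<le> 2 * w x / r" if v: "v \<in> ball z (r/2)" for v
      proof -
        have sub: "cball v (r/2) \<subseteq> cball z r"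
          using v by (intro cball_subset_cball_iff[THEN iffD2]) (auto simp: dist_commute)
        have "norm ((deriv ^^ 1) (f x) v) \<le> fact 1 * w x / (r/2) ^ 1"
        proof (rule Cauchy_inequality)
          show "f x holomorphic_on ball v (r/2)"
            using elim(1) sub r(2) by (meson ball_subset_cball holomorphic_on_subset order_trans)
          show "continuous_on (cball v (r/2)) (f x)"
            using elim(1) sub r(2) by (meson holomorphic_on_imp_continuous_on holomorphic_on_subset order_trans)
          show "norm (f x y) \<le> w x" if "norm (v - y) = r/2" for y
            using elim(2) sub that by (auto simp: subset_iff dist_norm)
        qed (use r in auto)
        then show ?thesis by (simp add: mult.commute)
      qed
      show ?case
      proof
        fix y assume y: "y \<in> ball z (r/2)"
        have "norm (f x y - f x z) \<le> 2 * w x / r * norm (y - z)"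
        proof (rule field_differentiable_bound[of "ball z (r/2)" "f x" "deriv (f x)"])
          show "(f x has_field_derivative deriv (f x) v) (at v within ball z (r/2))" if "v \<in> ball z (r/2)" for v
          proof -
            have "v \<in> S" using that r by (auto simp: subset_iff)
            then show ?thesis using elim(1) \<open>open S\<close> by (simp add: holomorphic_derivI)
          qed
        qed (use y r d in auto)
        then show "norm (Q y x) \<le> 2 * w x / r"
          using w0 r by (cases "y = z") (auto simp: Q_def norm_divide divide_simps mult_ac)
      qed
    qed
    have at: "at z within ball z (r/2) = at z"
      using r by (intro at_within_open) auto
    have "\<exists>L. ((\<lambda>y. \<integral>x. Q y x \<partial>M) \<longlongrightarrow> L) (at z within ball z (r/2))"
    proof (rule dominated_convergence_within_ex[where w = "\<lambda>x. 2 * w x / r"])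
      show "Q y \<in> borel_measurable M" if "y \<in> ball z (r/2)" for y
        by (rule mQ) (use that r in \<open>auto simp: subset_iff\<close>)
      show "AE x in M. \<exists>l. ((\<lambda>y. Q y x) \<longlongrightarrow> l) (at z within ball z (r/2))"
        using Q_lim unfolding at by eventually_elim blast
      show "AE x in M. norm (Q y x) \<le> 2 * w x / r" if "y \<in> ball z (r / 2)" for y
        using Q_le by eventually_elim (use that in blast)
    qed (use w at in auto)
    then obtain L where "((\<lambda>y. \<integral>x. Q y x \<partial>M) \<longlongrightarrow> L) (at z)"
      unfolding at by blast
    moreover have "\<forall>\<^sub>F y in at z. (\<integral>x. Q y x \<partial>M) = ((\<integral>x. f x y \<partial>M) - (\<integral>x. f x z \<partial>M)) / (y - z)"
      unfolding eventually_at
    proof (intro exI[of _ r] conjI ballI impI)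
      fix y assume "y \<noteq> z \<and> dist y z < r"
      then have "integrable M (\<lambda>x. f x y)" "integrable M (\<lambda>x. f x z)"
        using r by (auto intro!: int simp: dist_commute)
      then show "(\<integral>x. Q y x \<partial>M) = ((\<integral>x. f x y \<partial>M) - (\<integral>x. f x z \<partial>M)) / (y - z)"
        unfolding Q_def by simp
    qed (use r in auto)
    ultimately have "((\<lambda>y. ((\<integral>x. f x y \<partial>M) - (\<integral>x. f x z \<partial>M)) / (y - z)) \<longlongrightarrow> L) (at z)"
      by (rule Lim_transform_eventually)
    then show ?thesis
      unfolding field_differentiable_def has_field_derivative_iff by blast
  qed
  then show ?thesis
    by (simp add: holomorphic_on_def field_differentiable_at_within)
qed

section \<open>The Herglotz integral and its real part\<close>

text \<open>The real part is the Poisson integral of the indicator of \<open>A\<close>, that is, the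
  harmonic measure of \<open>A\<close> seen from \<open>z\<close>; the division normalises the whole
  circle to 1.\<close>

definition herglotz :: "complex set \<Rightarrow> complex \<Rightarrow> complex" where
  "herglotz A z = (\<integral>x. indicator A x *\<^sub>R ((x + z) / (x - z)) \<partial>circle_measure) / (2 * pi)"

lemma norm_herglotz_eq:
  "norm (herglotz A z) = norm (\<integral>x. indicator A x *\<^sub>R ((x + z) / (x - z)) \<partial>circle_measure) / (2 * pi)"
  by (simp add: herglotz_def norm_divide)

lemma herglotz_kernel_bound:
  fixes x z :: complex
  assumes "norm x = 1" "norm z < 1"
  shows "norm ((x + z) / (x - z)) \<le> 2 / (1 - norm z)"
proof -
  have "1 - norm z \<le> norm (x - z)" using norm_triangle_ineq2[of x z] assms by simp
  moreover have "norm (x + z) \<le> 2" using norm_triangle_ineq[of x z] assms by simp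
  ultimately show ?thesis using assms by (simp add: norm_divide frac_le)
qed

lemma Re_herglotz_kernel:
  assumes "norm x = 1"
  shows "Re ((x + z) / (x - z)) = (1 - (norm z)\<^sup>2) / (norm (x - z))\<^sup>2"
proof -
  have "Re ((x + z) / (x - z)) = Re ((x + z) * cnj (x - z)) / (norm (x - z))\<^sup>2"
    by (simp add: complex_div_cnj[of "x+z"])
  also have "Re ((x + z) * cnj (x - z)) = (norm x)\<^sup>2 - (norm z)\<^sup>2"
    unfolding cmod_power2 by (simp add: power2_eq_square algebra_simps)
  finally show ?thesis using assms by simp
qed

lemma Re_herglotz_kernel_nonneg:
  assumes "norm x = 1" "norm z < 1"
  shows "Re ((x + z) / (x - z)) \<ge> 0"
  unfolding Re_herglotz_kernel[OF assms(1)] using assms(2) by (simp add: power_le_one)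

lemma herglotz_kernel_measurable:
  assumes "A \<in> sets borel"
  shows "(\<lambda>x. indicator A x *\<^sub>R ((x + z) / (x - z))) \<in> borel_measurable (borel :: complex measure)"
  using assms by measurable

lemma herglotz_integrable:
  assumes "A \<in> sets borel" "norm z < 1"
  shows "integrable circle_measure (\<lambda>x. indicator A x *\<^sub>R ((x + z) / (x - z)))"
proof (rule integrable_circle_measure_bounded[where C = "2 / (1 - norm z)"])
  show "norm (indicator A x *\<^sub>R ((x + z) / (x - z))) \<le> 2 / (1 - norm z)" if "norm x = 1" for x
    using herglotz_kernel_bound[OF that assms(2)] assms(2) by (auto simp: indicator_def)
qed (rule herglotz_kernel_measurable[OF assms(1)])

lemma holomorphic_herglotz:
  assumes "A \<in> sets borel"
  shows "herglotz A holomorphic_on ball 0 1"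
proof -
  have "(\<lambda>z. \<integral>x. indicator A x *\<^sub>R ((x + z) / (x - z)) \<partial>circle_measure) holomorphic_on ball 0 1"
  proof (rule holomorphic_on_integral)
    show "AE x in circle_measure. (\<lambda>z. indicator A x *\<^sub>R ((x + z) / (x - z))) holomorphic_on ball 0 1"
      using AE_circle_measure
    proof eventually_elim
      case (elim x)
      then have "(\<lambda>z. of_real (indicator A x) * ((x + z) / (x - z))) holomorphic_on ball 0 1"
        by (intro holomorphic_intros) auto
      then show ?case by (simp add: scaleR_conv_of_real)
    qed
    fix z :: complex assume z: "z \<in> ball 0 1"
    define r where "r = (1 - norm z) / 2"
    have r: "0 < r" using z by (simp add: r_def)
    have *: "norm y \<le> 1 - r" if "y \<in> cball z r" for y
      using norm_triangle_ineq2[of y z] that by (simp add: r_def dist_norm norm_minus_commute field_simps)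
    have "AE x in circle_measure. \<forall>y\<in>cball z r. norm (indicator A x *\<^sub>R ((x + y) / (x - y))) \<le> 2 / r"
      using AE_circle_measure
    proof eventually_elim
      case (elim x)
      show ?case
      proof
        fix y assume y: "y \<in> cball z r"
        have "norm ((x + y) / (x - y)) \<le> 2 / (1 - norm y)"
          by (rule herglotz_kernel_bound[OF elim]) (use *[OF y] r in auto)
        also have "\<dots> \<le> 2 / r" using *[OF y] r by (intro divide_left_mono) auto
        finally show "norm (indicator A x *\<^sub>R ((x + y) / (x - y))) \<le> 2 / r"
          using r by (auto simp: indicator_def)
      qed
    qed
    moreover have "cball z r \<subseteq> ball 0 1" using * r by fastforce
    ultimately show "\<exists>r w. 0 < r \<and> cball z r \<subseteq> ball 0 1 \<and> integrable circle_measure w \<and>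
        (AE x in circle_measure. \<forall>y\<in>cball z r. norm (indicator A x *\<^sub>R ((x + y) / (x - y))) \<le> w x)"
      using r by (intro exI[of _ r] exI[of _ "\<lambda>_. 2/r"]) auto
  qed (use herglotz_kernel_measurable[OF assms] in auto)
  then show ?thesis
    unfolding herglotz_def[abs_def] by (intro holomorphic_intros) auto
qed

lemma Re_herglotz_mono:
  assumes "A \<in> sets borel" "B \<in> sets borel" "A \<subseteq> B" "norm z < 1"
  shows "Re (herglotz A z) \<le> Re (herglotz B z)"
proof -
  have "(\<integral>x. Re (indicator A x *\<^sub>R ((x + z) / (x - z))) \<partial>circle_measure)
      \<le> (\<integral>x. Re (indicator B x *\<^sub>R ((x + z) / (x - z))) \<partial>circle_measure)"
  proof (rule integral_mono_AE)
    show "AE x in circle_measure. Re (indicator A x *\<^sub>R ((x + z) / (x - z))) \<le> Re (indicator B x *\<^sub>R ((x + z) / (x - z)))"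
      using AE_circle_measure
      by eventually_elim (use assms Re_herglotz_kernel_nonneg in \<open>auto simp: indicator_def\<close>)
  qed (intro integrable_Re herglotz_integrable assms)+
  then have "Re (\<integral>x. indicator A x *\<^sub>R ((x + z) / (x - z)) \<partial>circle_measure)
      \<le> Re (\<integral>x. indicator B x *\<^sub>R ((x + z) / (x - z)) \<partial>circle_measure)"
    by (simp only: integral_Re[OF herglotz_integrable[OF assms(1,4)]] integral_Re[OF herglotz_integrable[OF assms(2,4)]])
  then show ?thesis
    by (simp add: herglotz_def divide_right_mono)
qed

lemma Re_herglotz_nonneg:
  assumes "A \<in> sets borel" "norm z < 1"
  shows "Re (herglotz A z) \<ge> 0"
  using Re_herglotz_mono[of "{}" A z] assms by (simp add: herglotz_def)

lemma herglotz_Un_disjoint: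
  assumes "A \<in> sets borel" "B \<in> sets borel" "A \<inter> B = {}" "norm z < 1"
  shows "herglotz (A \<union> B) z = herglotz A z + herglotz B z"
proof -
  have eq: "indicator (A \<union> B) x *\<^sub>R ((x + z) / (x - z))
      = indicator A x *\<^sub>R ((x + z) / (x - z)) + indicator B x *\<^sub>R ((x + z) / (x - z))" for x
    using assms(3) by (auto simp: indicator_def)
  show ?thesis
    unfolding herglotz_def eq
      Bochner_Integration.integral_add[OF herglotz_integrable[OF assms(1,4)] herglotz_integrable[OF assms(2,4)]]
    by (rule add_divide_distrib)
qed

lemma herglotz_UNIV:
  assumes "norm z < 1"
  shows "herglotz UNIV z = 1"
proof -
  have ne: "cis t - z \<noteq> 0" for t using assms by (metis eq_iff_diff_eq_0 less_irrefl norm_cis)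
  have "((\<lambda>t. 1 * cis t / (cis t - z)) has_integral 2 * pi * 1) {0..2*pi}"
    using Cauchy_integral_cis[of "\<lambda>_. 1" z] assms by simp
  \<comment> \<open>The identity (x + z) / (x - z) = 2 x / (x - z) - 1 reduces the kernel to
    Cauchy's.\<close>
  from has_integral_diff[OF has_integral_mult_right[OF this, of 2] has_integral_const_real[of 1 0 "2*pi"]]
  have "((\<lambda>t. (cis t + z) / (cis t - z)) has_integral 2 * pi) {0..2*pi}"
    using ne by (simp add: field_simps scaleR_conv_of_real)
  moreover have "(\<integral>x. (x + z) / (x - z) \<partial>circle_measure) = integral {0..2*pi} (\<lambda>t. (cis t + z) / (cis t - z))"
  proof (rule integral_circle_measure_eq_integral)
    show "continuous_on unit_circle (\<lambda>x. (x + z) / (x - z))"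
      using assms by (intro continuous_intros) auto
  qed measurable
  ultimately show ?thesis by (simp add: herglotz_def has_integral_iff)
qed

lemma norm_herglotz_le:
  assumes "A \<in> sets borel" "norm z < 1"
  shows "norm (herglotz A z) \<le> measure circle_measure A / (pi * (1 - norm z))"
proof -
  have "norm (\<integral>x. indicator A x *\<^sub>R ((x + z) / (x - z)) \<partial>circle_measure)
      \<le> (\<integral>x. norm (indicator A x *\<^sub>R ((x + z) / (x - z))) \<partial>circle_measure)"
    by (rule integral_norm_bound)
  also have "\<dots> \<le> (\<integral>x. 2 / (1 - norm z) * indicator A x \<partial>circle_measure)"
  proof (rule integral_mono_AE)
    show "AE x in circle_measure. norm (indicator A x *\<^sub>R ((x + z) / (x - z))) \<le> 2 / (1 - norm z) * indicator A x"
      using AE_circle_measure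
      by eventually_elim (use herglotz_kernel_bound assms(2) in \<open>auto simp: indicator_def\<close>)
    show "integrable circle_measure (\<lambda>x. norm (indicator A x *\<^sub>R ((x + z) / (x - z))))"
      using herglotz_integrable[OF assms] by (rule integrable_norm)
    show "integrable circle_measure (\<lambda>x. 2 / (1 - norm z) * indicator A x)"
      using assms by (intro integrable_mult_right integrable_real_indicator) (auto simp: circle_measure.emeasure_eq_measure)
  qed
  also have "\<dots> = 2 / (1 - norm z) * measure circle_measure A"
    using assms by simp
  finally have "norm (herglotz A z) \<le> 2 / (1 - norm z) * measure circle_measure A / (2 * pi)"
    unfolding norm_herglotz_eq by (rule divide_right_mono) simp
  then show ?thesis by (simp add: mult.commute)
qed

lemma at_left_1_eq: "at_left (1::real) = at 1 within {0<..<1}"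
  by (rule at_within_nhd[of _ "{0<..}"]) auto

section \<open>Control along a radius by a potential\<close>

text \<open>For \<zeta> on the circle and outside \<open>A\<close> this dominates the Herglotz
  integral along the entire radius to \<zeta>: finiteness gives a radial limit, smallness gives a
  small integral. Extended values make countable subadditivity unconditional.\<close>

definition reciprocal_potential :: "complex set \<Rightarrow> complex \<Rightarrow> ennreal" where
  "reciprocal_potential A \<zeta> = (\<integral>\<^sup>+x. ennreal (1 / dist x \<zeta>) * indicator A x \<partial>circle_measure)"

lemma reciprocal_potential_mono:
  "A \<subseteq> B \<Longrightarrow> reciprocal_potential A \<zeta> \<le> reciprocal_potential B \<zeta>"
  unfolding reciprocal_potential_def
  by (intro nn_integral_mono mult_left_mono) (auto simp: indicator_def)

lemma reciprocal_potential_UN_le: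
  assumes "\<And>n. A n \<in> sets borel"
  shows "reciprocal_potential (\<Union>n. A n) \<zeta> \<le> (\<Sum>n. reciprocal_potential (A n) \<zeta>)"
proof -
  have "(\<lambda>x. ennreal (1 / dist x \<zeta>)) \<in> borel_measurable circle_measure" by measurable
  then have "reciprocal_potential A \<zeta> = emeasure (density circle_measure (\<lambda>x. ennreal (1 / dist x \<zeta>))) A"
    if "A \<in> sets borel" for A
    unfolding reciprocal_potential_def using that by (subst emeasure_density) auto
  then show ?thesis
    using assms by (simp add: emeasure_subadditive_countably image_subset_iff sets.countable_UN)
qed

lemma reciprocal_potential_le:
  assumes "A \<in> sets borel" "\<delta> > 0" "\<And>x. x \<in> A \<Longrightarrow> dist x \<zeta> \<ge> \<delta>"
  shows "reciprocal_potential A \<zeta> \<le> ennreal (1 / \<delta>) * emeasure circle_measure A"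
proof -
  have "reciprocal_potential A \<zeta> \<le> (\<integral>\<^sup>+x. ennreal (1 / \<delta>) * indicator A x \<partial>circle_measure)"
    unfolding reciprocal_potential_def
    using assms(2,3) by (intro nn_integral_mono) (auto simp: indicator_def intro!: ennreal_leI frac_le)
  also have "\<dots> = ennreal (1 / \<delta>) * emeasure circle_measure A"
    using assms by (subst nn_integral_cmult_indicator) auto
  finally show ?thesis .
qed

text \<open>On the radius, 1 - r is both the distance from z to \<zeta> and a lower bound for |x -
  z|; hence |x - \<zeta>| is at most 2 |x - z|. The numerator contributes another factor 2.\<close>

lemma herglotz_kernel_radial_bound:
  fixes x \<zeta> :: complex
  assumes "norm x = 1" "norm \<zeta> = 1" "x \<noteq> \<zeta>" "0 \<le> r" "r < 1"
  shows "norm ((x + of_real r * \<zeta>) / (x - of_real r * \<zeta>)) \<le> 4 / dist x \<zeta>"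
proof -
  let ?z = "of_real r * \<zeta>"
  have n: "norm ?z = r" using assms by (simp add: norm_mult)
  have 1: "1 - r \<le> norm (x - ?z)"
    using norm_triangle_ineq2[of x ?z] unfolding n assms(1) .
  have "?z - \<zeta> = of_real (r - 1) * \<zeta>" by (simp add: algebra_simps)
  then have 2: "norm (?z - \<zeta>) = 1 - r"
    using assms(2,5) by (simp add: norm_mult del: of_real_diff)
  have "dist x \<zeta> \<le> norm (x - ?z) + norm (?z - \<zeta>)"
    using dist_triangle[of x \<zeta> ?z] unfolding dist_norm .
  with 1 2 have d: "dist x \<zeta> / 2 \<le> norm (x - ?z)" by linarith
  have "norm (x + ?z) \<le> 1 + r" using norm_triangle_ineq[of x ?z] unfolding n assms(1) .
  then have "norm (x + ?z) \<le> 2" using assms(5) by linarith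
  moreover have "0 < dist x \<zeta> / 2" using assms(3) by simp
  ultimately have "norm ((x + ?z) / (x - ?z)) \<le> 2 / (dist x \<zeta> / 2)"
    unfolding norm_divide using d by (intro frac_le) simp_all
  then show ?thesis by simp
qed

lemma norm_herglotz_radial_le:
  assumes A: "A \<in> sets borel" "\<zeta> \<notin> A" and \<zeta>: "norm \<zeta> = 1" and r: "0 \<le> r" "r < 1"
  shows "ennreal (norm (herglotz A (of_real r * \<zeta>))) \<le> reciprocal_potential A \<zeta>"
proof -
  let ?k = "\<lambda>x. (x + of_real r * \<zeta>) / (x - of_real r * \<zeta>)"
  have z: "norm (of_real r * \<zeta>) < 1" using \<zeta> r by (simp add: norm_mult)
  have "ennreal (norm (\<integral>x. indicator A x *\<^sub>R ?k x \<partial>circle_measure))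
      \<le> (\<integral>\<^sup>+x. ennreal (norm (indicator A x *\<^sub>R ?k x)) \<partial>circle_measure)"
    by (rule integral_norm_bound_ennreal[OF herglotz_integrable[OF A(1) z]])
  also have "\<dots> \<le> (\<integral>\<^sup>+x. 4 * (ennreal (1 / dist x \<zeta>) * indicator A x) \<partial>circle_measure)"
  proof (rule nn_integral_mono_AE)
    show "AE x in circle_measure. ennreal (norm (indicator A x *\<^sub>R ?k x)) \<le> 4 * (ennreal (1 / dist x \<zeta>) * indicator A x)"
      using AE_circle_measure
    proof eventually_elim
      case (elim x)
      show ?case
      proof (cases "x \<in> A")
        case True
        then have "x \<noteq> \<zeta>" using A(2) by blast
        then have "norm (?k x) \<le> 4 * (1 / dist x \<zeta>)"
          using herglotz_kernel_radial_bound[OF elim \<zeta> _ r] by simp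
        then have "ennreal (norm (?k x)) \<le> ennreal 4 * ennreal (1 / dist x \<zeta>)"
          unfolding ennreal_mult[OF zero_le_numeral divide_nonneg_nonneg[OF zero_le_one zero_le_dist], symmetric]
          by (rule ennreal_leI)
        then show ?thesis using True by simp
      qed auto
    qed
  qed
  also have "\<dots> = 4 * reciprocal_potential A \<zeta>"
    unfolding reciprocal_potential_def using A(1) by (intro nn_integral_cmult) simp
  finally have le: "ennreal (norm (\<integral>x. indicator A x *\<^sub>R ?k x \<partial>circle_measure)) \<le> 4 * reciprocal_potential A \<zeta>" .
  show ?thesis
  proof (cases "reciprocal_potential A \<zeta>" rule: ennreal_cases)
    case (real p)
    with le have "norm (\<integral>x. indicator A x *\<^sub>R ?k x \<partial>circle_measure) \<le> 4 * p"
      by (simp add: ennreal_mult[symmetric] ennreal_le_iff flip: ennreal_numeral)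
    then have "norm (herglotz A (of_real r * \<zeta>)) \<le> 4 * p / (2 * pi)"
      unfolding norm_herglotz_eq by (rule divide_right_mono) simp
    \<comment> \<open>The kernel constant 4 is absorbed by the normalisation: 4 / (2 pi) is at most
      1.\<close>
    also have "\<dots> \<le> p" using real mult_right_mono[OF pi_ge_two, of p] by (simp add: field_simps)
    finally show ?thesis using real by (simp add: ennreal_leI)
  qed auto
qed

lemma herglotz_radial_limit:
  assumes A: "A \<in> sets borel" "\<zeta> \<notin> A" and \<zeta>: "norm \<zeta> = 1" and fin: "reciprocal_potential A \<zeta> < \<infinity>"
  shows "\<exists>L. has_radial_limit (herglotz A) L \<zeta>"
proof -
  have [measurable]: "A \<in> sets borel" by fact
  have "((\<lambda>r. \<integral>x. indicator A x *\<^sub>R ((x + of_real r * \<zeta>) / (x - of_real r * \<zeta>)) \<partial>circle_measure) \<longlongrightarrow>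
      (\<integral>x. indicator A x *\<^sub>R ((x + \<zeta>) / (x - \<zeta>)) \<partial>circle_measure)) (at 1 within {0<..<1})"
  proof (rule dominated_convergence_within[where w = "\<lambda>x. 4 * (1 / dist x \<zeta> * indicator A x)"])
    show "(\<lambda>x. indicator A x *\<^sub>R ((x + of_real r * \<zeta>) / (x - of_real r * \<zeta>))) \<in> borel_measurable circle_measure" for r
      by measurable
    show "(\<lambda>x. indicator A x *\<^sub>R ((x + \<zeta>) / (x - \<zeta>))) \<in> borel_measurable circle_measure"
      by measurable
    have "integrable circle_measure (\<lambda>x. 1 / dist x \<zeta> * indicator A x)"
    proof (rule integrableI_bounded)
      have "(\<integral>\<^sup>+x. ennreal (norm (1 / dist x \<zeta> * indicator A x)) \<partial>circle_measure) = reciprocal_potential A \<zeta>"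
        unfolding reciprocal_potential_def by (intro nn_integral_cong) (auto simp: indicator_def)
      then show "(\<integral>\<^sup>+x. ennreal (norm (1 / dist x \<zeta> * indicator A x)) \<partial>circle_measure) < \<infinity>"
        using fin by simp
    qed measurable
    then show "integrable circle_measure (\<lambda>x. 4 * (1 / dist x \<zeta> * indicator A x))"
      by (rule integrable_mult_right)
    show "AE x in circle_measure. ((\<lambda>r. indicator A x *\<^sub>R ((x + of_real r * \<zeta>) / (x - of_real r * \<zeta>)))
        \<longlongrightarrow> indicator A x *\<^sub>R ((x + \<zeta>) / (x - \<zeta>))) (at 1 within {0<..<1})"
    proof (rule AE_I2)
      fix x
      show "((\<lambda>r. indicator A x *\<^sub>R ((x + of_real r * \<zeta>) / (x - of_real r * \<zeta>)))
        \<longlongrightarrow> indicator A x *\<^sub>R ((x + \<zeta>) / (x - \<zeta>))) (at 1 within {0<..<1})"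
      proof (cases "x \<in> A")
        case True
        then have "x - of_real 1 * \<zeta> \<noteq> 0" using A by auto
        then have "((\<lambda>r. indicator A x *\<^sub>R ((x + of_real r * \<zeta>) / (x - of_real r * \<zeta>)))
          \<longlongrightarrow> indicator A x *\<^sub>R ((x + of_real 1 * \<zeta>) / (x - of_real 1 * \<zeta>))) (at 1 within {0<..<1})"
          by (intro tendsto_intros)
        then show ?thesis by simp
      qed simp
    qed
    show "AE x in circle_measure. norm (indicator A x *\<^sub>R ((x + of_real r * \<zeta>) / (x - of_real r * \<zeta>)))
        \<le> 4 * (1 / dist x \<zeta> * indicator A x)" if "r \<in> {0<..<1}" for r
      using AE_circle_measure
    proof eventually_elim
      case (elim x)
      show ?case
      proof (cases "x \<in> A")
        case True
        then have "x \<noteq> \<zeta>" using A by blast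
        then show ?thesis
          using herglotz_kernel_radial_bound[OF elim \<zeta>, of r] that True by simp
      qed simp
    qed
  qed
  moreover have "complex_of_real (2 * pi) \<noteq> 0" by simp
  ultimately have "((\<lambda>r. (\<integral>x. indicator A x *\<^sub>R ((x + of_real r * \<zeta>) / (x - of_real r * \<zeta>)) \<partial>circle_measure) / complex_of_real (2 * pi)) \<longlongrightarrow>
      (\<integral>x. indicator A x *\<^sub>R ((x + \<zeta>) / (x - \<zeta>)) \<partial>circle_measure) / complex_of_real (2 * pi)) (at 1 within {0<..<1})"
    by (intro tendsto_divide tendsto_const)
  then show ?thesis unfolding has_radial_limit_def herglotz_def at_left_1_eq by (rule exI)
qed

lemma norm_ge_1_add_if_Re_nonneg:
  assumes "Re w \<ge> 0" shows "1 + Re w \<le> norm (1 + w)" "1 + w \<noteq> 0" "norm (inverse (1 + w)) \<le> 1"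
proof -
  show 1: "1 + Re w \<le> norm (1 + w)" using complex_Re_le_cmod[of "1 + w"] by simp
  then have "norm (1 + w) \<ge> 1" using assms by linarith
  then show "1 + w \<noteq> 0" "norm (inverse (1 + w)) \<le> 1" by (auto simp: norm_inverse inverse_le_1_iff)
qed

lemma norm_radial: "norm \<zeta> = 1 \<Longrightarrow> 0 \<le> r \<Longrightarrow> norm (of_real r * \<zeta>) = r" for \<zeta> :: complex
  by (simp add: norm_mult)

lemma eventually_at_left_1: "(\<And>r::real. 0 < r \<Longrightarrow> r < 1 \<Longrightarrow> P r) \<Longrightarrow> \<forall>\<^sub>F r in at_left 1. P r"
  by (rule eventually_mono[OF eventually_at_left_real[of 0 1]]) auto

section \<open>Radial convergence of a Moebius image of the Herglotz integral\<close>

text \<open>The Moebius image is bounded, so Fatou's theorem applies to it. The limit may be 0: a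
  Herglotz integral that tends to infinity counts as convergent.\<close>

definition inv_herglotz_converges :: "complex set \<Rightarrow> complex \<Rightarrow> bool" where
  "inv_herglotz_converges U \<zeta> \<longleftrightarrow> (\<exists>L. has_radial_limit (\<lambda>z. inverse (1 + herglotz U z)) L \<zeta>)"

lemma inv_herglotz_converges_AE:
  assumes "U \<in> sets borel"
  shows "\<exists>N \<in> null_sets circle_measure. {\<zeta> \<in> unit_circle. \<not> inv_herglotz_converges U \<zeta>} \<subseteq> N"
  unfolding inv_herglotz_converges_def
proof (rule Fatou_radial_limit)
  show "(\<lambda>z. inverse (1 + herglotz U z)) holomorphic_on ball 0 1"
    using norm_ge_1_add_if_Re_nonneg(2)[OF Re_herglotz_nonneg[OF assms]]
    by (intro holomorphic_intros holomorphic_herglotz assms) auto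
  show "norm (inverse (1 + herglotz U z)) \<le> 1" if "norm z < 1" for z
    by (rule norm_ge_1_add_if_Re_nonneg(3)[OF Re_herglotz_nonneg[OF assms that]])
qed

text \<open>With q = 1 / (1 + H U) and h = H A the new function is q / (1 + q h), and the point is
  that the denominator has a nonzero limit. Since the Herglotz integral of the union has nonnegative
  real part, |q| is at most |1 + q h|, and this persists in the limit: a zero of the limiting
  denominator would force q to tend to 0, but then the denominator tends to 1.\<close>

lemma inv_herglotz_converges_Un:
  assumes U: "U \<in> sets borel" "A \<in> sets borel" "U \<inter> A = {}" and \<zeta>: "norm \<zeta> = 1"
    and conv: "inv_herglotz_converges U \<zeta>" and A: "has_radial_limit (herglotz A) l \<zeta>"
  shows "inv_herglotz_converges (U \<union> A) \<zeta>"
proof -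
  define q where "q r = inverse (1 + herglotz U (of_real r * \<zeta>))" for r :: real
  define h where "h r = herglotz A (of_real r * \<zeta>)" for r :: real
  obtain q0 where q0: "(q \<longlongrightarrow> q0) (at_left 1)"
    using conv by (auto simp: inv_herglotz_converges_def has_radial_limit_def q_def[abs_def])
  have h: "(h \<longlongrightarrow> l) (at_left 1)"
    using A by (simp add: has_radial_limit_def h_def[abs_def])
  have r: "norm (of_real r * \<zeta>) < 1" if "0 < r" "r < 1" for r
    using that \<zeta> by (simp add: norm_radial)
  have U0: "1 + herglotz U (of_real r * \<zeta>) \<noteq> 0" if "0 < r" "r < 1" for r
    by (rule norm_ge_1_add_if_Re_nonneg(2)[OF Re_herglotz_nonneg[OF U(1) r[OF that]]])
  have UA: "herglotz (U \<union> A) (of_real r * \<zeta>) = herglotz U (of_real r * \<zeta>) + h r" if "0 < r" "r < 1" for r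
    unfolding h_def by (rule herglotz_Un_disjoint[OF U r[OF that]])
  have eq: "1 + q r * h r = (1 + herglotz (U \<union> A) (of_real r * \<zeta>)) * q r" if "0 < r" "r < 1" for r
    unfolding UA[OF that] q_def using U0[OF that] by (simp add: field_simps)
  have lim: "((\<lambda>r. 1 + q r * h r) \<longlongrightarrow> 1 + q0 * l) (at_left 1)"
    by (intro tendsto_intros q0 h)
  have "norm q0 \<le> norm (1 + q0 * l)"
  proof (rule tendsto_le[OF _ tendsto_norm[OF lim] tendsto_norm[OF q0]])
    show "\<forall>\<^sub>F r in at_left 1. norm (q r) \<le> norm (1 + q r * h r)"
    proof (rule eventually_at_left_1)
      fix r :: real assume r': "0 < r" "r < 1"
      have "Re (herglotz (U \<union> A) (of_real r * \<zeta>)) \<ge> 0"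
        using U r[OF r'] by (intro Re_herglotz_nonneg) auto
      from norm_ge_1_add_if_Re_nonneg(1)[OF this] this
      have "1 \<le> norm (1 + herglotz (U \<union> A) (of_real r * \<zeta>))" by linarith
      then show "norm (q r) \<le> norm (1 + q r * h r)"
        unfolding eq[OF r'] norm_mult by (simp add: mult_left_le_one_le mult_le_cancel_right1)
    qed
  qed simp
  then have ne: "1 + q0 * l \<noteq> 0" by (cases "q0 = 0") auto
  have "((\<lambda>r. q r / (1 + q r * h r)) \<longlongrightarrow> q0 / (1 + q0 * l)) (at_left 1)"
    by (intro tendsto_divide q0 lim ne)
  moreover have "\<forall>\<^sub>F r in at_left 1. q r / (1 + q r * h r) = inverse (1 + herglotz (U \<union> A) (of_real r * \<zeta>))"
  proof (rule eventually_at_left_1)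
    fix r :: real assume r': "0 < r" "r < 1"
    have "q r \<noteq> 0" using U0[OF r'] by (simp add: q_def)
    then show "q r / (1 + q r * h r) = inverse (1 + herglotz (U \<union> A) (of_real r * \<zeta>))"
      unfolding eq[OF r'] by (simp add: divide_simps)
  qed
  ultimately have "((\<lambda>r. inverse (1 + herglotz (U \<union> A) (of_real r * \<zeta>))) \<longlongrightarrow> q0 / (1 + q0 * l)) (at_left 1)"
    by (rule Lim_transform_eventually)
  then show ?thesis unfolding inv_herglotz_converges_def has_radial_limit_def by blast
qed

lemma inv_herglotz_converges_potential:
  assumes U: "U \<in> sets borel" "V \<in> sets borel" "U \<subseteq> V" and \<zeta>: "norm \<zeta> = 1"
    and conv: "inv_herglotz_converges U \<zeta>" and "\<zeta> \<notin> V - U" "reciprocal_potential (V - U) \<zeta> < \<infinity>"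
  shows "inv_herglotz_converges V \<zeta>"
proof -
  obtain l where "has_radial_limit (herglotz (V - U)) l \<zeta>"
    using herglotz_radial_limit[of "V - U" \<zeta>] assms by auto
  from inv_herglotz_converges_Un[OF U(1) _ _ \<zeta> conv this] U
  show ?thesis by (auto simp: Un_absorb1)
qed

lemma inv_herglotz_converges_empty: "inv_herglotz_converges {} \<zeta>"
  by (auto simp: inv_herglotz_converges_def has_radial_limit_def herglotz_def)

text \<open>The complement of \<open>U\<close> stays away from \<zeta> and so has finite potential;
  hence H U = 1 - H (- U) has a radial limit, and adding \<open>U\<close> to the empty set transfers
  this to the Moebius image.\<close>

lemma inv_herglotz_converges_open:
  assumes U: "open U" "\<zeta> \<in> U" and \<zeta>: "norm \<zeta> = 1"
  shows "inv_herglotz_converges U \<zeta>"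
proof -
  obtain \<delta> where \<delta>: "\<delta> > 0" "ball \<zeta> \<delta> \<subseteq> U" using U openE by blast
  have b: "- U \<in> sets borel" using U by auto
  have "reciprocal_potential (- U) \<zeta> \<le> ennreal (1 / \<delta>) * emeasure circle_measure (- U)"
  proof (rule reciprocal_potential_le[OF b \<delta>(1)])
    show "\<delta> \<le> dist x \<zeta>" if "x \<in> - U" for x
      using that \<delta> by (force simp: dist_commute not_less)
  qed
  also have "\<dots> < \<infinity>" by (simp add: ennreal_mult_less_top circle_measure.emeasure_eq_measure)
  finally obtain l where l: "has_radial_limit (herglotz (- U)) l \<zeta>"
    using herglotz_radial_limit[OF b _ \<zeta>] U by auto
  have eq: "herglotz U (of_real r * \<zeta>) = 1 - herglotz (- U) (of_real r * \<zeta>)" if "0 < r" "r < 1" for r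
  proof -
    have "herglotz (U \<union> - U) (of_real r * \<zeta>) = herglotz U (of_real r * \<zeta>) + herglotz (- U) (of_real r * \<zeta>)"
      by (rule herglotz_Un_disjoint) (use U b \<zeta> that in \<open>auto simp: norm_radial\<close>)
    then show ?thesis using herglotz_UNIV[of "of_real r * \<zeta>"] \<zeta> that by (simp add: norm_radial eq_diff_eq)
  qed
  have "((\<lambda>r. 1 - herglotz (- U) (of_real r * \<zeta>)) \<longlongrightarrow> 1 - l) (at_left 1)"
    using l unfolding has_radial_limit_def by (intro tendsto_intros)
  then have "((\<lambda>r. herglotz U (of_real r * \<zeta>)) \<longlongrightarrow> 1 - l) (at_left 1)"
    by (rule Lim_transform_eventually) (rule eventually_at_left_1, simp add: eq)
  then have "has_radial_limit (herglotz U) (1 - l) \<zeta>" by (simp add: has_radial_limit_def)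
  from inv_herglotz_converges_Un[OF _ _ _ \<zeta> inv_herglotz_converges_empty this] U
  show ?thesis by simp
qed

section \<open>Open covers of null sets\<close>

lemma null_set_open_cover:
  assumes "N \<in> null_sets circle_measure" "e > 0"
  obtains U where "open U" "N \<subseteq> U" "emeasure circle_measure U < ennreal e"
proof -
  have "(INF U \<in> {U. N \<subseteq> U \<and> open U}. emeasure circle_measure U) = emeasure circle_measure N"
    by (rule outer_regular[symmetric]) (use assms circle_measure.emeasure_finite in \<open>auto dest: null_setsD2\<close>)
  also have "\<dots> < ennreal e" using assms by auto
  finally show ?thesis using that by (auto simp: INF_less_iff)
qed

text \<open>Whitney-type covering: near the boundary of \<open>G\<close> the cover is chosen so thin that its
  potential stays small outside \<open>G\<close>.\<close>

lemma thin_open_cover: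
  assumes G: "open G" and N: "N \<in> null_sets circle_measure" and C: "C \<subseteq> N" "C \<subseteq> G" and "e > 0"
  obtains V where "open V" "C \<subseteq> V" "V \<subseteq> G" "emeasure circle_measure V \<le> ennreal e"
    "\<And>\<zeta>. \<zeta> \<notin> G \<Longrightarrow> reciprocal_potential V \<zeta> \<le> ennreal e"
proof -
  \<comment> \<open>The doubled ball inside \<open>G\<close> keeps every point of \<open>H n\<close>
    at distance at least \<open>(1/2)^n\<close> from the complement of \<open>G\<close>.\<close>
  define H where "H n = (\<Union>x\<in>{x. ball x (2 * (1/2)^n) \<subseteq> G}. ball x ((1/2)^n))" for n :: nat
  have H: "open (H n)" "H n \<subseteq> G" for n
  proof -
    show "open (H n)" by (auto simp: H_def)
    show "H n \<subseteq> G"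
    proof
      fix y assume "y \<in> H n"
      then obtain x where x: "ball x (2 * (1/2)^n) \<subseteq> G" "dist x y < (1/2)^n" by (auto simp: H_def)
      moreover have "(1/2)^n > (0::real)" by simp
      ultimately have "y \<in> ball x (2 * (1/2)^n)" unfolding mem_ball by linarith
      with x show "y \<in> G" by blast
    qed
  qed
  have H_dist: "(1/2)^n \<le> dist y \<zeta>" if y: "y \<in> H n" and \<zeta>: "\<zeta> \<notin> G" for n y \<zeta>
  proof -
    obtain x where x: "ball x (2 * (1/2)^n) \<subseteq> G" "dist x y < (1/2)^n" using y by (auto simp: H_def)
    then have "2 * (1/2)^n \<le> dist x \<zeta>" using \<zeta> by (meson mem_ball not_le subsetD)
    then show ?thesis using x(2) dist_triangle[of x \<zeta> y] by linarith
  qed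
  have H_cover: "G \<subseteq> (\<Union>n. H n)"
  proof
    fix x assume "x \<in> G"
    then obtain d where d: "d > 0" "ball x d \<subseteq> G" using G openE by blast
    obtain n where "(1/2)^n < d / 2" using d real_arch_pow_inv[of "d/2" "1/2"] by auto
    then have "ball x (2 * (1/2)^n) \<subseteq> ball x d" by (intro subset_ball) auto
    then have "x \<in> H n" using d by (force simp: H_def)
    then show "x \<in> (\<Union>n. H n)" by blast
  qed
  \<comment> \<open>The measure allowed in layer \<open>n\<close> carries two small factors:
    \<open>(1/2)^n\<close> pays for the potential kernel, which is at most \<open>2^n\<close> there,
    and \<open>(1/2)^Suc n\<close> makes the layers sum to \<open>e\<close>.\<close>
  have "\<forall>n. \<exists>U. open U \<and> N \<subseteq> U \<and> emeasure circle_measure U < ennreal (e * (1/2)^Suc n * (1/2)^n)"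
    using null_set_open_cover[OF N] \<open>e > 0\<close> by (metis mult_pos_pos zero_less_divide_1_iff zero_less_numeral zero_less_power)
  then obtain U where U: "\<And>n. open (U n)" "\<And>n. N \<subseteq> U n"
    "\<And>n. emeasure circle_measure (U n) < ennreal (e * (1/2)^Suc n * (1/2)^n)" by metis
  define A where "A n = U n \<inter> H n" for n
  have A: "open (A n)" for n using U H by (auto simp: A_def)
  have A_em: "emeasure circle_measure (A n) \<le> ennreal (e * (1/2)^Suc n * (1/2)^n)" for n
    using U(1,3)[of n] by (intro order_trans[OF emeasure_mono[of "A n" "U n"]]) (auto simp: A_def)
  have sums: "(\<Sum>n. ennreal (e * (1/2)^Suc n)) = ennreal e"
    using \<open>e > 0\<close> sums_mult[OF power_half_series, of e] by (intro suminf_ennreal_eq) auto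
  show ?thesis
  proof (rule that[of "\<Union>n. A n"])
    show "open (\<Union>n. A n)" using A by auto
    show "C \<subseteq> (\<Union>n. A n)"
    proof
      fix x assume "x \<in> C"
      moreover from this obtain n where "x \<in> H n" using C(2) H_cover by blast
      ultimately have "x \<in> A n" using C(1) U(2) by (auto simp: A_def)
      then show "x \<in> (\<Union>n. A n)" by blast
    qed
    show "(\<Union>n. A n) \<subseteq> G" using H(2) by (auto simp: A_def)
    have "emeasure circle_measure (\<Union>n. A n) \<le> (\<Sum>n. emeasure circle_measure (A n))"
      using A by (intro emeasure_subadditive_countably) auto
    also have "\<dots> \<le> (\<Sum>n. ennreal (e * (1/2)^Suc n))"
    proof (intro suminf_le)
      fix n
      have "e * (1/2)^Suc n * (1/2)^n \<le> e * (1/2)^Suc n"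
        using \<open>e > 0\<close> by (intro mult_left_le) (auto simp: power_le_one)
      then show "emeasure circle_measure (A n) \<le> ennreal (e * (1/2)^Suc n)"
        by (intro order_trans[OF A_em] ennreal_leI)
    qed auto
    finally show "emeasure circle_measure (\<Union>n. A n) \<le> ennreal e" unfolding sums .
    fix \<zeta> assume \<zeta>: "\<zeta> \<notin> G"
    have "reciprocal_potential (\<Union>n. A n) \<zeta> \<le> (\<Sum>n. reciprocal_potential (A n) \<zeta>)"
      using A by (intro reciprocal_potential_UN_le) auto
    also have "\<dots> \<le> (\<Sum>n. ennreal (e * (1/2)^Suc n))"
    proof (intro suminf_le)
      fix n
      have "reciprocal_potential (A n) \<zeta> \<le> ennreal (1 / (1/2)^n) * emeasure circle_measure (A n)"
        using A H_dist[OF _ \<zeta>] by (intro reciprocal_potential_le) (auto simp: A_def)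
      also have "\<dots> \<le> ennreal (1 / (1/2)^n) * ennreal (e * (1/2)^Suc n * (1/2)^n)"
        by (intro mult_left_mono A_em) auto
      also have "\<dots> = ennreal (e * (1/2)^Suc n)"
        using \<open>e > 0\<close> by (subst ennreal_mult[symmetric]) auto
      finally show "reciprocal_potential (A n) \<zeta> \<le> ennreal (e * (1/2)^Suc n)" .
    qed auto
    finally show "reciprocal_potential (\<Union>n. A n) \<zeta> \<le> ennreal e" unfolding sums .
  qed
qed

section \<open>Dyadic families of open covers\<close>

text \<open>A single open cover of a null set produces a function with bad radii. Passing from \<open>c i\<close> to
  \<open>c (Suc i)\<close> in the following chains, the bad radii of the later set all end inside the earlier one.\<close>

definition open_chain :: "complex set \<Rightarrow> (nat \<Rightarrow> complex set) \<Rightarrow> bool" where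
  "open_chain E c \<longleftrightarrow> (\<forall>i. open (c i) \<and> E \<subseteq> c i \<and> c (Suc i) \<subseteq> c i \<and>
     (\<forall>\<zeta>\<in>unit_circle - c i. inv_herglotz_converges (c (Suc i)) \<zeta>))"

text \<open>Indices double: even ones keep the old sets, and the odd one between \<open>c i\<close>
  and \<open>c (Suc i)\<close> receives an enlargement of \<open>c (Suc i)\<close>. With
  \<open>e\<close> summable over the levels, the potential bound makes a whole sequence of
  enlargements harmless to radial convergence outside \<open>c i\<close>.\<close>

definition chain_refinement :: "real \<Rightarrow> (nat \<Rightarrow> complex set) \<Rightarrow> (nat \<Rightarrow> complex set) \<Rightarrow> bool" where
  "chain_refinement e c c' \<longleftrightarrow> (\<forall>i. c' (2 * i) = c i \<and> c (Suc i) \<subseteq> c' (Suc (2 * i)) \<and>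
     (\<forall>\<zeta>\<in>unit_circle - c i. reciprocal_potential (c' (Suc (2 * i)) - c (Suc i)) \<zeta> \<le> ennreal e))"

text \<open>\<open>V\<close> is \<open>U\<close> together with a thin cover, inside
  \<open>G\<close>, of the null set where \<open>U\<close> is bad; that set lies in \<open>G\<close>
  by \<open>conv\<close>. Thus the bad points of \<open>U\<close> are absorbed by \<open>V\<close>,
  and outside \<open>G\<close> the added potential is finite, which preserves convergence.\<close>

lemma ex_inserted_open:
  assumes "open G" "open U" "U \<subseteq> G" "e > 0"
    and conv: "\<forall>\<zeta>\<in>unit_circle - G. inv_herglotz_converges U \<zeta>"
  shows "\<exists>V. open V \<and> U \<subseteq> V \<and> V \<subseteq> G \<and> (\<forall>\<zeta>\<in>unit_circle - V. inv_herglotz_converges U \<zeta>) \<and>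
    (\<forall>\<zeta>\<in>unit_circle - G. inv_herglotz_converges V \<zeta>) \<and>
    (\<forall>\<zeta>\<in>unit_circle - G. reciprocal_potential (V - U) \<zeta> \<le> ennreal e)"
proof -
  define C where "C = {\<zeta> \<in> unit_circle. \<not> inv_herglotz_converges U \<zeta>}"
  obtain N where N: "N \<in> null_sets circle_measure" "C \<subseteq> N"
    using inv_herglotz_converges_AE[of U] assms unfolding C_def by auto
  have "C \<subseteq> G" using conv by (auto simp: C_def)
  from thin_open_cover[OF \<open>open G\<close> N this \<open>e > 0\<close>] obtain V' where V': "open V'" "C \<subseteq> V'" "V' \<subseteq> G"
    "\<And>\<zeta>. \<zeta> \<notin> G \<Longrightarrow> reciprocal_potential V' \<zeta> \<le> ennreal e" by metis
  define V where "V = U \<union> V'"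
  have V: "open V" "U \<subseteq> V" "V \<subseteq> G" using assms V' by (auto simp: V_def)
  have pot: "reciprocal_potential (V - U) \<zeta> \<le> ennreal e" if "\<zeta> \<in> unit_circle - G" for \<zeta>
  proof -
    have "reciprocal_potential (V - U) \<zeta> \<le> reciprocal_potential V' \<zeta>"
      by (rule reciprocal_potential_mono) (auto simp: V_def)
    also have "\<dots> \<le> ennreal e" using V'(4) that by auto
    finally show ?thesis .
  qed
  have "inv_herglotz_converges V \<zeta>" if \<zeta>: "\<zeta> \<in> unit_circle - G" for \<zeta>
  proof (rule inv_herglotz_converges_potential[of U V])
    show "reciprocal_potential (V - U) \<zeta> < \<infinity>"
      using order_le_less_trans[OF pot[OF \<zeta>]] by simp
  qed (use assms V \<zeta> conv in auto)
  moreover have "\<forall>\<zeta>\<in>unit_circle - V. inv_herglotz_converges U \<zeta>"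
    using V'(2) by (auto simp: C_def V_def)
  ultimately show ?thesis using V pot by blast
qed

lemma ex_chain_refinement:
  assumes c: "open_chain E c" and "e > 0"
  shows "\<exists>c'. open_chain E c' \<and> chain_refinement e c c'"
proof -
  have "\<forall>i. \<exists>V. open V \<and> c (Suc i) \<subseteq> V \<and> V \<subseteq> c i \<and> (\<forall>\<zeta>\<in>unit_circle - V. inv_herglotz_converges (c (Suc i)) \<zeta>) \<and>
    (\<forall>\<zeta>\<in>unit_circle - c i. inv_herglotz_converges V \<zeta>) \<and>
    (\<forall>\<zeta>\<in>unit_circle - c i. reciprocal_potential (V - c (Suc i)) \<zeta> \<le> ennreal e)"
    using c \<open>e > 0\<close> by (intro allI ex_inserted_open) (auto simp: open_chain_def)
  from choice[OF this] obtain V where V: "\<And>i. open (V i)" "\<And>i. c (Suc i) \<subseteq> V i" "\<And>i. V i \<subseteq> c i"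
    "\<And>i. \<forall>\<zeta>\<in>unit_circle - V i. inv_herglotz_converges (c (Suc i)) \<zeta>"
    "\<And>i. \<forall>\<zeta>\<in>unit_circle - c i. inv_herglotz_converges (V i) \<zeta>"
    "\<And>i. \<forall>\<zeta>\<in>unit_circle - c i. reciprocal_potential (V i - c (Suc i)) \<zeta> \<le> ennreal e" by blast
  define c' where "c' k = (if even k then c (k div 2) else V (k div 2))" for k
  have ev: "c' (2 * i) = c i" and od: "c' (Suc (2 * i)) = V i" for i by (auto simp: c'_def)
  have "open (c' k) \<and> E \<subseteq> c' k \<and> c' (Suc k) \<subseteq> c' k \<and>
     (\<forall>\<zeta>\<in>unit_circle - c' k. inv_herglotz_converges (c' (Suc k)) \<zeta>)" for k
  proof (cases "even k")
    case True
    then obtain i where k: "k = 2 * i" by (elim evenE)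
    show ?thesis unfolding k ev od using c V by (auto simp: open_chain_def)
  next
    case False
    then obtain i where k: "k = Suc (2 * i)" by (metis oddE Suc_eq_plus1)
    have k': "Suc k = 2 * Suc i" using k by simp
    have "E \<subseteq> c (Suc i)" using c by (auto simp: open_chain_def)
    then show ?thesis unfolding k' unfolding k ev od using V(1,2,4)[of i] by auto
  qed
  then have "open_chain E c'" by (simp add: open_chain_def)
  moreover have "chain_refinement e c c'"
    unfolding chain_refinement_def ev od using V by auto
  ultimately show ?thesis by blast
qed

text \<open>Near \<zeta> the Poisson kernel at \<open>z\<close> is small on the complement of
  \<open>U\<close>, and the real parts for \<open>U\<close> and its complement add up to 1. The
  approach is unrestricted, and so is the limit of \<open>W\<close> derived from it.\<close>

lemma Re_herglotz_open_ge_half: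
  assumes U: "open U" "\<zeta> \<in> U" and \<zeta>: "norm \<zeta> = 1"
  shows "\<forall>\<^sub>F z in at \<zeta> within ball 0 1. Re (herglotz U z) \<ge> 1/2"
proof -
  obtain \<delta> where \<delta>: "\<delta> > 0" "ball \<zeta> \<delta> \<subseteq> U" using U openE by blast
  have b: "- U \<in> sets borel" using U by auto
  \<comment> \<open>The two distances are chosen so that 1 - |z|^2 is at most
    \<open>\<delta>\<^sup>2 / 8\<close>, while |x - z| is at least \<open>\<delta>/2\<close> for x
    off \<open>U\<close>; the quotient of the first by the square of the second is then at most
    1/2.\<close>
  have "1/2 \<le> Re (herglotz U z)" if z: "norm z < 1" and d: "dist z \<zeta> < \<delta>/2" "dist z \<zeta> < \<delta>\<^sup>2 / 16" for z
  proof -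
    have "1 - norm z \<le> dist z \<zeta>" using norm_triangle_ineq2[of \<zeta> z] \<zeta> by (simp add: dist_norm norm_minus_commute)
    moreover have "1 - (norm z)\<^sup>2 \<le> 2 * (1 - norm z)"
    proof -
      have "0 \<le> (1 - norm z)\<^sup>2" by simp
      then show ?thesis by (simp add: power2_eq_square algebra_simps)
    qed
    ultimately have "1 - (norm z)\<^sup>2 \<le> 2 * dist z \<zeta>" by (smt (verit))
    also have "\<dots> \<le> \<delta>\<^sup>2 / 8" using d(2) by simp
    finally have num: "1 - (norm z)\<^sup>2 \<le> \<delta>\<^sup>2 / 8" .
    have k_le: "Re (indicator (- U) x *\<^sub>R ((x + z) / (x - z))) \<le> 1/2" if x: "norm x = 1" for x
    proof (cases "x \<in> U")
      case False
      then have "\<delta> \<le> dist x \<zeta>" using \<delta> by (force simp: dist_commute not_less)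
      then have "\<delta>/2 \<le> norm (x - z)" using d(1) dist_triangle[of x \<zeta> z] by (simp add: dist_norm)
      then have "(\<delta>/2)\<^sup>2 \<le> (norm (x - z))\<^sup>2" using \<delta> by (intro power_mono) auto
      then have "(1 - (norm z)\<^sup>2) / (norm (x - z))\<^sup>2 \<le> (\<delta>\<^sup>2 / 8) / (\<delta>/2)\<^sup>2"
        using num \<delta> by (intro frac_le) auto
      also have "\<dots> = 1/2" using \<delta> by (simp add: power_divide)
      finally have "Re ((x + z) / (x - z)) \<le> 1/2" unfolding Re_herglotz_kernel[OF x] .
      then show ?thesis using False by simp
    qed simp
    have "(\<integral>x. Re (indicator (- U) x *\<^sub>R ((x + z) / (x - z))) \<partial>circle_measure) \<le> (\<integral>x. 1/2 \<partial>circle_measure)"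
    proof (rule integral_mono_AE)
      show "AE x in circle_measure. Re (indicator (- U) x *\<^sub>R ((x + z) / (x - z))) \<le> 1/2"
        using AE_circle_measure by eventually_elim (rule k_le)
    qed (auto intro!: integrable_Re herglotz_integrable b z simp del: scaleR_complex.sel)
    also have "\<dots> = pi" by (simp add: measure_def emeasure_circle_measure_UNIV)
    finally have "Re (\<integral>x. indicator (- U) x *\<^sub>R ((x + z) / (x - z)) \<partial>circle_measure) \<le> pi"
      by (simp only: integral_Re[OF herglotz_integrable[OF b z]])
    then have "Re (herglotz (- U) z) \<le> 1/2"
      by (simp add: herglotz_def field_simps)
    moreover have "herglotz (U \<union> - U) z = herglotz U z + herglotz (- U) z"
      by (rule herglotz_Un_disjoint) (use U b z in auto)
    then have "Re (herglotz U z) = 1 - Re (herglotz (- U) z)"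
      using herglotz_UNIV[OF z] by (simp add: complex_eq_iff)
    ultimately show ?thesis by simp
  qed
  then show ?thesis
    unfolding eventually_at using \<delta> by (intro exI[of _ "min (\<delta>/2) (\<delta>\<^sup>2/16)"]) auto
qed

section \<open>Dyadic cells of the parameter\<close>

definition dyadic_index :: "nat \<Rightarrow> real \<Rightarrow> nat" where
  "dyadic_index j s = nat \<lfloor>s * 2 ^ j\<rfloor>"

lemma dyadic_index_le: "s \<ge> 0 \<Longrightarrow> real (dyadic_index j s) \<le> s * 2 ^ j"
  and dyadic_index_gt: "s \<ge> 0 \<Longrightarrow> s * 2 ^ j < real (dyadic_index j s) + 1"
  unfolding dyadic_index_def by (simp_all add: of_nat_nat)

lemma dyadic_index_mono: "s \<le> t \<Longrightarrow> dyadic_index j s \<le> dyadic_index j t"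
  unfolding dyadic_index_def by (intro nat_mono floor_mono mult_right_mono) auto

lemma dyadic_index_Suc:
  assumes "s \<ge> 0"
  shows "dyadic_index (Suc j) s = 2 * dyadic_index j s \<or> dyadic_index (Suc j) s = Suc (2 * dyadic_index j s)"
proof -
  have "real (dyadic_index (Suc j) s) < 2 * real (dyadic_index j s) + 2"
    using dyadic_index_le[OF assms, of "Suc j"] dyadic_index_gt[OF assms, of j] by simp
  moreover have "2 * real (dyadic_index j s) < real (dyadic_index (Suc j) s) + 1"
    using dyadic_index_gt[OF assms, of "Suc j"] dyadic_index_le[OF assms, of j] by simp
  ultimately show ?thesis by linarith
qed

lemma dyadic_index_separates:
  assumes "0 \<le> s" "s < t"
  shows "\<exists>j. \<forall>l\<ge>j. Suc (dyadic_index l s) \<le> dyadic_index l t"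
proof -
  obtain j where j: "1 / (t - s) < 2 ^ j" using real_arch_pow[of 2 "1 / (t - s)"] by auto
  have "Suc (dyadic_index l s) \<le> dyadic_index l t" if "l \<ge> j" for l
  proof -
    have "(2::real) ^ j \<le> 2 ^ l" using that by (intro power_increasing) auto
    with j have "1 / (t - s) < 2 ^ l" by linarith
    then have "1 < (t - s) * 2 ^ l" using assms by (simp add: field_simps)
    then have "real (dyadic_index l s) + 1 < real (dyadic_index l t) + 1"
      using dyadic_index_le[of s l] dyadic_index_gt[of t l] assms by (simp add: algebra_simps)
    then show ?thesis by linarith
  qed
  then show ?thesis by blast
qed

section \<open>The limit family of open sets\<close>

text \<open>\<open>S j i\<close> plays the role of the set at the parameter
  \<open>i / 2 ^ j\<close>; a refinement leaves the sets at the old dyadic parameters unchanged. The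
  two base conditions provide majorants for the integral over \<open>s\<close>: the measure bound
  inside the disc, the potential bound along radii that end outside some
  \<open>S 0 n\<close>.\<close>

locale dyadic_family =
  fixes E :: "complex set" and S :: "nat \<Rightarrow> nat \<Rightarrow> complex set"
  assumes chain: "\<And>j. open_chain E (S j)"
    and refine: "\<And>j. chain_refinement ((1/2)^j) (S j) (S (Suc j))"
    and measure_base: "\<And>n. emeasure circle_measure (S 0 (Suc n)) \<le> ennreal ((1/2)^n)"
    and potential_base: "\<And>n \<zeta>. \<zeta> \<in> unit_circle - S 0 n \<Longrightarrow> reciprocal_potential (S 0 (Suc n)) \<zeta> \<le> ennreal ((1/2)^n)"
begin

lemma open_S: "open (S j i)" and E_sub_S: "E \<subseteq> S j i" and S_Suc: "S j (Suc i) \<subseteq> S j i"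
  and conv_S: "\<zeta> \<in> unit_circle - S j i \<Longrightarrow> inv_herglotz_converges (S j (Suc i)) \<zeta>"
  using chain[of j] by (auto simp: open_chain_def)

lemma S_antimono: "i \<le> k \<Longrightarrow> S j k \<subseteq> S j i"
  by (rule lift_Suc_antimono_le[of "S j", OF S_Suc])

lemma S_even: "S (Suc j) (2 * i) = S j i" and S_odd: "S j (Suc i) \<subseteq> S (Suc j) (Suc (2 * i))"
  and potential_S_odd: "\<zeta> \<in> unit_circle - S j i \<Longrightarrow>
    reciprocal_potential (S (Suc j) (Suc (2 * i)) - S j (Suc i)) \<zeta> \<le> ennreal ((1/2)^j)"
  using refine[of j] by (auto simp: chain_refinement_def)

lemma S_Suc_Suc: "S (Suc j) (Suc (Suc (2 * i))) = S j (Suc i)"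
  using S_even[of j "Suc i"] by simp

text \<open>The set at the right end point of the level-\<open>j\<close> dyadic interval containing
  \<open>s\<close>, hence the \<open>Suc\<close>. The end points decrease as the level rises, so for
  \<open>s \<ge> 0\<close> these sets increase.\<close>

abbreviation D :: "nat \<Rightarrow> real \<Rightarrow> complex set" where
  "D j s \<equiv> S j (Suc (dyadic_index j s))"

text \<open>Splitting a dyadic interval either moves the right end point to the midpoint, where an
  enlargement of the old set was inserted, or leaves it in place.\<close>

lemma D_Suc:
  assumes "s \<ge> 0" shows "D j s \<subseteq> D (Suc j) s"
  using dyadic_index_Suc[OF assms, of j]
proof
  assume i: "dyadic_index (Suc j) s = 2 * dyadic_index j s"
  show ?thesis unfolding i by (rule S_odd)
next
  assume i: "dyadic_index (Suc j) s = Suc (2 * dyadic_index j s)"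
  show ?thesis unfolding i S_Suc_Suc ..
qed

lemma incseq_D: "s \<ge> 0 \<Longrightarrow> incseq (\<lambda>j. D j s)"
  by (intro incseq_SucI D_Suc)

lemma S_index_Suc:
  assumes "s \<ge> 0" shows "S (Suc j) (dyadic_index (Suc j) s) \<subseteq> S j (dyadic_index j s)"
  using dyadic_index_Suc[OF assms, of j] S_even[of j "dyadic_index j s"] S_Suc[of "Suc j" "2 * dyadic_index j s"] by auto

definition V :: "real \<Rightarrow> complex set" where
  "V s = (\<Union>j. D j s)"

lemma open_V: "open (V s)"
  by (auto simp: V_def open_S)

lemma borel_V [measurable]: "V s \<in> sets borel"
  using open_V by auto

lemma E_sub_V: "E \<subseteq> V s"
  using E_sub_S by (auto simp: V_def)

lemma V_sub_S:
  assumes "s \<ge> 0" shows "V s \<subseteq> S j (dyadic_index j s)"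
proof -
  have "D l s \<subseteq> S j (dyadic_index j s)" for l
  proof (cases "l \<le> j")
    case True
    then have "D l s \<subseteq> D j s" using incseq_D[OF assms] by (auto simp: incseq_def)
    also have "\<dots> \<subseteq> S j (dyadic_index j s)" by (rule S_Suc)
    finally show ?thesis .
  next
    case False
    have "D l s \<subseteq> S l (dyadic_index l s)" by (rule S_Suc)
    also have "\<dots> \<subseteq> S j (dyadic_index j s)"
      by (rule lift_Suc_antimono_le[of "\<lambda>l. S l (dyadic_index l s)", OF S_index_Suc[OF assms]]) (use False in simp)
    finally show ?thesis .
  qed
  then show ?thesis by (auto simp: V_def)
qed

lemma V_antimono:
  assumes "0 \<le> s" "s \<le> t" shows "V t \<subseteq> V s"
proof -
  have "D j t \<subseteq> D j s" for j
    by (rule S_antimono) (simp add: dyadic_index_mono assms)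
  then show ?thesis by (auto simp: V_def)
qed

text \<open>At a fine level \<open>j\<close> the dyadic intervals of \<open>s\<close> and
  \<open>t\<close> are separated, so \<zeta> lies outside the set that precedes \<open>D j t\<close>
  in its chain, and \<open>D j t\<close> is good at \<zeta>. The rest of \<open>V t\<close> is
  covered by increments whose potentials at \<zeta> are bounded by a geometric series.\<close>

lemma conv_V:
  assumes \<zeta>: "\<zeta> \<in> unit_circle - V s" and st: "0 \<le> s" "s < t"
  shows "inv_herglotz_converges (V t) \<zeta>"
proof -
  obtain j where j: "\<And>l. l \<ge> j \<Longrightarrow> Suc (dyadic_index l s) \<le> dyadic_index l t"
    using dyadic_index_separates[OF st] by blast
  \<comment> \<open>\<open>S l (dyadic_index l t)\<close> is contained in \<open>D l s\<close>,
    hence in \<open>V s\<close>.\<close>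
  have out: "\<zeta> \<notin> S l (dyadic_index l t)" if "l \<ge> j" for l
    using \<zeta> S_antimono[OF j[OF that], of l] by (auto simp: V_def)
  define A where "A n = D (Suc (j + n)) t - D (j + n) t" for n
  have A: "A n \<in> sets borel" for n unfolding A_def using open_S by auto
  have sub: "V t - D j t \<subseteq> (\<Union>n. A n)"
  proof
    fix x assume x: "x \<in> V t - D j t"
    then obtain l where "x \<in> D l t" by (auto simp: V_def)
    have "\<exists>n. x \<in> D (j + n) t"
    proof (intro exI)
      have "D l t \<subseteq> D (j + l) t" using incseq_D[of t] st by (auto simp: incseq_def)
      then show "x \<in> D (j + l) t" using \<open>x \<in> D l t\<close> by blast
    qed
    then obtain n where n: "x \<in> D (j + n) t" "\<And>m. m < n \<Longrightarrow> x \<notin> D (j + m) t"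
      using exists_least_iff[of "\<lambda>n. x \<in> D (j + n) t"] by blast
    then obtain m where "n = Suc m" using x by (cases n) auto
    then have "x \<in> A m" using n by (auto simp: A_def)
    then show "x \<in> (\<Union>n. A n)" by blast
  qed
  have A_le: "reciprocal_potential (A n) \<zeta> \<le> ennreal ((1/2)^n)" for n
  proof -
    define l where "l = j + n"
    have "l \<ge> j" by (simp add: l_def)
    have An: "A n = D (Suc l) t - D l t" by (simp add: A_def l_def)
    have "reciprocal_potential (A n) \<zeta> \<le> ennreal ((1/2)^l)"
      using dyadic_index_Suc[OF order_trans[OF st(1) less_imp_le[OF st(2)]], of l]
    proof
      assume i: "dyadic_index (Suc l) t = 2 * dyadic_index l t"
      show ?thesis unfolding An i
        by (rule potential_S_odd) (use out[OF \<open>l \<ge> j\<close>] \<zeta> in auto)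
    next
      assume i: "dyadic_index (Suc l) t = Suc (2 * dyadic_index l t)"
      \<comment> \<open>The right end point does not move, so nothing is added at this
        level.\<close>
      show ?thesis unfolding An i S_Suc_Suc by (simp add: reciprocal_potential_def)
    qed
    also have "\<dots> \<le> ennreal ((1/2)^n)" by (intro ennreal_leI power_decreasing) (auto simp: l_def)
    finally show ?thesis .
  qed
  have "reciprocal_potential (V t - D j t) \<zeta> \<le> (\<Sum>n. reciprocal_potential (A n) \<zeta>)"
    by (rule order_trans[OF reciprocal_potential_mono[OF sub] reciprocal_potential_UN_le[OF A]])
  also have "\<dots> \<le> (\<Sum>n. ennreal ((1/2)^n))" by (intro suminf_le A_le) auto
  also have "\<dots> = ennreal 2"
    using geometric_sums[of "1/2::real"] by (intro suminf_ennreal_eq) auto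
  finally have pot: "reciprocal_potential (V t - D j t) \<zeta> < \<infinity>" by (rule order_le_less_trans) simp
  show ?thesis
  proof (rule inv_herglotz_converges_potential[OF _ borel_V _ _ _ _ pot])
    show "D j t \<in> sets borel" using open_S by auto
    show "D j t \<subseteq> V t" by (auto simp: V_def)
    show "inv_herglotz_converges (D j t) \<zeta>" by (rule conv_S) (use \<zeta> out in auto)
    show "\<zeta> \<notin> V t - D j t" using out[of j] V_sub_S[of t j] st by auto
  qed (use \<zeta> in auto)
qed

text \<open>Suppose that a < b are both bad at \<zeta>. Badness for b puts \<zeta> into
  \<open>V a\<close>, by \<open>conv_V\<close>; but an open set is good at its own points, a
  contradiction.\<close>

lemma conv_V_except_one:
  assumes \<zeta>: "\<zeta> \<in> unit_circle"
  shows "\<exists>s0. \<forall>s\<ge>0. s \<noteq> s0 \<longrightarrow> inv_herglotz_converges (V s) \<zeta>"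
proof (rule ccontr)
  assume "\<not> ?thesis"
  then have *: "\<And>s0. \<exists>s\<ge>0. s \<noteq> s0 \<and> \<not> inv_herglotz_converges (V s) \<zeta>" by auto
  obtain s where s: "s \<ge> 0" "\<not> inv_herglotz_converges (V s) \<zeta>" using * by blast
  obtain t where t: "t \<ge> 0" "t \<noteq> s" "\<not> inv_herglotz_converges (V t) \<zeta>" using * by blast
  have bad: False if "0 \<le> a" "a < b" "\<not> inv_herglotz_converges (V a) \<zeta>" "\<not> inv_herglotz_converges (V b) \<zeta>" for a b
  proof -
    have "\<zeta> \<in> V a" using conv_V[of \<zeta> a b] that \<zeta> by auto
    then have "inv_herglotz_converges (V a) \<zeta>"
      using inv_herglotz_converges_open[OF open_V] \<zeta> by simp
    then show False using that by simp
  qed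
  from s t bad[of s t] bad[of t s] show False by linarith
qed

text \<open>In the cell of index 0 the total mass 2 pi is below 8; in the others, 8 leaves room for
  the shift of index in \<open>measure_base\<close>.\<close>

lemma measure_V_le:
  assumes "s \<ge> 0" shows "measure circle_measure (V s) \<le> 8 * (1/2) ^ dyadic_index 0 s"
proof -
  have m: "measure circle_measure (V s) \<le> measure circle_measure (S 0 (dyadic_index 0 s))"
    by (rule circle_measure.finite_measure_mono[OF V_sub_S[OF assms]]) (use open_S in auto)
  show ?thesis
  proof (cases "dyadic_index 0 s")
    case 0
    have "measure circle_measure (V s) \<le> measure circle_measure UNIV"
      by (rule circle_measure.finite_measure_mono) auto
    also have "\<dots> = 2 * pi" by (simp add: measure_def emeasure_circle_measure_UNIV)
    finally show ?thesis using 0 pi_less_4 by simp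
  next
    case (Suc n)
    have "measure circle_measure (S 0 (Suc n)) \<le> (1/2)^n"
      using measure_base[of n] by (simp add: circle_measure.emeasure_eq_measure)
    also have "\<dots> \<le> 8 * (1/2) ^ Suc n" by simp
    finally show ?thesis using m Suc by simp
  qed
qed

section \<open>Averaging over the parameter\<close>

text \<open>The map w / (1 + w) = 1 - 1 / (1 + w) sends the closed right half-plane into the disc
  with diameter from 0 to 1. The first form makes it small with w, the second transfers radial
  convergence.\<close>

definition g :: "real \<Rightarrow> complex \<Rightarrow> complex" where
  "g s z = herglotz (V s) z * inverse (1 + herglotz (V s) z)"

lemma Re_herglotz_V: "norm z < 1 \<Longrightarrow> Re (herglotz (V s) z) \<ge> 0"
  by (rule Re_herglotz_nonneg) auto

lemma g_eq: "norm z < 1 \<Longrightarrow> g s z = 1 - inverse (1 + herglotz (V s) z)"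
  using norm_ge_1_add_if_Re_nonneg(2)[OF Re_herglotz_V, of z s] by (simp add: g_def field_simps)

lemma norm_g_le:
  assumes "norm z < 1" shows "norm (g s z) \<le> norm (herglotz (V s) z)"
  using norm_ge_1_add_if_Re_nonneg(3)[OF Re_herglotz_V[OF assms], of s]
  by (simp add: g_def norm_mult mult_left_le)

lemma norm_g_le_1:
  assumes "norm z < 1" shows "norm (g s z) \<le> 1"
proof -
  have "(norm (herglotz (V s) z))\<^sup>2 \<le> (norm (1 + herglotz (V s) z))\<^sup>2"
    using Re_herglotz_V[OF assms, of s] unfolding cmod_power2 by (simp add: power2_sum)
  then have "norm (herglotz (V s) z) \<le> norm (1 + herglotz (V s) z)"
    by (rule power2_le_imp_le) simp
  moreover have "norm (g s z) = norm (herglotz (V s) z) / norm (1 + herglotz (V s) z)"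
    unfolding g_def norm_mult norm_inverse by (rule divide_inverse[symmetric])
  moreover have "norm (1 + herglotz (V s) z) > 0"
    using norm_ge_1_add_if_Re_nonneg(2)[OF Re_herglotz_V[OF assms], of s] by simp
  ultimately show ?thesis by simp
qed

lemma Re_g_ge:
  assumes "norm z < 1" shows "Re (g s z) \<ge> 1 - inverse (1 + Re (herglotz (V s) z))"
proof -
  note R = Re_herglotz_V[OF assms, of s]
  have "Re (inverse (1 + herglotz (V s) z)) \<le> norm (inverse (1 + herglotz (V s) z))"
    by (rule complex_Re_le_cmod)
  also have "\<dots> \<le> inverse (1 + Re (herglotz (V s) z))"
    unfolding norm_inverse using norm_ge_1_add_if_Re_nonneg(1)[OF R] R by (intro le_imp_inverse_le) auto
  finally show ?thesis unfolding g_eq[OF assms] by simp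
qed

lemma Re_g_nonneg:
  assumes "norm z < 1" shows "Re (g s z) \<ge> 0"
proof -
  have "inverse (1 + Re (herglotz (V s) z)) \<le> 1"
    using Re_herglotz_V[OF assms, of s] by (simp add: inverse_le_1_iff)
  with Re_g_ge[OF assms, of s] show ?thesis by linarith
qed

lemma holomorphic_g: "g s holomorphic_on ball 0 1"
  unfolding g_def
  using norm_ge_1_add_if_Re_nonneg(2)[OF Re_herglotz_V]
  by (intro holomorphic_intros holomorphic_herglotz borel_V) auto

text \<open>At a finite level the set depends on \<open>s\<close> through the integer part of
  \<open>s * 2 ^ j\<close>, so its Herglotz integral is a measurable step function of
  \<open>s\<close>; dominated convergence along the increasing \<open>D j s\<close> carries this
  over to \<open>V s\<close>.\<close>

lemma g_measurable:
  assumes z: "norm z < 1"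
  shows "(\<lambda>s. indicator {0..} s *\<^sub>R g s z) \<in> borel_measurable lborel"
proof -
  have lim: "(\<lambda>j. indicator {0..} s *\<^sub>R herglotz (D j s) z) \<longlonglongrightarrow> indicator {0..} s *\<^sub>R herglotz (V s) z" for s
  proof (cases "s \<ge> 0")
    case True
    have "(\<lambda>j. \<integral>x. indicator (D j s) x *\<^sub>R ((x + z) / (x - z)) \<partial>circle_measure)
        \<longlonglongrightarrow> (\<integral>x. indicator (V s) x *\<^sub>R ((x + z) / (x - z)) \<partial>circle_measure)"
    proof (rule integral_dominated_convergence[where w = "\<lambda>_. 2 / (1 - norm z)"])
      show "AE x in circle_measure. (\<lambda>j. indicator (D j s) x *\<^sub>R ((x + z) / (x - z))) \<longlonglongrightarrow>
          indicator (V s) x *\<^sub>R ((x + z) / (x - z))"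
        unfolding V_def by (intro AE_I2 tendsto_intros LIMSEQ_indicator_incseq incseq_D True)
      show "AE x in circle_measure. norm (indicator (D j s) x *\<^sub>R ((x + z) / (x - z))) \<le> 2 / (1 - norm z)" for j
        using AE_circle_measure
        by eventually_elim (use herglotz_kernel_bound[OF _ z] z in \<open>auto simp: indicator_def\<close>)
    qed (use herglotz_kernel_measurable[OF borel_open[OF open_S]] herglotz_kernel_measurable[OF borel_V] in auto)
    then show ?thesis using True by (auto simp: herglotz_def intro!: tendsto_intros)
  qed simp
  have m: "(\<lambda>s. indicator {0..} s *\<^sub>R herglotz (D j s) z) \<in> borel_measurable borel" for j
  proof -
    have 1: "(\<lambda>s::real. \<lfloor>s * 2 ^ j\<rfloor>) \<in> borel \<rightarrow>\<^sub>M count_space UNIV" by measurable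
    have 2: "(\<lambda>k. herglotz (S j (Suc (nat k))) z) \<in> borel_measurable (count_space UNIV)" by simp
    have "(\<lambda>s. herglotz (D j s) z) \<in> borel_measurable borel"
      using measurable_compose[OF 1 2] by (simp add: dyadic_index_def)
    then show ?thesis by measurable
  qed
  have "(\<lambda>s. indicator {0..} s *\<^sub>R herglotz (V s) z) \<in> borel_measurable borel"
    by (rule borel_measurable_LIMSEQ_metric[OF m lim])
  then have "(\<lambda>s. (indicator {0..} s *\<^sub>R herglotz (V s) z) * inverse (1 + indicator {0..} s *\<^sub>R herglotz (V s) z)) \<in> borel_measurable borel"
    by measurable
  also have "(\<lambda>s. (indicator {0..} s *\<^sub>R herglotz (V s) z) * inverse (1 + indicator {0..} s *\<^sub>R herglotz (V s) z))
      = (\<lambda>s. indicator {0..} s *\<^sub>R g s z)"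
    by (rule ext) (auto simp: g_def indicator_def)
  finally show ?thesis by simp
qed

definition decay :: "real \<Rightarrow> real" where
  "decay s = indicator {0..} s * exp (- ln 2 * s)"

lemma integrable_decay: "integrable lborel decay"
proof -
  have "((\<lambda>x. exp (- ln 2 * x)) has_integral exp (- ln 2 * 0) / ln 2) {0::real..}"
    by (rule has_integral_exp_minus_to_infinity) simp
  then have "(\<lambda>x::real. exp (- ln 2 * x)) absolutely_integrable_on {0..}"
    by (intro nonnegative_absolutely_integrable_1) (auto simp: has_integral_iff)
  then have "integrable lebesgue decay"
    by (simp add: set_integrable_def decay_def[abs_def])
  moreover have "decay \<in> borel_measurable lborel"
    unfolding decay_def[abs_def] by measurable
  ultimately show ?thesis by (simp add: integrable_completion)
qed

text \<open>For nonnegative \<open>s\<close>, \<open>decay s\<close> is 2 to the power -s; the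
  factor 2 compensates for rounding \<open>s\<close> down.\<close>

lemma power_half_le_decay:
  assumes "s \<ge> 0" shows "(1/2) ^ dyadic_index 0 s \<le> 2 * decay s"
proof -
  have "s \<le> real (Suc (dyadic_index 0 s))" using dyadic_index_gt[OF assms, of 0] by simp
  then have "exp (- ln 2 * real (Suc (dyadic_index 0 s))) \<le> exp (- ln 2 * s)" by simp
  moreover have "exp (- ln 2 * real n) = (1/2) ^ n" for n
    by (simp add: exp_minus exp_of_nat2_mult power_one_over inverse_eq_divide)
  ultimately show ?thesis using assms by (simp only: decay_def) simp
qed

definition W :: "complex \<Rightarrow> complex" where
  "W z = (\<integral>s. indicator {0..} s *\<^sub>R g s z \<partial>lborel)"

text \<open>The measure of \<open>V s\<close> decays exponentially and the kernel is bounded for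
  such \<open>z\<close>. The constant 16 is 8 from \<open>measure_V_le\<close> times 2 from
  \<open>power_half_le_decay\<close>.\<close>

lemma norm_g_le_decay:
  assumes z: "norm z \<le> 1 - r" and r: "r > 0"
  shows "norm (indicator {0..} s *\<^sub>R g s z) \<le> 16 / r * decay s"
proof (cases "s \<ge> 0")
  case True
  have z1: "norm z < 1" using z r by linarith
  have "norm (g s z) \<le> measure circle_measure (V s) / (pi * (1 - norm z))"
    using norm_g_le[OF z1] norm_herglotz_le[OF borel_V z1] by (rule order_trans)
  also have "\<dots> \<le> 8 * (1/2) ^ dyadic_index 0 s / r"
  proof (rule frac_le)
    have "1 * r \<le> pi * (1 - norm z)" using pi_ge_two z r by (intro mult_mono) auto
    then show "r \<le> pi * (1 - norm z)" by simp
  qed (use measure_V_le[OF True] r in auto)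
  also have "\<dots> \<le> 8 * (2 * decay s) / r"
    using power_half_le_decay[OF True] r by (intro divide_right_mono mult_left_mono) auto
  finally show ?thesis using True by simp
qed (simp add: decay_def)

lemma integrable_g:
  assumes z: "norm z < 1"
  shows "integrable lborel (\<lambda>s. indicator {0..} s *\<^sub>R g s z)"
proof (rule Bochner_Integration.integrable_bound[OF integrable_mult_right[OF integrable_decay] g_measurable[OF z]])
  show "AE s in lborel. norm (indicator {0..} s *\<^sub>R g s z) \<le> norm (16 / (1 - norm z) * decay s)"
  proof (rule AE_I2)
    fix s
    have "norm (indicator {0..} s *\<^sub>R g s z) \<le> 16 / (1 - norm z) * decay s"
      by (rule norm_g_le_decay) (use z in auto)
    also have "\<dots> \<le> norm (16 / (1 - norm z) * decay s)"
      unfolding real_norm_def by (rule abs_ge_self)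
    finally show "norm (indicator {0..} s *\<^sub>R g s z) \<le> norm (16 / (1 - norm z) * decay s)" .
  qed
qed

lemma holomorphic_W: "W holomorphic_on ball 0 1"
  unfolding W_def[abs_def]
proof (rule holomorphic_on_integral)
  show "AE s in lborel. (\<lambda>z. indicator {0..} s *\<^sub>R g s z) holomorphic_on ball 0 1"
  proof (rule AE_I2)
    fix s
    have "(\<lambda>z. of_real (indicator {0..} s) * g s z) holomorphic_on ball 0 1"
      by (intro holomorphic_intros holomorphic_g)
    then show "(\<lambda>z. indicator {0..} s *\<^sub>R g s z) holomorphic_on ball 0 1"
      by (simp add: scaleR_conv_of_real)
  qed
  fix z :: complex assume z: "z \<in> ball 0 1"
  define r where "r = (1 - norm z) / 2"
  have r: "0 < r" using z by (simp add: r_def)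
  have *: "norm y \<le> 1 - r" if "y \<in> cball z r" for y
    using norm_triangle_ineq2[of y z] that by (simp add: r_def dist_norm norm_minus_commute field_simps)
  show "\<exists>r w. 0 < r \<and> cball z r \<subseteq> ball 0 1 \<and> integrable lborel w \<and>
      (AE s in lborel. \<forall>y\<in>cball z r. norm (indicator {0..} s *\<^sub>R g s y) \<le> w s)"
  proof (intro exI conjI)
    show "cball z r \<subseteq> ball 0 1" using * r by fastforce
    show "integrable lborel (\<lambda>s. 16 / r * decay s)"
      by (rule integrable_mult_right[OF integrable_decay])
    show "AE s in lborel. \<forall>y\<in>cball z r. norm (indicator {0..} s *\<^sub>R g s y) \<le> 16 / r * decay s"
      using norm_g_le_decay[OF * r] by (intro AE_I2 ballI)
  qed (fact r)
qed (use g_measurable in auto)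

lemma Re_W:
  assumes "norm z < 1" shows "Re (W z) = (\<integral>s. indicator {0..} s * Re (g s z) \<partial>lborel)"
  unfolding W_def integral_Re[OF integrable_g[OF assms], symmetric] by simp

lemma Re_W_nonneg:
  assumes "norm z < 1" shows "Re (W z) \<ge> 0"
  unfolding Re_W[OF assms] using Re_g_nonneg[OF assms] by (intro Bochner_Integration.integral_nonneg) auto

text \<open>Dominated convergence in \<open>s\<close>, where the one parameter that may be bad at
  \<zeta> is Lebesgue-null. The majorant has to hold uniformly along the radius, where the estimate
  through \<open>measure_V_le\<close> degenerates; the potential bound takes its place.\<close>

lemma W_radial_limit:
  assumes \<zeta>: "\<zeta> \<in> unit_circle - S 0 n"
  shows "\<exists>L. has_radial_limit W L \<zeta>"
  unfolding has_radial_limit_def W_def at_left_1_eq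
proof (rule dominated_convergence_within_ex)
  have r: "norm (of_real r * \<zeta>) < 1" if "r \<in> {0<..<1}" for r
    using that \<zeta> by (simp add: norm_radial)
  show "(\<lambda>s. indicator {0..} s *\<^sub>R g s (of_real r * \<zeta>)) \<in> borel_measurable lborel" if "r \<in> {0<..<1}" for r
    by (rule g_measurable[OF r[OF that]])
  show "integrable lborel (\<lambda>s. 2 ^ (n + 2) * decay s)"
    by (rule integrable_mult_right[OF integrable_decay])
  show "at (1::real) within {0<..<1} \<noteq> bot"
    unfolding at_left_1_eq[symmetric] by simp
  obtain s0 where s0: "\<And>s. s \<ge> 0 \<Longrightarrow> s \<noteq> s0 \<Longrightarrow> inv_herglotz_converges (V s) \<zeta>"
    using conv_V_except_one[of \<zeta>] \<zeta> by auto
  show "AE s in lborel. \<exists>l. ((\<lambda>r. indicator {0..} s *\<^sub>R g s (of_real r * \<zeta>)) \<longlongrightarrow> l) (at 1 within {0<..<1})"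
    using AE_lborel_singleton[of s0]
  proof eventually_elim
    case (elim s)
    show ?case
    proof (cases "s \<ge> 0")
      case True
      then obtain L where L: "((\<lambda>r. inverse (1 + herglotz (V s) (of_real r * \<zeta>))) \<longlongrightarrow> L) (at 1 within {0<..<1})"
        using s0[OF True elim] by (auto simp: inv_herglotz_converges_def has_radial_limit_def at_left_1_eq)
      then have "((\<lambda>r. 1 - inverse (1 + herglotz (V s) (of_real r * \<zeta>))) \<longlongrightarrow> 1 - L) (at 1 within {0<..<1})"
        by (intro tendsto_intros)
      moreover have "\<forall>\<^sub>F r in at 1 within {0<..<1}. 1 - inverse (1 + herglotz (V s) (of_real r * \<zeta>)) = indicator {0..} s *\<^sub>R g s (of_real r * \<zeta>)"
        unfolding at_left_1_eq[symmetric] using True r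
        by (intro eventually_at_left_1) (simp add: g_eq)
      ultimately have "((\<lambda>r. indicator {0..} s *\<^sub>R g s (of_real r * \<zeta>)) \<longlongrightarrow> 1 - L) (at 1 within {0<..<1})"
        by (rule Lim_transform_eventually)
      then show ?thesis ..
    next
      case False
      then have "(\<lambda>r. indicator {0..} s *\<^sub>R g s (of_real r * \<zeta>)) = (\<lambda>_. 0)" by (auto simp: indicator_def)
      then show ?thesis by (auto intro: exI[of _ 0])
    qed
  qed
  fix r :: real assume r': "r \<in> {0<..<1}"
  have "norm (indicator {0..} s *\<^sub>R g s (of_real r * \<zeta>)) \<le> 2 ^ (n + 2) * decay s" for s
  proof (cases "s \<ge> 0")
    case True
    define k where "k = dyadic_index 0 s"
    have d: "(1/2) ^ k \<le> 2 * decay s" unfolding k_def by (rule power_half_le_decay[OF True])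
    \<comment> \<open>For cells up to \<open>n\<close>, where \<zeta> may lie in \<open>V s\<close>,
      the bound 1 is used and the factor \<open>2 ^ (n + 1)\<close> makes room for it; beyond,
      \<open>V s\<close> lies in a base set of potential at most \<open>(1/2)^m\<close>, with
      \<open>k = Suc m\<close>.\<close>
    have "norm (g s (of_real r * \<zeta>)) \<le> 2 ^ (n + 1) * (1/2) ^ k"
    proof (cases "k \<le> n")
      case True
      then have "(1::real) \<le> 2 ^ (n + 1 - k)" by simp
      also have "\<dots> = 2 ^ (n + 1) * (1/2) ^ k" using True by (simp add: power_diff power_one_over)
      finally show ?thesis using norm_g_le_1[OF r[OF r'], of s] by linarith
    next
      case False
      then obtain m where m: "k = Suc m" "n \<le> m" by (cases k) auto
      have out: "\<zeta> \<in> unit_circle - S 0 m" using \<zeta> S_antimono[OF m(2), of 0] by auto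
      have Vs: "V s \<subseteq> S 0 (Suc m)" using V_sub_S[OF True, of 0] by (simp add: k_def[symmetric] m)
      have "ennreal (norm (herglotz (V s) (of_real r * \<zeta>))) \<le> reciprocal_potential (V s) \<zeta>"
        using out Vs S_Suc[of 0 m] r' by (intro norm_herglotz_radial_le borel_V) auto
      also have "\<dots> \<le> reciprocal_potential (S 0 (Suc m)) \<zeta>" by (rule reciprocal_potential_mono[OF Vs])
      also have "\<dots> \<le> ennreal ((1/2)^m)" by (rule potential_base[OF out])
      finally have "norm (herglotz (V s) (of_real r * \<zeta>)) \<le> (1/2)^m" by simp
      also have "\<dots> = 2 * (1/2)^k" using m by simp
      also have "\<dots> \<le> 2 ^ (n + 1) * (1/2)^k" by (intro mult_right_mono) auto
      finally show ?thesis using norm_g_le[OF r[OF r'], of s] by linarith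
    qed
    also have "\<dots> \<le> 2 ^ (n + 1) * (2 * decay s)" by (intro mult_left_mono d) auto
    finally show ?thesis using True by simp
  qed (simp add: decay_def)
  then show "AE s in lborel. norm (indicator {0..} s *\<^sub>R g s (of_real r * \<zeta>)) \<le> 2 ^ (n + 2) * decay s"
    by (intro AE_I2)
qed

text \<open>Every \<open>V s\<close> contains \<zeta>. Near \<zeta>, for s in
  \<open>{0..real K}\<close>, monotonicity gives a Herglotz real part at least that of
  \<open>V K\<close>, so at least 1/2; then \<open>Re (g s z)\<close> is at least 1 - 2/3 = 1/3, and
  integration over this interval gives K / 3, which is arbitrarily large.\<close>

lemma W_at_infinity:
  assumes \<zeta>: "\<zeta> \<in> E" "norm \<zeta> = 1"
  shows "filterlim W at_infinity (at \<zeta> within ball 0 1)"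
  unfolding filterlim_at_infinity[OF order.refl]
proof (intro allI impI)
  fix r :: real
  obtain K :: nat where K: "r \<le> real K / 3"
    using real_arch_simple[of "3 * r"] by (auto simp: field_simps)
  have "\<zeta> \<in> V K" using E_sub_V \<zeta> by blast
  with Re_herglotz_open_ge_half[OF open_V this \<zeta>(2)]
  have "\<forall>\<^sub>F z in at \<zeta> within ball 0 1. 1/2 \<le> Re (herglotz (V K) z)" by blast
  moreover have "\<forall>\<^sub>F z in at \<zeta> within ball 0 1. z \<in> ball 0 1"
    by (auto simp: eventually_at_filter)
  ultimately show "\<forall>\<^sub>F z in at \<zeta> within ball 0 1. r \<le> norm (W z)"
  proof eventually_elim
    case (elim z)
    then have z: "norm z < 1" by simp
    have "real K / 3 = (\<integral>s. (1/3::real) * indicator {0..real K} s \<partial>lborel)" by simp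
    also have "\<dots> \<le> (\<integral>s. indicator {0..} s * Re (g s z) \<partial>lborel)"
    proof (rule integral_mono)
      show "integrable lborel (\<lambda>s. (1/3::real) * indicator {0..real K} s)" by simp
      show "integrable lborel (\<lambda>s. indicator {0..} s * Re (g s z))"
        using integrable_Re[OF integrable_g[OF z]] by simp
      fix s :: real
      show "1/3 * indicator {0..real K} s \<le> indicator {0..} s * Re (g s z)"
      proof (cases "s \<in> {0..real K}")
        case True
        then have "Re (herglotz (V K) z) \<le> Re (herglotz (V s) z)"
          using V_antimono[of s K] by (intro Re_herglotz_mono borel_V z) auto
        with elim(1) have "inverse (1 + Re (herglotz (V s) z)) \<le> inverse (1 + 1/2)"
          by (intro le_imp_inverse_le) auto
        with Re_g_ge[OF z, of s] have "1/3 \<le> Re (g s z)" by simp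
        then show ?thesis using True by simp
      next
        case False
        then have "indicator {0..real K} s = (0::real)" by (rule indicator_simps)
        then show ?thesis using Re_g_nonneg[OF z, of s] by simp
      qed
    qed
    also have "\<dots> = Re (W z)" by (rule Re_W[OF z, symmetric])
    finally show ?case using K complex_Re_le_cmod[of "W z"] by linarith
  qed
qed

end

section \<open>The function attached to a null G-delta set\<close>

text \<open>Intersecting with the n-th open set of the G-delta representation at each step makes the
  base chain shrink to exactly \<open>E\<close> on the circle, so every other point of the circle is
  outside some \<open>S 0 n\<close>, as \<open>W_radial_limit\<close> requires.\<close>

theorem ex_radial_limits_infinite_on_null_gdelta:
  assumes gd: "gdelta_in (top_of_set unit_circle) E" and null: "E \<in> null_sets arc_length"
  shows "\<exists>W. W holomorphic_on ball 0 1 \<and> (\<forall>z. norm z < 1 \<longrightarrow> Re (W z) \<ge> 0) \<and>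
    (\<forall>\<zeta>\<in>E. filterlim W at_infinity (at \<zeta> within ball 0 1)) \<and>
    (\<forall>\<zeta>\<in>unit_circle - E. \<exists>L. has_radial_limit W L \<zeta>)"
proof -
  have sub: "E \<subseteq> unit_circle" using gdelta_in_subset[OF gd] by simp
  obtain N where N: "N \<in> null_sets circle_measure" "E \<subseteq> N"
    using null null_sets_arc_length_iff[OF sub] by blast
  obtain C :: "nat \<Rightarrow> complex set" where C: "\<And>n. openin (top_of_set unit_circle) (C n)" "\<Inter>(range C) = E"
    using gd unfolding gdelta_in_descending by blast
  have "\<forall>n. \<exists>A. open A \<and> C n = unit_circle \<inter> A" using C(1) by (auto simp: openin_open)
  then obtain A where A: "\<And>n. open (A n)" "\<And>n. C n = unit_circle \<inter> A n" by metis
  have EA: "E \<subseteq> A n" for n using C(2) A(2) by blast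
  have "\<exists>G. \<forall>n. (open (G n) \<and> E \<subseteq> G n) \<and> (G (Suc n) \<subseteq> G n \<inter> A n \<and>
      emeasure circle_measure (G (Suc n)) \<le> ennreal ((1/2)^n) \<and>
      (\<forall>\<zeta>. \<zeta> \<notin> G n \<inter> A n \<longrightarrow> reciprocal_potential (G (Suc n)) \<zeta> \<le> ennreal ((1/2)^n)))"
  proof (rule dependent_nat_choice)
    show "\<exists>U. open U \<and> E \<subseteq> U" by (rule exI[of _ UNIV]) auto
    fix U n assume U: "open U \<and> E \<subseteq> U"
    show "\<exists>V. (open V \<and> E \<subseteq> V) \<and> (V \<subseteq> U \<inter> A n \<and> emeasure circle_measure V \<le> ennreal ((1/2)^n) \<and>
      (\<forall>\<zeta>. \<zeta> \<notin> U \<inter> A n \<longrightarrow> reciprocal_potential V \<zeta> \<le> ennreal ((1/2)^n)))"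
      using thin_open_cover[of "U \<inter> A n" N E "(1/2)^n"] U A(1) EA N by (metis Int_greatest open_Int zero_less_divide_1_iff zero_less_numeral zero_less_power)
  qed
  then obtain G where G: "\<And>n. open (G n)" "\<And>n. E \<subseteq> G n" "\<And>n. G (Suc n) \<subseteq> G n \<inter> A n"
    "\<And>n. emeasure circle_measure (G (Suc n)) \<le> ennreal ((1/2)^n)"
    "\<And>n \<zeta>. \<zeta> \<notin> G n \<inter> A n \<Longrightarrow> reciprocal_potential (G (Suc n)) \<zeta> \<le> ennreal ((1/2)^n)" by blast
  have "open_chain E G"
    unfolding open_chain_def
  proof (intro allI conjI ballI)
    fix i \<zeta> assume \<zeta>: "\<zeta> \<in> unit_circle - G i"
    \<comment> \<open>Outside \<open>G i\<close> the next set has finite potential, so it is good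
      there by comparison with the empty set.\<close>
    have "reciprocal_potential (G (Suc i)) \<zeta> < \<infinity>"
      using G(5)[of \<zeta> i] \<zeta> by (auto intro: order_le_less_trans)
    then show "inv_herglotz_converges (G (Suc i)) \<zeta>"
      using inv_herglotz_converges_potential[OF _ _ _ _ inv_herglotz_converges_empty, of "G (Suc i)" \<zeta>] G(1,3) \<zeta> by auto
  qed (use G in auto)
  \<comment> \<open>The clause for \<open>j = 0\<close> pins the first chain to \<open>G\<close>;
    each later chain refines its predecessor, with summable tolerances
    \<open>(1/2)^j\<close>.\<close>
  then have "\<exists>S. \<forall>j. (open_chain E (S j) \<and> (j = 0 \<longrightarrow> S j = G)) \<and> chain_refinement ((1/2)^j) (S j) (S (Suc j))"
    by (intro dependent_nat_choice) (auto intro!: ex_chain_refinement)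
  then obtain S where S: "\<And>j. open_chain E (S j)" "S 0 = G" "\<And>j. chain_refinement ((1/2)^j) (S j) (S (Suc j))" by blast
  interpret dyadic_family E S
    by standard (use S G in auto)
  show ?thesis
  proof (intro exI[of _ W] conjI allI impI ballI)
    fix \<zeta> assume \<zeta>: "\<zeta> \<in> unit_circle - E"
    then obtain n where "\<zeta> \<notin> C n" using C(2) by blast
    then have "\<zeta> \<in> unit_circle - S 0 (Suc n)" using A(2)[of n] G(3)[of n] \<zeta> S(2) by auto
    then show "\<exists>L. has_radial_limit W L \<zeta>" by (rule W_radial_limit)
  next
    fix \<zeta> assume "\<zeta> \<in> E"
    then show "filterlim W at_infinity (at \<zeta> within ball 0 1)"
      using subsetD[OF sub] by (intro W_at_infinity) auto
  qed (auto intro: holomorphic_W Re_W_nonneg)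
qed

section \<open>Prescribed boundary behaviour\<close>

text \<open>If \<open>W \<rightarrow> \<infinity>\<close> along a radius, then \<open>(1 + W)\<^sup>i\<close> is bounded above and below there while its argument,
  \<open>ln |1 + W|\<close>, tends to infinity, so it winds around the origin infinitely often.\<close>

definition winding_power :: "(complex \<Rightarrow> complex) \<Rightarrow> complex \<Rightarrow> complex" where
  "winding_power W z = exp (\<i> * Ln (1 + W z) - of_real (pi / 2))"

lemma Re_Im_Ln_1_add:
  assumes "Re w \<ge> 0"
  shows "\<bar>Im (Ln (1 + w))\<bar> < pi / 2" "Re (Ln (1 + w)) = ln (norm (1 + w))"
  using assms norm_ge_1_add_if_Re_nonneg(2)[OF assms] Re_Ln_pos_lt_imp[of "1 + w"] by auto

text \<open>The modulus is exp (- Im (Ln (1 + W z)) - pi / 2), and the argument of 1 + W z lies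
  strictly between -pi / 2 and pi / 2. The shift by pi / 2 brings the upper bound to 1; the modulus
  stays above exp (- pi).\<close>

lemma norm_winding_power_le_1:
  assumes "Re (W z) \<ge> 0" shows "norm (winding_power W z) \<le> 1"
  using Re_Im_Ln_1_add(1)[OF assms] by (simp add: winding_power_def)

lemma holomorphic_winding_power:
  assumes "W holomorphic_on S" "\<And>z. z \<in> S \<Longrightarrow> Re (W z) \<ge> 0"
  shows "winding_power W holomorphic_on S"
  unfolding winding_power_def[abs_def]
  by (intro holomorphic_intros assms) (use assms(2) in \<open>force simp: complex_nonpos_Reals_iff\<close>)

lemma winding_power_radial_limit:
  assumes W: "has_radial_limit W L \<zeta>" and \<zeta>: "norm \<zeta> = 1" and Re: "\<And>z. norm z < 1 \<Longrightarrow> Re (W z) \<ge> 0"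
  shows "\<exists>M. has_radial_limit (winding_power W) M \<zeta>"
proof -
  have "Re L \<ge> 0"
  proof (rule tendsto_lowerbound[OF tendsto_Re[OF W[unfolded has_radial_limit_def]]])
    show "\<forall>\<^sub>F r in at_left 1. 0 \<le> Re (W (of_real r * \<zeta>))"
      by (rule eventually_at_left_1) (auto intro!: Re simp: norm_radial \<zeta>)
  qed simp
  then have "1 + L \<notin> \<real>\<^sub>\<le>\<^sub>0" by (auto simp: complex_nonpos_Reals_iff)
  then have "((\<lambda>r. winding_power W (of_real r * \<zeta>)) \<longlongrightarrow> exp (\<i> * Ln (1 + L) - of_real (pi / 2))) (at_left 1)"
    unfolding winding_power_def using W[unfolded has_radial_limit_def] by (intro tendsto_intros)
  then show ?thesis unfolding has_radial_limit_def by blast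
qed

lemma filterlim_radius:
  fixes \<zeta> :: complex
  assumes "norm \<zeta> = 1"
  shows "filterlim (\<lambda>r. of_real r * \<zeta>) (at \<zeta> within ball 0 1) (at_left 1)"
proof -
  have "((\<lambda>r. of_real r * \<zeta>) \<longlongrightarrow> of_real 1 * \<zeta>) (at_left 1)" by (intro tendsto_intros)
  moreover have "\<forall>\<^sub>F r in at_left 1. of_real r * \<zeta> \<in> ball 0 1 \<and> of_real r * \<zeta> \<noteq> \<zeta>"
  proof (rule eventually_at_left_1)
    fix r :: real assume r: "0 < r" "r < 1"
    then have "norm (of_real r * \<zeta>) < norm \<zeta>" using assms by (simp add: norm_radial)
    then show "of_real r * \<zeta> \<in> ball 0 1 \<and> of_real r * \<zeta> \<noteq> \<zeta>" using assms by auto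
  qed
  ultimately show ?thesis by (simp add: filterlim_at)
qed

text \<open>The function \<open>l\<close> is a continuous argument of \<open>winding_power W\<close>
  on the radius and tends to infinity. By the intermediate value theorem it reaches an even and an
  odd multiple of pi beyond any \<rho>, where the cosine is 1 and -1; the modulus is at least exp (-
  pi).\<close>

lemma winding_power_oscillates:
  assumes cont: "continuous_on (ball 0 1) W" and Re: "\<And>z. norm z < 1 \<Longrightarrow> Re (W z) \<ge> 0"
    and inf: "filterlim W at_infinity (at \<zeta> within ball 0 1)" and \<zeta>: "norm \<zeta> = 1"
    and \<rho>: "\<rho> < 1"
  shows "\<exists>r s. \<rho> < r \<and> 0 < r \<and> r < 1 \<and> \<rho> < s \<and> 0 < s \<and> s < 1 \<and>
    exp (- pi) \<le> Re (winding_power W (of_real r * \<zeta>)) \<and> Re (winding_power W (of_real s * \<zeta>)) \<le> - exp (- pi)"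
proof -
  \<comment> \<open>Searching from \<open>b\<close> on keeps all radii positive and beyond
    \<rho>.\<close>
  define a where "a = max \<rho> 0"
  define b where "b = (a + 1) / 2"
  have ab: "0 \<le> a" "\<rho> \<le> a" "a < b" "b < 1" using \<rho> by (auto simp: a_def b_def)
  define l where "l r = ln (norm (1 + W (of_real r * \<zeta>)))" for r :: real
  have ne: "1 + W (of_real r * \<zeta>) \<noteq> 0" if "0 \<le> r" "r < 1" for r
    using norm_ge_1_add_if_Re_nonneg(2)[OF Re] that \<zeta> by (simp add: norm_radial)
  have cont_l: "continuous_on {b..t} l" if "t < 1" for t
    unfolding l_def
    by (intro continuous_intros continuous_on_compose2[OF cont]) (use that ab ne \<zeta> in \<open>auto simp: norm_radial\<close>)
  have "filterlim (\<lambda>r. W (of_real r * \<zeta>)) at_infinity (at_left 1)"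
    by (rule filterlim_compose[OF inf filterlim_radius[OF \<zeta>]])
  then have "filterlim (\<lambda>r. 1 + W (of_real r * \<zeta>)) at_infinity (at_left 1)"
    by (rule tendsto_add_filterlim_at_infinity[OF tendsto_const])
  then have "filterlim (\<lambda>r. norm (1 + W (of_real r * \<zeta>))) at_top (at_left 1)"
    by (rule filterlim_at_infinity_imp_norm_at_top)
  then have lim: "filterlim l at_top (at_left 1)"
    unfolding l_def by (rule filterlim_compose[OF ln_at_top])
  have hit: "\<exists>r. b \<le> r \<and> r < 1 \<and> l r = y" if "l b \<le> y" for y
  proof -
    have "\<forall>\<^sub>F r in at_left 1. y \<le> l r" using lim by (simp add: filterlim_at_top)
    moreover have "\<forall>\<^sub>F r in at_left 1. r \<in> {b<..<1}" by (rule eventually_at_left_real) (use ab in simp)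
    ultimately have "\<forall>\<^sub>F r in at_left 1. y \<le> l r \<and> r \<in> {b<..<1}" by (rule eventually_conj)
    from eventually_happens'[OF trivial_limit_at_left_real this]
    obtain t where t: "y \<le> l t" "b < t" "t < 1" by auto
    from IVT'[of l b y t] cont_l[of t] t that show ?thesis by force
  qed
  obtain k :: nat where k: "l b \<le> 2 * pi * real k"
  proof -
    obtain k :: nat where "l b / (2 * pi) \<le> real k" using real_arch_simple by blast
    then show ?thesis using that[of k] by (simp add: field_simps)
  qed
  obtain r where r: "b \<le> r" "r < 1" "l r = 2 * pi * real k" using hit[OF k] by blast
  obtain s where s: "b \<le> s" "s < 1" "l s = 2 * pi * real k + pi" using hit[of "2 * pi * real k + pi"] k pi_gt_zero by force
  have wp: "Re (winding_power W (of_real t * \<zeta>)) = exp (- (Im (Ln (1 + W (of_real t * \<zeta>)))) - pi / 2) * cos (l t)"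
    and wp_ge: "exp (- pi) \<le> exp (- (Im (Ln (1 + W (of_real t * \<zeta>)))) - pi / 2)" if "b \<le> t" "t < 1" for t
  proof -
    have "Re (W (of_real t * \<zeta>)) \<ge> 0" using that ab \<zeta> by (intro Re) (simp add: norm_radial)
    note Ln = Re_Im_Ln_1_add[OF this]
    show "Re (winding_power W (of_real t * \<zeta>)) = exp (- (Im (Ln (1 + W (of_real t * \<zeta>)))) - pi / 2) * cos (l t)"
      by (simp add: winding_power_def Re_exp l_def Ln(2))
    show "exp (- pi) \<le> exp (- (Im (Ln (1 + W (of_real t * \<zeta>)))) - pi / 2)"
      using Ln(1) by simp
  qed
  have cos_r: "cos (l r) = 1" and cos_s: "cos (l s) = -1"
    unfolding r(3) s(3) using cos_npi[of "2 * k"] by (simp_all add: mult_ac)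
  have "exp (- pi) \<le> Re (winding_power W (of_real r * \<zeta>))"
    unfolding wp[OF r(1,2)] cos_r using wp_ge[OF r(1,2)] by simp
  moreover have "Re (winding_power W (of_real s * \<zeta>)) \<le> - exp (- pi)"
    unfolding wp[OF s(1,2)] cos_s using wp_ge[OF s(1,2)] by simp
  moreover have "\<rho> < r" "0 < r" "\<rho> < s" "0 < s" using r(1) s(1) ab by linarith+
  ultimately show ?thesis using r(2) s(2) by blast
qed

section \<open>Superposition for a countable union\<close>

text \<open>At a point of the union let n be the first index whose set contains it: the earlier
  terms converge there, the n-th oscillates by a fixed amount times \<open>c ^ n\<close>, and the
  tail is too small to cancel this. At the other points of the circle, uniform convergence passes
  the radial limits on to the sum.\<close>

lemma ex_bounded_holomorphic_no_radial_limit_on: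
  fixes E :: "nat \<Rightarrow> complex set"
  assumes W: "\<And>n. W n holomorphic_on ball 0 1" "\<And>n z. norm z < 1 \<Longrightarrow> Re (W n z) \<ge> 0"
    "\<And>n \<zeta>. \<zeta> \<in> E n \<Longrightarrow> filterlim (W n) at_infinity (at \<zeta> within ball 0 1)"
    "\<And>n \<zeta>. \<zeta> \<in> unit_circle - E n \<Longrightarrow> \<exists>L. has_radial_limit (W n) L \<zeta>"
    and sub: "\<And>n. E n \<subseteq> unit_circle"
  shows "\<exists>h. h holomorphic_on ball 0 1 \<and> (\<forall>z. norm z < 1 \<longrightarrow> norm (h z) \<le> 2) \<and>
    {\<zeta> \<in> unit_circle. \<not> (\<exists>L. has_radial_limit h L \<zeta>)} = (\<Union>n. E n)"
proof -
  define \<kappa> where "\<kappa> = exp (- pi)"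
  \<comment> \<open>Since 1 / (1 - c) is at most 4/3, the tail after the n-th term is at most
    \<open>c ^ Suc n * (4/3)\<close>, which is exactly one third of
    \<open>c ^ n * \<kappa>\<close>.\<close>
  define c where "c = \<kappa> / 4"
  have \<kappa>: "0 < \<kappa>" "\<kappa> < 1" by (auto simp: \<kappa>_def)
  then have c: "0 < c" "c < 1/4" by (auto simp: c_def)
  define p where "p n z = of_real (c ^ n) * winding_power (W n) z" for n z
  define h where "h z = (\<Sum>n. p n z)" for z
  have p_le: "norm (p n z) \<le> c ^ n" if "norm z < 1" for n z
    using norm_winding_power_le_1[of "W n" z] W(2)[OF that, of n] c
    by (simp add: p_def norm_mult norm_power mult_left_le)
  have sm_c: "summable (\<lambda>n. c ^ n)" using c by (intro summable_geometric) auto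
  have sm: "summable (\<lambda>n. p (n + k) z)" and sm_norm: "summable (\<lambda>n. norm (p (n + k) z))" if "norm z < 1" for z k
  proof -
    have "summable (\<lambda>n. c ^ (n + k))" using sm_c by (subst summable_iff_shift)
    then show "summable (\<lambda>n. norm (p (n + k) z))"
      by (rule summable_comparison_test') (use p_le[OF that] in \<open>simp only: real_norm_def abs_norm_cancel\<close>)
    then show "summable (\<lambda>n. p (n + k) z)" by (rule summable_norm_cancel)
  qed
  have tail_le: "norm (\<Sum>n. p (n + k) z) \<le> c ^ k * (4/3)" if "norm z < 1" for k z
  proof -
    have "norm (\<Sum>n. p (n + k) z) \<le> (\<Sum>n. norm (p (n + k) z))" by (rule summable_norm[OF sm_norm[OF that]])
    also have "\<dots> \<le> (\<Sum>n. c ^ k * c ^ n)"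
    proof (intro suminf_le sm_norm that summable_mult sm_c)
      show "norm (p (n + k) z) \<le> c ^ k * c ^ n" for n
        using p_le[OF that, of "n + k"] by (simp add: power_add mult.commute)
    qed
    also have "\<dots> = c ^ k * (1 / (1 - c))" using c by (subst suminf_mult[OF sm_c]) (simp add: suminf_geometric)
    also have "\<dots> \<le> c ^ k * (4/3)" using c by (intro mult_left_mono) (auto simp: field_simps)
    finally show ?thesis .
  qed
  have split: "h z = (\<Sum>n<k. p n z) + (\<Sum>n. p (n + k) z)" if "norm z < 1" for z k
    using suminf_split_initial_segment[of "\<lambda>n. p n z" k] sm[OF that, of 0] by (simp add: h_def add.commute)
  have hol: "h holomorphic_on ball 0 1"
  proof (rule holomorphic_uniform_sequence[of _ "\<lambda>N z. \<Sum>n<N. p n z"])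
    show "(\<lambda>z. \<Sum>n<N. p n z) holomorphic_on ball 0 1" for N
      unfolding p_def by (intro holomorphic_intros holomorphic_winding_power W) auto
    fix z :: complex assume "z \<in> ball 0 1"
    then obtain d where d: "0 < d" "cball z d \<subseteq> ball 0 1" using open_contains_cball[of "ball (0::complex) 1"] open_ball by blast
    have "uniform_limit (cball z d) (\<lambda>N z. \<Sum>n<N. p n z) (\<lambda>z. \<Sum>n. p n z) sequentially"
      by (rule Weierstrass_m_test[OF _ sm_c]) (use d p_le in auto)
    then show "\<exists>d>0. cball z d \<subseteq> ball 0 1 \<and> uniform_limit (cball z d) (\<lambda>N z. \<Sum>n<N. p n z) h sequentially"
      using d by (auto simp: h_def[abs_def])
  qed simp
  have h_le: "norm (h z) \<le> 2" if "norm z < 1" for z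
    using tail_le[OF that, of 0] by (simp add: h_def)
  have p_conv: "\<exists>M. ((\<lambda>r. p n (of_real r * \<zeta>)) \<longlongrightarrow> M) (at_left 1)" if \<zeta>: "\<zeta> \<in> unit_circle" "\<zeta> \<notin> E n" for n \<zeta>
  proof -
    obtain L where "has_radial_limit (W n) L \<zeta>" using W(4)[of \<zeta> n] \<zeta> by blast
    from winding_power_radial_limit[OF this _ W(2)] \<zeta>
    obtain M where "has_radial_limit (winding_power (W n)) M \<zeta>" by auto
    then have "((\<lambda>r. p n (of_real r * \<zeta>)) \<longlongrightarrow> of_real (c ^ n) * M) (at_left 1)"
      unfolding p_def has_radial_limit_def by (intro tendsto_intros)
    then show ?thesis ..
  qed
  have conv: "\<exists>L. has_radial_limit h L \<zeta>" if \<zeta>: "\<zeta> \<in> unit_circle" "\<zeta> \<notin> (\<Union>n. E n)" for \<zeta>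
    unfolding has_radial_limit_def
  proof (rule ex_tendsto_if_approximable)
    fix e :: real assume "e > 0"
    then obtain N where N: "c ^ N < e / 2" using real_arch_pow_inv[of "e/2" c] c by auto
    obtain M where M: "\<And>n. ((\<lambda>r. p n (of_real r * \<zeta>)) \<longlongrightarrow> M n) (at_left 1)"
      using p_conv[OF \<zeta>(1)] \<zeta>(2) by (metis UN_iff UNIV_I)
    have "((\<lambda>r. \<Sum>n<N. p n (of_real r * \<zeta>)) \<longlongrightarrow> (\<Sum>n<N. M n)) (at_left 1)"
      by (intro tendsto_sum M)
    moreover have "\<forall>\<^sub>F r in at_left 1. dist (h (of_real r * \<zeta>)) (\<Sum>n<N. p n (of_real r * \<zeta>)) \<le> e"
    proof (rule eventually_at_left_1)
      fix r :: real assume "0 < r" "r < 1"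
      then have r: "norm (of_real r * \<zeta>) < 1" using \<zeta> by (simp add: norm_radial)
      show "dist (h (of_real r * \<zeta>)) (\<Sum>n<N. p n (of_real r * \<zeta>)) \<le> e"
        using tail_le[OF r, of N] N \<open>e > 0\<close> by (simp add: split[OF r, of N] dist_norm)
    qed
    ultimately show "\<exists>g l. (g \<longlongrightarrow> l) (at_left 1) \<and> (\<forall>\<^sub>F r in at_left 1. dist (h (of_real r * \<zeta>)) (g r) \<le> e)"
      by blast
  qed simp
  have nconv: "\<not> has_radial_limit h L \<zeta>" if \<zeta>: "\<zeta> \<in> E m" for \<zeta> m L
  proof
    assume L: "has_radial_limit h L \<zeta>"
    define n where "n = (LEAST n. \<zeta> \<in> E n)"
    have n: "\<zeta> \<in> E n" "\<And>k. k < n \<Longrightarrow> \<zeta> \<notin> E k"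
      unfolding n_def using \<zeta> by (auto intro: LeastI dest: not_less_Least)
    have \<zeta>1: "norm \<zeta> = 1" using subsetD[OF sub n(1)] by simp
    have "\<forall>k. \<exists>M. k < n \<longrightarrow> ((\<lambda>r. p k (of_real r * \<zeta>)) \<longlongrightarrow> M) (at_left 1)"
      using p_conv[of \<zeta>] \<zeta>1 n(2) by auto
    then obtain M where M: "\<And>k. k < n \<Longrightarrow> ((\<lambda>r. p k (of_real r * \<zeta>)) \<longlongrightarrow> M k) (at_left 1)" by metis
    define T where "T r = h (of_real r * \<zeta>) - (\<Sum>k<n. p k (of_real r * \<zeta>))" for r :: real
    have T: "(T \<longlongrightarrow> L - (\<Sum>k<n. M k)) (at_left 1)"
      unfolding T_def using L[unfolded has_radial_limit_def] by (intro tendsto_intros M) auto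
    \<comment> \<open>The real part of the n-th term swings from at least 3e to at most -3e; with an
      error e from the tail at each end, \<open>T\<close> moves by at least 4e, whereas convergence
      allows less than 2e.\<close>
    define e where "e = c ^ n * \<kappa> / 3"
    have "e > 0" using c \<kappa> by (simp add: e_def)
    with T have "\<forall>\<^sub>F r in at_left 1. dist (T r) (L - (\<Sum>k<n. M k)) < e" by (rule tendstoD)
    then obtain \<rho> where \<rho>: "\<rho> < 1" "\<And>r. \<rho> < r \<Longrightarrow> r < 1 \<Longrightarrow> dist (T r) (L - (\<Sum>k<n. M k)) < e"
      unfolding eventually_at_left_field by auto
    obtain r s where rs: "\<rho> < r" "0 < r" "r < 1" "\<rho> < s" "0 < s" "s < 1"
      "\<kappa> \<le> Re (winding_power (W n) (of_real r * \<zeta>))" "Re (winding_power (W n) (of_real s * \<zeta>)) \<le> - \<kappa>"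
      using winding_power_oscillates[OF holomorphic_on_imp_continuous_on[OF W(1)] W(2) W(3)[OF n(1)] \<zeta>1 \<rho>(1)]
      unfolding \<kappa>_def by blast
    have T_near: "\<bar>Re (T t) - c ^ n * Re (winding_power (W n) (of_real t * \<zeta>))\<bar> \<le> e" if "0 < t" "t < 1" for t
    proof -
      have t: "norm (of_real t * \<zeta>) < 1" using that \<zeta>1 by (simp add: norm_radial)
      have "T t = (\<Sum>j. p (j + Suc n) (of_real t * \<zeta>)) + p n (of_real t * \<zeta>)"
        unfolding T_def split[OF t, of "Suc n"] by simp
      then have "T t - of_real (c ^ n) * winding_power (W n) (of_real t * \<zeta>) = (\<Sum>j. p (j + Suc n) (of_real t * \<zeta>))"
        by (simp add: p_def)
      then have "norm (T t - of_real (c ^ n) * winding_power (W n) (of_real t * \<zeta>)) \<le> c ^ Suc n * (4/3)"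
        using tail_le[OF t, of "Suc n"] by simp
      also have "\<dots> = e" by (simp add: e_def c_def)
      finally have "\<bar>Re (T t - of_real (c ^ n) * winding_power (W n) (of_real t * \<zeta>))\<bar> \<le> e"
        using abs_Re_le_cmod order_trans by blast
      then show ?thesis by (simp del: of_real_power)
    qed
    have "dist (T r) (T s) < 2 * e"
      using \<rho>(2)[OF rs(1,3)] \<rho>(2)[OF rs(4,6)] dist_triangle2[of "T r" "T s" "L - (\<Sum>k<n. M k)"] by linarith
    moreover have "Re (T r) - Re (T s) \<le> dist (T r) (T s)"
      using complex_Re_le_cmod[of "T r - T s"] by (simp add: dist_norm)
    moreover have "c ^ n * \<kappa> \<le> c ^ n * Re (winding_power (W n) (of_real r * \<zeta>))"
      using rs c by (intro mult_left_mono) auto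
    moreover have "c ^ n * Re (winding_power (W n) (of_real s * \<zeta>)) \<le> c ^ n * - \<kappa>"
      using rs c by (intro mult_left_mono) auto
    moreover note T_near[OF rs(2,3)] T_near[OF rs(5,6)]
    moreover have "c ^ n * \<kappa> = 3 * e" "c ^ n * - \<kappa> = - (3 * e)" by (auto simp: e_def)
    ultimately show False using \<open>e > 0\<close> unfolding abs_le_iff by linarith
  qed
  show ?thesis
  proof (intro exI[of _ h] conjI allI impI hol h_le)
    show "{\<zeta> \<in> unit_circle. \<not> (\<exists>L. has_radial_limit h L \<zeta>)} = (\<Union>n. E n)"
      using conv nconv sub by blast
  qed auto
qed

section \<open>Descriptive type of the two boundary sets\<close>

text \<open>The negated Cauchy criterion: for some tolerance \<open>k n\<close> and every
  \<open>m\<close> there are two radii beyond \<open>1 - k m\<close> at which the values of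
  \<open>f\<close> differ by more than \<open>k n\<close>. For fixed radii this is an open condition
  on \<zeta>, by continuity in the disc.\<close>

lemma gdelta_sigma_no_radial_limit:
  assumes cont: "continuous_on (ball 0 1) f"
  shows "gdelta_sigma_in (top_of_set unit_circle) {\<zeta> \<in> unit_circle. \<not> (\<exists>L. has_radial_limit f L \<zeta>)}"
proof -
  define k where "k n = inverse (real (Suc n))" for n
  define U where "U n m = (\<Union>r\<in>{1 - k m<..<1} \<inter> {0<..}. \<Union>s\<in>{1 - k m<..<1} \<inter> {0<..}.
    {\<zeta> \<in> unit_circle. k n < dist (f (of_real r * \<zeta>)) (f (of_real s * \<zeta>))})" for n m
  have k_small: "\<exists>n. k n < e" if "e > 0" for e
    unfolding k_def using reals_Archimedean[OF that] .
  have k_pos: "k n > 0" for n by (simp add: k_def)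
  have openin_U: "openin (top_of_set unit_circle) (U n m)" for n m
  proof -
    have *: "openin (top_of_set unit_circle) {\<zeta> \<in> unit_circle. k n < dist (f (of_real r * \<zeta>)) (f (of_real s * \<zeta>))}"
      if rs: "r \<in> {1 - k m<..<1} \<inter> {0<..}" "s \<in> {1 - k m<..<1} \<inter> {0<..}" for r s
    proof -
      have "continuous_on unit_circle (\<lambda>\<zeta>. dist (f (of_real r * \<zeta>)) (f (of_real s * \<zeta>)))"
        by (intro continuous_intros continuous_on_compose2[OF cont]) (use rs in \<open>auto simp: norm_radial\<close>)
      from continuous_openin_preimage_gen[OF this open_greaterThan[of "k n"]]
      show ?thesis by (simp add: vimage_def Int_def)
    qed
    show ?thesis
      unfolding U_def
      by (rule openin_Union, elim imageE, simp only:, rule openin_Union, elim imageE, simp only:, rule *)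
  qed
  have "{\<zeta> \<in> unit_circle. \<not> (\<exists>L. has_radial_limit f L \<zeta>)} = (\<Union>n. \<Inter>m. U n m)"
  proof (intro equalityI subsetI)
    fix \<zeta> assume \<zeta>: "\<zeta> \<in> {\<zeta> \<in> unit_circle. \<not> (\<exists>L. has_radial_limit f L \<zeta>)}"
    show "\<zeta> \<in> (\<Union>n. \<Inter>m. U n m)"
    proof (rule ccontr)
      assume out: "\<zeta> \<notin> (\<Union>n. \<Inter>m. U n m)"
      have "\<exists>L. has_radial_limit f L \<zeta>"
        unfolding has_radial_limit_def
      proof (rule ex_tendsto_if_approximable)
        fix e :: real assume "e > 0"
        then obtain n where n: "k n < e" using k_small by blast
        obtain m where m: "\<zeta> \<notin> U n m" using out by blast
        define a where "a = max (1 - k m) 0"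
        have a: "a < 1" using k_pos[of m] by (simp add: a_def)
        then obtain s where s: "a < s" "s < 1" using dense by blast
        have "dist (f (of_real r * \<zeta>)) (f (of_real s * \<zeta>)) \<le> e" if "a < r" "r < 1" for r
        proof -
          have "\<not> k n < dist (f (of_real r * \<zeta>)) (f (of_real s * \<zeta>))"
            using m \<zeta> that s unfolding U_def by (auto simp: a_def)
          then show ?thesis using n by linarith
        qed
        then have "\<forall>\<^sub>F r in at_left 1. dist (f (of_real r * \<zeta>)) (f (of_real s * \<zeta>)) \<le> e"
          using eventually_at_left_real[OF a] by (auto elim: eventually_mono)
        then show "\<exists>g l. (g \<longlongrightarrow> l) (at_left 1) \<and> (\<forall>\<^sub>F r in at_left 1. dist (f (of_real r * \<zeta>)) (g r) \<le> e)"
          by (intro exI[of _ "\<lambda>_. f (of_real s * \<zeta>)"]) auto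
      qed simp
      with \<zeta> show False by simp
    qed
  next
    fix \<zeta> assume "\<zeta> \<in> (\<Union>n. \<Inter>m. U n m)"
    then obtain n where n: "\<And>m. \<zeta> \<in> U n m" by blast
    have "\<not> has_radial_limit f L \<zeta>" for L
    proof
      assume "has_radial_limit f L \<zeta>"
      then have "\<forall>\<^sub>F r in at_left 1. dist (f (of_real r * \<zeta>)) L < k n / 2"
        unfolding has_radial_limit_def by (rule tendstoD) (rule half_gt_zero[OF k_pos])
      then obtain b where b: "b < 1" "\<And>r. b < r \<Longrightarrow> r < 1 \<Longrightarrow> dist (f (of_real r * \<zeta>)) L < k n / 2"
        unfolding eventually_at_left_field by auto
      obtain m where m: "k m < 1 - b" using k_small[of "1 - b"] b(1) by auto
      obtain r s where rs': "1 - k m < r" "r < 1" "1 - k m < s" "s < 1"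
        "k n < dist (f (of_real r * \<zeta>)) (f (of_real s * \<zeta>))"
        using n[of m] unfolding U_def by auto
      then have rs: "b < r" "r < 1" "b < s" "s < 1" "k n < dist (f (of_real r * \<zeta>)) (f (of_real s * \<zeta>))"
        using m by linarith+
      show False
        using b(2)[OF rs(1,2)] b(2)[OF rs(3,4)] rs(5) dist_triangle2[of "f (of_real r * \<zeta>)" "f (of_real s * \<zeta>)" L]
        by linarith
    qed
    moreover have "\<zeta> \<in> unit_circle" using n[of 0] unfolding U_def by blast
    ultimately show "\<zeta> \<in> {\<zeta> \<in> unit_circle. \<not> (\<exists>L. has_radial_limit f L \<zeta>)}" by simp
  qed
  also have "gdelta_sigma_in (top_of_set unit_circle) (\<Union>n. \<Inter>m. U n m)"
  proof -
    have "gdelta_in (top_of_set unit_circle) (\<Inter>m. U n m)" for n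
      by (rule gdelta_in_Inter) (auto intro!: open_imp_gdelta_in openin_U)
    then show ?thesis
      unfolding gdelta_sigma_in_def union_of_def
      by (intro exI[of _ "range (\<lambda>n. \<Inter>m. U n m)"]) auto
  qed
  finally show ?thesis .
qed

text \<open>A vanishing limit means that for each \<open>n\<close> some ball around the point
  carries |f| at most \<open>k n\<close> on its part in the disc. The balls collected in
  \<open>U n\<close> may have any centre, which makes \<open>U n\<close> open at once.\<close>

lemma gdelta_vanishing_unrestricted_limit:
  "gdelta_in (top_of_set unit_circle) {\<zeta> \<in> unit_circle. has_unrestricted_limit f 0 \<zeta>}"
proof -
  define k where "k n = inverse (real (Suc n))" for n
  define U where "U n = \<Union>{ball w d | w d. \<forall>z\<in>ball 0 1 \<inter> ball w d. norm (f z) \<le> k n}" for n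
  have open_U: "open (U n)" for n unfolding U_def by (rule open_Union) auto
  have "{\<zeta> \<in> unit_circle. has_unrestricted_limit f 0 \<zeta>} = (\<Inter>n. unit_circle \<inter> U n)"
  proof (intro equalityI subsetI)
    fix \<zeta> assume \<zeta>: "\<zeta> \<in> {\<zeta> \<in> unit_circle. has_unrestricted_limit f 0 \<zeta>}"
    have "\<zeta> \<in> U n" for n
    proof -
      have "\<forall>\<^sub>F z in at \<zeta> within ball 0 1. dist (f z) 0 < k n"
        using \<zeta> by (intro tendstoD) (auto simp: has_unrestricted_limit_def k_def)
      then obtain d where d: "d > 0" "\<And>z. z \<in> ball 0 1 \<Longrightarrow> z \<noteq> \<zeta> \<Longrightarrow> dist z \<zeta> < d \<Longrightarrow> norm (f z) < k n"
        unfolding eventually_at by auto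
      have "\<forall>z\<in>ball 0 1 \<inter> ball \<zeta> d. norm (f z) \<le> k n"
      proof
        fix z assume z: "z \<in> ball 0 1 \<inter> ball \<zeta> d"
        then have "z \<noteq> \<zeta>" using \<zeta> by auto
        then show "norm (f z) \<le> k n" using d(2)[of z] z by (simp add: dist_commute less_imp_le)
      qed
      then show ?thesis unfolding U_def using d(1) by (intro UnionI[of "ball \<zeta> d"]) auto
    qed
    with \<zeta> show "\<zeta> \<in> (\<Inter>n. unit_circle \<inter> U n)" by auto
  next
    fix \<zeta> assume \<zeta>: "\<zeta> \<in> (\<Inter>n. unit_circle \<inter> U n)"
    have "(f \<longlongrightarrow> 0) (at \<zeta> within ball 0 1)"
    proof (rule tendstoI)
      fix e :: real assume "e > 0"
      then obtain n where n: "k n < e" unfolding k_def using reals_Archimedean[OF \<open>e > 0\<close>] by blast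
      have "\<zeta> \<in> U n" using \<zeta> by blast
      then obtain w d where d: "\<zeta> \<in> ball w d" "\<And>z. z \<in> ball 0 1 \<Longrightarrow> z \<in> ball w d \<Longrightarrow> norm (f z) \<le> k n"
        unfolding U_def by blast
      have "\<forall>\<^sub>F z in at \<zeta> within ball 0 1. z \<in> ball w d"
        unfolding eventually_at_topological using d(1) open_ball by blast
      moreover have "\<forall>\<^sub>F z in at \<zeta> within ball 0 1. z \<in> ball 0 1" by (auto simp: eventually_at_filter)
      ultimately show "\<forall>\<^sub>F z in at \<zeta> within ball 0 1. dist (f z) 0 < e"
      proof eventually_elim
        case (elim z)
        then show ?case using d(2)[of z] n by simp
      qed
    qed
    with \<zeta> show "\<zeta> \<in> {\<zeta> \<in> unit_circle. has_unrestricted_limit f 0 \<zeta>}" by (auto simp: has_unrestricted_limit_def)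
  qed
  also have "gdelta_in (top_of_set unit_circle) (\<Inter>n. unit_circle \<inter> U n)"
    by (rule gdelta_in_Inter) (auto intro!: open_imp_gdelta_in openin_open_Int open_U)
  finally show ?thesis .
qed

lemma gdelta_sigma_sequence:
  assumes "gdelta_sigma_in X E"
  shows "\<exists>G :: nat \<Rightarrow> 'a set. (\<forall>n. gdelta_in X (G n)) \<and> E = (\<Union>n. G n)"
proof -
  obtain \<U> where U: "countable \<U>" "\<U> \<subseteq> Collect (gdelta_in X)" "\<Union>\<U> = E"
    using assms unfolding gdelta_sigma_in_def union_of_def by blast
  \<comment> \<open>Adding the empty set, itself a G-delta, guarantees a nonempty family to
    enumerate.\<close>
  define G where "G = from_nat_into (insert {} \<U>)"
  have r: "range G = insert {} \<U>"
    unfolding G_def using U(1) by (intro range_from_nat_into) auto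
  have "gdelta_in X (G n)" for n
  proof -
    have "G n \<in> insert {} \<U>" using r by blast
    then show ?thesis using U(2) by (elim insertE) auto
  qed
  moreover have "E = (\<Union>n. G n)" using r U(3) by auto
  ultimately show ?thesis by (intro exI[of _ G]) simp
qed

lemma radial_limit_if_unrestricted_limit:
  assumes "has_unrestricted_limit f L \<zeta>" "norm \<zeta> = 1"
  shows "has_radial_limit f L \<zeta>"
  using filterlim_compose[OF _ filterlim_radius[OF assms(2)]] assms(1)
  unfolding has_unrestricted_limit_def has_radial_limit_def by blast

section \<open>Assembly of the function and the equivalence\<close>

text \<open>On \<open>E2\<close> the factor \<open>inverse (1 + W z)\<close> has a nonzero radial
  limit, so it neither creates nor destroys radial limits of \<open>h\<close>, and \<open>f\<close>
  cannot tend to 0 there. Off \<open>E2\<close> it forces \<open>f\<close> to 0, which hides no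
  point of \<open>E1\<close> because \<open>E1\<close> is contained in \<open>E2\<close>.\<close>

theorem ex_function_with_prescribed_boundary_behaviour:
  assumes sub: "E1 \<subseteq> E2" "E2 \<subseteq> unit_circle"
    and E1: "gdelta_sigma_in (top_of_set unit_circle) E1" "E1 \<in> null_sets arc_length"
    and E2: "fsigma_in (top_of_set unit_circle) E2" "unit_circle - E2 \<in> null_sets arc_length"
  shows "\<exists>f \<in> H_infinity. {\<zeta> \<in> unit_circle. \<not> (\<exists>L. has_radial_limit f L \<zeta>)} = E1 \<and>
    {\<zeta> \<in> unit_circle. has_unrestricted_limit f 0 \<zeta>} = unit_circle - E2"
proof -
  obtain G :: "nat \<Rightarrow> complex set" where G: "\<And>n. gdelta_in (top_of_set unit_circle) (G n)" "E1 = (\<Union>n. G n)"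
    using gdelta_sigma_sequence[OF E1(1)] by auto
  have "G n \<in> null_sets arc_length" for n
    using E1(2) unfolding G(2) arc_length_def by (rule null_sets_completion_subset[rotated]) auto
  then have "\<forall>n. \<exists>W. W holomorphic_on ball 0 1 \<and> (\<forall>z. norm z < 1 \<longrightarrow> Re (W z) \<ge> 0) \<and>
    (\<forall>\<zeta>\<in>G n. filterlim W at_infinity (at \<zeta> within ball 0 1)) \<and>
    (\<forall>\<zeta>\<in>unit_circle - G n. \<exists>L. has_radial_limit W L \<zeta>)"
    by (intro allI ex_radial_limits_infinite_on_null_gdelta G(1))
  from choice[OF this] obtain Wn where Wn: "\<And>n. Wn n holomorphic_on ball 0 1" "\<And>n z. norm z < 1 \<Longrightarrow> Re (Wn n z) \<ge> 0"
    "\<And>n \<zeta>. \<zeta> \<in> G n \<Longrightarrow> filterlim (Wn n) at_infinity (at \<zeta> within ball 0 1)"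
    "\<And>n \<zeta>. \<zeta> \<in> unit_circle - G n \<Longrightarrow> \<exists>L. has_radial_limit (Wn n) L \<zeta>" by blast
  have "G n \<subseteq> unit_circle" for n using gdelta_in_subset[OF G(1)[of n]] by simp
  from ex_bounded_holomorphic_no_radial_limit_on[of Wn G, OF Wn this]
  obtain h where h: "h holomorphic_on ball 0 1"
    "\<And>z. norm z < 1 \<Longrightarrow> norm (h z) \<le> 2" "{\<zeta> \<in> unit_circle. \<not> (\<exists>L. has_radial_limit h L \<zeta>)} = E1"
    unfolding G(2) by auto
  have "gdelta_in (top_of_set unit_circle) (unit_circle - E2)"
    using E2(1) by (simp add: fsigma_in_gdelta_in)
  from ex_radial_limits_infinite_on_null_gdelta[OF this E2(2)] obtain W where W: "W holomorphic_on ball 0 1"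
    "\<And>z. norm z < 1 \<Longrightarrow> Re (W z) \<ge> 0"
    "\<And>\<zeta>. \<zeta> \<in> unit_circle - E2 \<Longrightarrow> filterlim W at_infinity (at \<zeta> within ball 0 1)"
    "\<And>\<zeta>. \<zeta> \<in> unit_circle - (unit_circle - E2) \<Longrightarrow> \<exists>L. has_radial_limit W L \<zeta>" by auto
  note W1 = norm_ge_1_add_if_Re_nonneg[OF W(2)]
  \<comment> \<open>Adding 3 to \<open>h\<close>, of modulus at most 2, keeps the numerator between
    1 and 5 in modulus: \<open>f\<close> is bounded, and its vanishing is decided by the denominator
    alone.\<close>
  define f where "f z = (h z + 3) * inverse (1 + W z)" for z
  have h3: "1 \<le> norm (h z + 3)" "norm (h z + 3) \<le> 5" if "norm z < 1" for z
    using h(2)[OF that] norm_triangle_ineq[of "h z" 3] norm_triangle_ineq2[of 3 "- h z"] by (simp_all add: add.commute)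
  have "f holomorphic_on ball 0 1"
    unfolding f_def using W1(2) by (intro holomorphic_intros h W) auto
  moreover have f_le: "norm (f z) \<le> 5" if "norm z < 1" for z
    using mult_mono[OF h3(2)[OF that] W1(3)[OF that]] by (simp add: f_def norm_mult)
  ultimately have "f \<in> H_infinity"
    unfolding H_infinity_def by (auto intro!: boundedI[of _ 5])
  have vanish: "has_unrestricted_limit f 0 \<zeta>" if \<zeta>: "\<zeta> \<in> unit_circle - E2" for \<zeta>
    unfolding has_unrestricted_limit_def
  proof (rule Lim_null_comparison)
    show "\<forall>\<^sub>F z in at \<zeta> within ball 0 1. norm (f z) \<le> 5 * norm (inverse (1 + W z))"
      unfolding eventually_at_filter using h3(2)
      by (auto simp: f_def norm_mult intro!: always_eventually mult_right_mono)
    have "filterlim (\<lambda>z. 1 + W z) at_infinity (at \<zeta> within ball 0 1)"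
      by (rule tendsto_add_filterlim_at_infinity[OF tendsto_const W(3)[OF \<zeta>]])
    from filterlim_compose[OF tendsto_inverse_0 this]
    show "((\<lambda>z. 5 * norm (inverse (1 + W z))) \<longlongrightarrow> 0) (at \<zeta> within ball 0 1)"
      by (intro tendsto_mult_right_zero tendsto_norm_zero)
  qed
  have off: "\<exists>l. l \<noteq> 0 \<and> has_radial_limit (\<lambda>z. inverse (1 + W z)) l \<zeta>" if \<zeta>: "\<zeta> \<in> E2" for \<zeta>
  proof -
    have \<zeta>1: "norm \<zeta> = 1" using \<zeta> sub by auto
    obtain L where L: "has_radial_limit W L \<zeta>" using W(4)[of \<zeta>] \<zeta> \<zeta>1 by auto
    have "Re L \<ge> 0"
    proof (rule tendsto_lowerbound[OF tendsto_Re[OF L[unfolded has_radial_limit_def]]])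
      show "\<forall>\<^sub>F r in at_left 1. 0 \<le> Re (W (of_real r * \<zeta>))"
        by (rule eventually_at_left_1) (auto intro!: W(2) simp: norm_radial \<zeta>1)
    qed simp
    then have ne: "1 + L \<noteq> 0" by (rule norm_ge_1_add_if_Re_nonneg(2))
    then have "has_radial_limit (\<lambda>z. inverse (1 + W z)) (inverse (1 + L)) \<zeta>"
      using L unfolding has_radial_limit_def by (intro tendsto_intros)
    with ne show ?thesis by (intro exI[of _ "inverse (1 + L)"]) auto
  qed
  have not_vanish: "\<not> has_unrestricted_limit f 0 \<zeta>" if \<zeta>: "\<zeta> \<in> E2" for \<zeta>
  proof
    assume "has_unrestricted_limit f 0 \<zeta>"
    moreover have \<zeta>1: "norm \<zeta> = 1" using \<zeta> sub by auto
    ultimately have f0: "has_radial_limit f 0 \<zeta>" by (rule radial_limit_if_unrestricted_limit)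
    obtain l where l: "l \<noteq> 0" "has_radial_limit (\<lambda>z. inverse (1 + W z)) l \<zeta>" using off[OF \<zeta>] by blast
    have "norm l \<le> norm (0 :: complex)"
    proof (rule tendsto_le[OF _ tendsto_norm[OF f0[unfolded has_radial_limit_def]] tendsto_norm[OF l(2)[unfolded has_radial_limit_def]]])
      show "\<forall>\<^sub>F r in at_left 1. norm (inverse (1 + W (of_real r * \<zeta>))) \<le> norm (f (of_real r * \<zeta>))"
      proof (rule eventually_at_left_1)
        fix r :: real assume "0 < r" "r < 1"
        then have "norm (of_real r * \<zeta>) < 1" using \<zeta>1 by (simp add: norm_radial)
        from mult_right_mono[OF h3(1)[OF this], of "norm (inverse (1 + W (of_real r * \<zeta>)))"]
        show "norm (inverse (1 + W (of_real r * \<zeta>))) \<le> norm (f (of_real r * \<zeta>))"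
          by (simp add: f_def norm_mult)
      qed
    qed simp
    with l(1) show False by simp
  qed
  have iff: "(\<exists>L. has_radial_limit f L \<zeta>) \<longleftrightarrow> (\<exists>L. has_radial_limit h L \<zeta>)" if \<zeta>: "\<zeta> \<in> E2" for \<zeta>
  proof -
    have \<zeta>1: "norm \<zeta> = 1" using \<zeta> sub by auto
    obtain l where l: "l \<noteq> 0" "((\<lambda>r. inverse (1 + W (of_real r * \<zeta>))) \<longlongrightarrow> l) (at_left 1)"
      using off[OF \<zeta>] unfolding has_radial_limit_def by blast
    show ?thesis
    proof
      assume "\<exists>L. has_radial_limit h L \<zeta>"
      then obtain L where "((\<lambda>r. h (of_real r * \<zeta>)) \<longlongrightarrow> L) (at_left 1)" unfolding has_radial_limit_def by blast
      then have "((\<lambda>r. f (of_real r * \<zeta>)) \<longlongrightarrow> (L + 3) * l) (at_left 1)"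
        unfolding f_def by (intro tendsto_intros l(2))
      then show "\<exists>L. has_radial_limit f L \<zeta>" unfolding has_radial_limit_def by blast
    next
      assume "\<exists>L. has_radial_limit f L \<zeta>"
      then obtain L where "((\<lambda>r. f (of_real r * \<zeta>)) \<longlongrightarrow> L) (at_left 1)" unfolding has_radial_limit_def by blast
      then have "((\<lambda>r. f (of_real r * \<zeta>) / inverse (1 + W (of_real r * \<zeta>)) - 3) \<longlongrightarrow> L / l - 3) (at_left 1)"
        by (intro tendsto_diff tendsto_divide tendsto_const l)
      moreover have "\<forall>\<^sub>F r in at_left 1. f (of_real r * \<zeta>) / inverse (1 + W (of_real r * \<zeta>)) - 3 = h (of_real r * \<zeta>)"
      proof (rule eventually_at_left_1)
        fix r :: real assume "0 < r" "r < 1"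
        then have "norm (of_real r * \<zeta>) < 1" using \<zeta>1 by (simp add: norm_radial)
        from W1(2)[OF this] show "f (of_real r * \<zeta>) / inverse (1 + W (of_real r * \<zeta>)) - 3 = h (of_real r * \<zeta>)"
          by (simp add: f_def)
      qed
      ultimately have "((\<lambda>r. h (of_real r * \<zeta>)) \<longlongrightarrow> L / l - 3) (at_left 1)" by (rule Lim_transform_eventually)
      then show "\<exists>L. has_radial_limit h L \<zeta>" unfolding has_radial_limit_def by blast
    qed
  qed
  have conv_F: "\<exists>L. has_radial_limit f L \<zeta>" if "\<zeta> \<in> unit_circle - E2" for \<zeta>
    using radial_limit_if_unrestricted_limit[OF vanish[OF that]] that by auto
  have "{\<zeta> \<in> unit_circle. \<not> (\<exists>L. has_radial_limit f L \<zeta>)} = E1"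
  proof -
    have "{\<zeta> \<in> unit_circle. \<not> (\<exists>L. has_radial_limit f L \<zeta>)} = {\<zeta> \<in> E2. \<not> (\<exists>L. has_radial_limit h L \<zeta>)}"
      using iff conv_F sub by blast
    also have "\<dots> = E1" using h(3) sub by blast
    finally show ?thesis .
  qed
  moreover have "{\<zeta> \<in> unit_circle. has_unrestricted_limit f 0 \<zeta>} = unit_circle - E2"
    using vanish not_vanish by blast
  ultimately show ?thesis using \<open>f \<in> H_infinity\<close> by blast
qed

theorem theorem6:
  fixes E1 E2 :: "complex set"
  assumes "E1 \<subseteq> E2"
    and "E2 \<subseteq> unit_circle"
    and "E2 \<in> sets arc_length"
    and "emeasure arc_length E2 = ennreal (2 * pi)"
  shows "(\<exists>f \<in> H_infinity.
            {\<zeta> \<in> unit_circle. \<not> (\<exists>L. has_radial_limit f L \<zeta>)} = E1 \<and>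
            {\<zeta> \<in> unit_circle. has_unrestricted_limit f 0 \<zeta>} = unit_circle - E2)
         \<longleftrightarrow>
         (gdelta_sigma_in (top_of_set unit_circle) E1 \<and> E1 \<in> null_sets arc_length) \<and>
         fsigma_in (top_of_set unit_circle) E2"
proof -
  have "(gdelta_sigma_in (top_of_set unit_circle) E1 \<and> E1 \<in> null_sets arc_length) \<and>
      fsigma_in (top_of_set unit_circle) E2"
    if f: "f \<in> H_infinity" "{\<zeta> \<in> unit_circle. \<not> (\<exists>L. has_radial_limit f L \<zeta>)} = E1"
      "{\<zeta> \<in> unit_circle. has_unrestricted_limit f 0 \<zeta>} = unit_circle - E2" for f
  proof (intro conjI)
    have hol: "f holomorphic_on ball 0 1" and "bounded (f ` ball 0 1)" using f(1) by (auto simp: H_infinity_def)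
    then obtain B where "\<forall>x\<in>f ` ball 0 1. norm x \<le> B" unfolding bounded_iff by blast
    then have B: "norm (f z) \<le> B" if "norm z < 1" for z using that by simp
    have "\<exists>N \<in> null_sets circle_measure. E1 \<subseteq> N"
      using Fatou_radial_limit[OF hol B] unfolding f(2) .
    then show "E1 \<in> null_sets arc_length"
      using assms by (subst null_sets_arc_length_iff) auto
    show "gdelta_sigma_in (top_of_set unit_circle) E1"
      using gdelta_sigma_no_radial_limit[OF holomorphic_on_imp_continuous_on[OF hol]] unfolding f(2) .
    show "fsigma_in (top_of_set unit_circle) E2"
      using gdelta_vanishing_unrestricted_limit[of f] assms(2) unfolding f(3) by (simp add: fsigma_in_gdelta_in)
  qed
  moreover have T: "unit_circle \<in> sets arc_length"
    using sets.top[of arc_length] by simp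
  \<comment> \<open>Full measure of \<open>E2\<close> becomes nullity of its complement, the
    hypothesis under which the denominator is built.\<close>
  have "emeasure arc_length (unit_circle - E2) = emeasure arc_length unit_circle - emeasure arc_length E2"
    by (rule emeasure_Diff) (use assms T in auto)
  then have "unit_circle - E2 \<in> null_sets arc_length"
    using assms(3,4) T by (auto simp: null_sets_def emeasure_arc_length_unit_circle)
  note ex_function_with_prescribed_boundary_behaviour[OF assms(1,2) _ _ _ this]
  ultimately show ?thesis by blast
qed

end
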